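(* Let $N\ge 3$ be odd, $q=e^{2\pi\sqrt{-1}/N}$ (so $q^N=1$), and let $L$ be a positive multiple of $N$. Then the transfer matrix $\tau_{\mathrm{NBS}}(z)$ of the nilpotent Bazhanov-Stroganov model has the $L(\mathfrak{sl}_2)$ symmetry in the sector $W=\{v\in(\mathbb{C}^N)^{\otimes L}: A^2v=v\}$: the operators $\hat H_i,\hat E_i,\hat F_i$ ($i=0,1$) on $W$ give a representation of the loop algebra $L(\mathfrak{sl}_2)$ on $W$ commuting with the transfer matrix, i.e. on $W$, for every $z\in\mathbb{C}\setminus\{0\}$ and $i=0,1$, $$[\tau_{\mathrm{NBS}}(z),\hat H_i]=[\tau_{\mathrm{NBS}}(z),\hat E_i]=[\tau_{\mathrm{NBS}}(z),\hat F_i]=0 .$$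
   Context: Basis and generic representation. Let $v_0,\dots,v_{N-1}$ be the standard basis of $\mathbb{C}^N$, with $v_{-1}=v_N=0$ below. For $q$ generic (with a chosen $q^{1/2}$), $[m]=\frac{q^m-q^{-m}}{q-q^{-1}}$, $[m]!=\prod_{i=1}^m[i]$, the $N$-dimensional irreducible representation of $U_q(\mathfrak{sl}_2)$ is $$\hat k^{1/2}v_\sigma=q^{\frac{N-1}{2}-\sigma}v_\sigma,\quad \hat f v_\sigma=[\sigma+1]v_{\sigma+1},\quad \hat e v_\sigma=[N-\sigma]v_{\sigma-1},$$ where $\hat f v_{N-1}=0$ and $\hat e v_0=0$. The limit $q^N\to1$ means $q^{1/2}\to e^{\pi\sqrt{-1}/N}$, so $q\to e^{2\pi\sqrt{-1}/N}$ and $q^{N/2}\to-1$. (At this value, $\hat k^{1/2}=-q^{-1/2}Z^{-1}$, $\hat e=X^{-1}\frac{Z^{-1}-Z}{q-q^{-1}}$, $\hat f=\frac{Z-Z^{-1}}{q-q^{-1}}X$ with $Zv_\sigma=q^\sigma v_\sigma$, $Xv_\sigma=v_{\sigma+1\bmod N}$.) A subscript $i$ denotes action on the $i$th factor of $(\mathbb{C}^N)^{\otimes L}$. Transfer matrix. Put $$\mathcal{L}_i(z)=\begin{pmatrix} q^{-1/2}(z\hat k_i^{1/2}-z^{-1}\hat k_i^{-1/2}) & (q-q^{-1})\hat f_i\\ (q-q^{-1})\hat e_i & q^{1/2}(z\hat k_i^{-1/2}-z^{-1}\hat k_i^{1/2})\end{pmatrix},$$ $$\mathcal{T}(z)=\mathcal{L}_L(z)\cdots\mathcal{L}_2(z)\mathcal{L}_1(z)=\begin{pmatrix}A(z)&B(z)\\C(z)&D(z)\end{pmatrix},\qquad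 \tau(z)=A(z)+D(z),$$ and $\tau_{\mathrm{NBS}}(z)=\tau(z)|_{q=e^{2\pi\sqrt{-1}/N}}$ (the nilpotent Bazhanov-Stroganov model). Generators. For generic $q$ set $A=(\hat k^{1/2})^{\otimes L}$ and $$B_\pm=q^{-\frac12(L+1)}\sum_{i=1}^Lq^i(\hat k^{\mp1/2})^{\otimes(i-1)}\otimes\hat f\otimes(\hat k^{\pm1/2})^{\otimes(L-i)},$$ $$C_\pm=q^{\frac12(L+1)}\sum_{i=1}^Lq^{-i}(\hat k^{\pm1/2})^{\otimes(i-1)}\otimes\hat e\otimes(\hat k^{\mp1/2})^{\otimes(L-i)}.$$ Then, using the same symbol $A$ at $q=e^{2\pi\sqrt{-1}/N}$, $$B_\pm^{(N)}=\lim_{q^N\to1}\frac{(B_\pm)^N}{[N]!},\quad C_\pm^{(N)}=\lim_{q^N\to1}\frac{(C_\pm)^N}{[N]!},\quad H^{(N)}=\frac1N\sum_{i=1}^L\hat h_i,\quad \hat h=\mathrm{diag}(N-1,N-3,\dots,-N+1)$$ ($\hat h v_\sigma=(N-1-2\sigma)v_\sigma$). Define $$\hat H_0=-\hat H_1=-H^{(N)},\quad \hat E_0=B_+^{(N)},\quad \hat E_1=C_+^{(N)},\quad \hat F_0=C_-^{(N)},\quad \hat F_1=B_-^{(N)}.$$ Loop algebra. $L(\mathfrak{sl}_2)=\mathfrak{sl}_2\otimes\mathbb{C}[t,t^{-1}]$ has Chevalley generators $H_i,E_i,F_i$ ($i=0,1$) with relations $H_0+H_1=0$, $[H_i,E_j]=a_{ij}E_j$,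 $[H_i,F_j]=-a_{ij}F_j$, $[E_i,F_j]=\delta_{ij}H_i$, and $(\mathrm{ad}\,E_i)^3E_j=(\mathrm{ad}\,F_i)^3F_j=0$ for $i\ne j$, where $a_{00}=a_{11}=2$, $a_{01}=a_{10}=-2$. The representation sends $H_i,E_i,F_i$ to $\hat H_i,\hat E_i,\hat F_i$. *)

theory Defs
  imports Complex_Main "HOL-Library.Poly_Mapping" "Jordan_Normal_Form.Matrix"
begin

section \<open>Tensor powers of matrices\<close>

text \<open>A configuration \<open>(\<sigma>\<^sub>1, \<dots>, \<sigma>\<^sub>L)\<close> with all \<open>\<sigma>\<^sub>i < N\<close> indexes the basis vector
  \<open>v\<^bsub>\<sigma>\<^sub>1\<^esub> \<otimes> \<dots> \<otimes> v\<^bsub>\<sigma>\<^sub>L\<^esub>\<close>; its position in \<open>{0..<N^L}\<close> is the number with base-\<open>N\<close> digits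
  \<open>\<sigma>\<^sub>1 \<dots> \<sigma>\<^sub>L\<close>, the first tensor factor being the most significant digit.\<close>

definition kronecker :: "complex mat \<Rightarrow> complex mat \<Rightarrow> complex mat" (infixr "\<otimes>\<^sub>K" 72) where
  "X \<otimes>\<^sub>K Y = mat (dim_row X * dim_row Y) (dim_col X * dim_col Y)
     (\<lambda>(a, b). X $$ (a div dim_row Y, b div dim_col Y) * Y $$ (a mod dim_row Y, b mod dim_col Y))"

definition tensor_list :: "complex mat list \<Rightarrow> complex mat" where
  "tensor_list Xs = foldr (\<otimes>\<^sub>K) Xs (1\<^sub>m 1)"

definition at_site :: "nat \<Rightarrow> nat \<Rightarrow> nat \<Rightarrow> complex mat \<Rightarrow> complex mat" where
  "at_site N L i X = tensor_list (replicate (i - 1) (1\<^sub>m N) @ [X] @ replicate (L - i) (1\<^sub>m N))"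

definition mat_sum :: "nat \<Rightarrow> (nat \<Rightarrow> complex mat) \<Rightarrow> nat set \<Rightarrow> complex mat" where
  "mat_sum d F I = mat d d (\<lambda>(a, b). \<Sum>i\<in>I. F i $$ (a, b))"

definition mat_lim :: "nat \<Rightarrow> complex filter \<Rightarrow> (complex \<Rightarrow> complex mat) \<Rightarrow> complex mat" where
  "mat_lim d \<F> F = mat d d (\<lambda>(a, b). Lim \<F> (\<lambda>s. F s $$ (a, b)))"

definition commutator :: "'a :: ring mat \<Rightarrow> 'a mat \<Rightarrow> 'a mat" where
  "commutator X Y = X * Y - Y * X"


section \<open>The generic \<open>N\<close>-dimensional representation\<close>

text \<open>The parameter \<open>s\<close> is the chosen square root \<open>q\<^bsup>1/2\<^esup>\<close>, so \<open>q = s\<^sup>2\<close>.\<close>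

definition q_int :: "complex \<Rightarrow> nat \<Rightarrow> complex" where
  "q_int s m = ((s\<^sup>2) ^ m - inverse (s\<^sup>2) ^ m) / (s\<^sup>2 - inverse (s\<^sup>2))"

definition q_fact :: "complex \<Rightarrow> nat \<Rightarrow> complex" where
  "q_fact s m = (\<Prod>i = 1..m. q_int s i)"

definition k_half :: "nat \<Rightarrow> complex \<Rightarrow> complex mat" where
  "k_half N s = mat N N (\<lambda>(a, b). if a = b then s powi (int N - 1 - 2 * int b) else 0)"

definition k_half_inv :: "nat \<Rightarrow> complex \<Rightarrow> complex mat" where
  "k_half_inv N s = mat N N (\<lambda>(a, b). if a = b then s powi (- (int N - 1 - 2 * int b)) else 0)"

definition f_op :: "nat \<Rightarrow> complex \<Rightarrow> complex mat" where
  "f_op N s = mat N N (\<lambda>(a, b). if a = b + 1 then q_int s (b + 1) else 0)"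

definition e_op :: "nat \<Rightarrow> complex \<Rightarrow> complex mat" where
  "e_op N s = mat N N (\<lambda>(a, b). if a + 1 = b then q_int s (N - b) else 0)"

definition h_op :: "nat \<Rightarrow> complex mat" where
  "h_op N = mat N N (\<lambda>(a, b). if a = b then of_int (int N - 1 - 2 * int b) else 0)"


section \<open>The transfer matrix\<close>

text \<open>A quadruple \<open>(A, B, C, D)\<close> stands for the \<open>2 \<times> 2\<close> matrix with rows \<open>(A, B)\<close> and \<open>(C, D)\<close>,
  whose entries are operators on the tensor power.\<close>

type_synonym block = "complex mat \<times> complex mat \<times> complex mat \<times> complex mat"

fun block_mult :: "block \<Rightarrow> block \<Rightarrow> block" where
  "block_mult (A, B, C, D) (A', B', C', D') =
     (A * A' + B * C', A * B' + B * D', C * A' + D * C', C * B' + D * D')"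

definition lax :: "nat \<Rightarrow> nat \<Rightarrow> complex \<Rightarrow> complex \<Rightarrow> nat \<Rightarrow> block" where
  "lax N L s z i =
    (inverse s \<cdot>\<^sub>m (z \<cdot>\<^sub>m at_site N L i (k_half N s) - inverse z \<cdot>\<^sub>m at_site N L i (k_half_inv N s)),
     (s\<^sup>2 - inverse (s\<^sup>2)) \<cdot>\<^sub>m at_site N L i (f_op N s),
     (s\<^sup>2 - inverse (s\<^sup>2)) \<cdot>\<^sub>m at_site N L i (e_op N s),
     s \<cdot>\<^sub>m (z \<cdot>\<^sub>m at_site N L i (k_half_inv N s) - inverse z \<cdot>\<^sub>m at_site N L i (k_half N s)))"

fun monodromy :: "nat \<Rightarrow> nat \<Rightarrow> complex \<Rightarrow> complex \<Rightarrow> nat \<Rightarrow> block" where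
  "monodromy N L s z 0 = (1\<^sub>m (N ^ L), 0\<^sub>m (N ^ L) (N ^ L), 0\<^sub>m (N ^ L) (N ^ L), 1\<^sub>m (N ^ L))"
| "monodromy N L s z (Suc i) = block_mult (lax N L s z (Suc i)) (monodromy N L s z i)"

definition transfer_matrix :: "nat \<Rightarrow> nat \<Rightarrow> complex \<Rightarrow> complex \<Rightarrow> complex mat" where
  "transfer_matrix N L s z = (case monodromy N L s z L of (A, B, C, D) \<Rightarrow> A + D)"

text \<open>The value of \<open>q\<^bsup>1/2\<^esup>\<close> at \<open>q = exp (2\<pi>\<i>/N)\<close>; it satisfies \<open>q\<^bsup>N/2\<^esup> = -1\<close>.\<close>

definition s_root :: "nat \<Rightarrow> complex" where
  "s_root N = cis (pi / real N)"

definition tau_NBS :: "nat \<Rightarrow> nat \<Rightarrow> complex \<Rightarrow> complex mat" where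
  "tau_NBS N L z = transfer_matrix N L (s_root N) z"


section \<open>The generators and the sector\<close>

definition A_op :: "nat \<Rightarrow> nat \<Rightarrow> complex \<Rightarrow> complex mat" where
  "A_op N L s = tensor_list (replicate L (k_half N s))"

text \<open>\<open>\<Sum>\<^sub>i c\<^sub>i X\<^bsup>\<otimes>(i-1)\<^esup> \<otimes> Y \<otimes> Z\<^bsup>\<otimes>(L-i)\<^esup>\<close>, with \<open>i\<close> running from 1 to \<open>L\<close>\<close>

definition twisted_sum ::
  "nat \<Rightarrow> nat \<Rightarrow> (nat \<Rightarrow> complex) \<Rightarrow> complex mat \<Rightarrow> complex mat \<Rightarrow> complex mat \<Rightarrow> complex mat" where
  "twisted_sum N L c X Y Z =
     mat_sum (N ^ L) (\<lambda>i. c i \<cdot>\<^sub>m tensor_list (replicate (i - 1) X @ [Y] @ replicate (L - i) Z)) {1..L}"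

definition B_plus :: "nat \<Rightarrow> nat \<Rightarrow> complex \<Rightarrow> complex mat" where
  "B_plus N L s = s powi (- (int L + 1)) \<cdot>\<^sub>m
     twisted_sum N L (\<lambda>i. (s\<^sup>2) ^ i) (k_half_inv N s) (f_op N s) (k_half N s)"

definition B_minus :: "nat \<Rightarrow> nat \<Rightarrow> complex \<Rightarrow> complex mat" where
  "B_minus N L s = s powi (- (int L + 1)) \<cdot>\<^sub>m
     twisted_sum N L (\<lambda>i. (s\<^sup>2) ^ i) (k_half N s) (f_op N s) (k_half_inv N s)"

definition C_plus :: "nat \<Rightarrow> nat \<Rightarrow> complex \<Rightarrow> complex mat" where
  "C_plus N L s = s powi (int L + 1) \<cdot>\<^sub>m
     twisted_sum N L (\<lambda>i. inverse (s\<^sup>2) ^ i) (k_half N s) (e_op N s) (k_half_inv N s)"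

definition C_minus :: "nat \<Rightarrow> nat \<Rightarrow> complex \<Rightarrow> complex mat" where
  "C_minus N L s = s powi (int L + 1) \<cdot>\<^sub>m
     twisted_sum N L (\<lambda>i. inverse (s\<^sup>2) ^ i) (k_half_inv N s) (e_op N s) (k_half N s)"

text \<open>The denominator \<open>[N]!\<close> vanishes at \<open>s = s_root N\<close> but at no other point of some
  neighbourhood of it. \<open>Lim\<close> is an unspecified value unless the limit exists.\<close>

definition divided_power_limit ::
  "nat \<Rightarrow> nat \<Rightarrow> (complex \<Rightarrow> complex mat) \<Rightarrow> complex mat" where
  "divided_power_limit N L X =
     mat_lim (N ^ L) (at (s_root N)) (\<lambda>s. (1 / q_fact s N) \<cdot>\<^sub>m (X s ^\<^sub>m N))"

definition H_N :: "nat \<Rightarrow> nat \<Rightarrow> complex mat" where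
  "H_N N L = (1 / of_nat N) \<cdot>\<^sub>m mat_sum (N ^ L) (\<lambda>i. at_site N L i (h_op N)) {1..L}"

definition H_hat :: "nat \<Rightarrow> nat \<Rightarrow> nat \<Rightarrow> complex mat" where
  "H_hat N L i = (if i = 0 then - H_N N L else H_N N L)"

definition E_hat :: "nat \<Rightarrow> nat \<Rightarrow> nat \<Rightarrow> complex mat" where
  "E_hat N L i = divided_power_limit N L (if i = 0 then B_plus N L else C_plus N L)"

definition F_hat :: "nat \<Rightarrow> nat \<Rightarrow> nat \<Rightarrow> complex mat" where
  "F_hat N L i = divided_power_limit N L (if i = 0 then C_minus N L else B_minus N L)"

definition sector :: "nat \<Rightarrow> nat \<Rightarrow> complex vec set" where
  "sector N L = {v \<in> carrier_vec (N ^ L). (A_op N L (s_root N) ^\<^sub>m 2) *\<^sub>v v = v}"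


section \<open>The loop algebra\<close>

text \<open>\<open>int \<Rightarrow>\<^sub>0 complex\<close> with its convolution product is the Laurent polynomial ring
  \<open>\<complex>[t, t\<^sup>-\<^sup>1]\<close>, and \<open>sl\<^sub>2 \<otimes> \<complex>[t, t\<^sup>-\<^sup>1]\<close> is identified with the traceless \<open>2 \<times> 2\<close> matrices over it,
  with the commutator as Lie bracket.\<close>

type_synonym laurent = "int \<Rightarrow>\<^sub>0 complex"

definition loop_sl2 :: "laurent mat set" where
  "loop_sl2 = {X \<in> carrier_mat 2 2. X $$ (0, 0) + X $$ (1, 1) = 0}"

abbreviation laurent_const :: "complex \<Rightarrow> laurent" where
  "laurent_const c \<equiv> Poly_Mapping.single 0 c"

abbreviation t_pow :: "int \<Rightarrow> laurent" where
  "t_pow n \<equiv> Poly_Mapping.single n 1"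

definition unit_mat2 :: "nat \<Rightarrow> nat \<Rightarrow> laurent \<Rightarrow> laurent mat" where
  "unit_mat2 i j p = mat 2 2 (\<lambda>(a, b). if a = i \<and> b = j then p else 0)"

text \<open>\<open>E\<^sub>1 = e\<close>, \<open>F\<^sub>1 = f\<close>, \<open>H\<^sub>1 = h\<close>, \<open>E\<^sub>0 = f \<otimes> t\<close>, \<open>F\<^sub>0 = e \<otimes> t\<^sup>-\<^sup>1\<close>, \<open>H\<^sub>0 = -h\<close>\<close>

definition loop_E :: "nat \<Rightarrow> laurent mat" where
  "loop_E i = (if i = 0 then unit_mat2 1 0 (t_pow 1) else unit_mat2 0 1 1)"

definition loop_F :: "nat \<Rightarrow> laurent mat" where
  "loop_F i = (if i = 0 then unit_mat2 0 1 (t_pow (- 1)) else unit_mat2 1 0 1)"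

definition loop_H :: "nat \<Rightarrow> laurent mat" where
  "loop_H i = (if i = 0 then unit_mat2 1 1 1 - unit_mat2 0 0 1 else unit_mat2 0 0 1 - unit_mat2 1 1 1)"

definition cartan :: "nat \<Rightarrow> nat \<Rightarrow> complex" where
  "cartan i j = (if i = j then 2 else - 2)"

definition loop_sl2_representation ::
  "complex vec set \<Rightarrow> (laurent mat \<Rightarrow> complex vec \<Rightarrow> complex vec) \<Rightarrow> bool" where
  "loop_sl2_representation W \<rho> \<longleftrightarrow>
     (\<forall>X\<in>loop_sl2. (\<forall>v\<in>W. \<rho> X v \<in> W)
        \<and> (\<forall>v\<in>W. \<forall>w\<in>W. \<rho> X (v + w) = \<rho> X v + \<rho> X w)
        \<and> (\<forall>c. \<forall>v\<in>W. \<rho> X (c \<cdot>\<^sub>v v) = c \<cdot>\<^sub>v \<rho> X v)) \<and>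
     (\<forall>X\<in>loop_sl2. \<forall>Y\<in>loop_sl2. \<forall>v\<in>W. \<rho> (X + Y) v = \<rho> X v + \<rho> Y v) \<and>
     (\<forall>c. \<forall>X\<in>loop_sl2. \<forall>v\<in>W. \<rho> (laurent_const c \<cdot>\<^sub>m X) v = c \<cdot>\<^sub>v \<rho> X v) \<and>
     (\<forall>X\<in>loop_sl2. \<forall>Y\<in>loop_sl2. \<forall>v\<in>W. \<rho> (commutator X Y) v = \<rho> X (\<rho> Y v) - \<rho> Y (\<rho> X v))"

lemma laurent_const_2: "laurent_const 2 = 2" "laurent_const (- 2) = - 2"
  by (simp_all add: single_numeral single_uminus)

lemma loop_chevalley_in: "loop_H i \<in> loop_sl2" "loop_E i \<in> loop_sl2" "loop_F i \<in> loop_sl2"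
  by (auto simp: loop_H_def loop_E_def loop_F_def unit_mat2_def loop_sl2_def)

lemmas loop_simps = loop_H_def loop_E_def loop_F_def unit_mat2_def commutator_def cartan_def
  scalar_prod_def mult_single laurent_const_2

lemma loop_chevalley_relations:
  assumes "i \<in> {0, 1}" "j \<in> {0, 1}"
  shows "loop_H 0 + loop_H 1 = 0\<^sub>m 2 2"
    and "commutator (loop_H i) (loop_E j) = laurent_const (cartan i j) \<cdot>\<^sub>m loop_E j"
    and "commutator (loop_H i) (loop_F j) = laurent_const (- cartan i j) \<cdot>\<^sub>m loop_F j"
    and "commutator (loop_E i) (loop_F j) = (if i = j then loop_H i else 0\<^sub>m 2 2)"
    and "i \<noteq> j \<Longrightarrow> commutator (loop_E i) (commutator (loop_E i) (commutator (loop_E i) (loop_E j))) = 0\<^sub>m 2 2"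
    and "i \<noteq> j \<Longrightarrow> commutator (loop_F i) (commutator (loop_F i) (commutator (loop_F i) (loop_F j))) = 0\<^sub>m 2 2"
  using assms
  by (auto intro!: eq_matI simp: loop_simps less_2_cases_iff numeral_2_eq_2 sum.atLeast0_lessThan_Suc)

end

theory Submission
  imports Defs
begin

text \<open>At generic \<open>q\<close> the pairs \<open>(C\<^sub>-, B\<^sub>+)\<close> and \<open>(C\<^sub>+, B\<^sub>-)\<close> generate copies of \<open>U\<^sub>q(sl\<^sub>2)\<close> with \<open>K = A\<^sup>2\<close>,
  while \<open>B\<^sub>+\<close> commutes with \<open>B\<^sub>-\<close> and \<open>C\<^sub>+\<close> with \<open>C\<^sub>-\<close>. The \<open>q\<close>-binomial formula, applied site by site,
  shows that the divided powers converge at the root of unity. In Kac's formula for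
  \<open>[C\<^bsup>(N)\<^esup>, B\<^bsup>(N)\<^esup>]\<close> on vectors of weight \<open>\<lambda>\<close>, all terms but the last one contain a factor \<open>[\<lambda>]\<close>, which
  tends to 0 if \<open>N\<close> divides \<open>\<lambda>\<close>, as is the case on the sector, and the last term tends to \<open>\<lambda>/N\<close>. The
  Serre relations need no higher order \<open>q\<close>-Serre identities: with respect to the adjoint action of an \<open>sl\<^sub>2\<close>
  with bounded weights, a lowest weight vector of weight \<open>-2\<close> is killed by the third power of the raising
  operator. The elements \<open>e \<otimes> t\<^sup>k, f \<otimes> t\<^sup>k, h \<otimes> t\<^sup>k\<close> are then obtained from the Chevalley generators by
  iterating \<open>ad (h \<otimes> t\<^bsup>\<plusminus>1\<^esup>)\<close>.

  For the transfer matrix, carrying the auxiliary space past the chain intertwines the two coproducts of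
  a generator \<open>X\<close>. The resulting relations between \<open>X\<close> and the entries of the monodromy matrix express
  \<open>[\<tau>, X\<^sup>n/[n]!]\<close> through terms with scalar factors \<open>q\<^bsup>\<plusminus>n\<^esup> - 1\<close> and one term ending in \<open>x A\<^sup>-\<^sup>1 - y A\<close> (or with
  \<open>A\<close> and \<open>A\<^sup>-\<^sup>1\<close> exchanged). For \<open>n = N\<close> and \<open>q\<^sup>N = 1\<close> the former vanish, \<open>x = y\<close> because \<open>N\<close> divides \<open>L\<close>, and
  \<open>A = A\<^sup>-\<^sup>1\<close> on the sector.\<close>

section \<open>Complex algebras\<close>

text \<open>At the root of unity [N]! is zero, and the relation between E and F holds only on the
  sector. Identities involving divided powers of order N are therefore proved for all nearby
  parameters s, where q is generic, and pass to the limit entrywise. That the divided powers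
  converge at all rests on the vanishing N-th powers of the local raising and lowering operators.
  The limits are then multiplied by the projection onto the weights divisible by N, which commutes
  with them because they shift weights by plus or minus 2N; after this the Chevalley relations hold
  as identities in an algebra and not merely on vectors. That such relations produce the whole loop
  algebra is shown by hand and not taken from a presentation theorem. Oddness of N enters twice: [m]
  is nonzero at the root for 0 < m < N, and the sign (-1)^(N-1) in the limit of the Gaussian
  binomial is 1.\<close>

class complex_alg = ring_1 +
  fixes csc :: "complex \<Rightarrow> 'a \<Rightarrow> 'a" (infixr "*\<^sub>c" 75)
  assumes csc_add_right: "c *\<^sub>c (x + y) = c *\<^sub>c x + c *\<^sub>c y"
    and csc_add_left: "(c + d) *\<^sub>c x = c *\<^sub>c x + d *\<^sub>c x"
    and csc_csc [simp]: "c *\<^sub>c d *\<^sub>c x = (c * d) *\<^sub>c x"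
    and csc_one [simp]: "1 *\<^sub>c x = x"
    and csc_mult_left [simp]: "(c *\<^sub>c x) * y = c *\<^sub>c (x * y)"
    and csc_mult_right [simp]: "x * (c *\<^sub>c y) = c *\<^sub>c (x * y)"
begin

lemma csc_zero_left [simp]: "0 *\<^sub>c x = 0"
  using csc_add_left[of 0 0 x] by simp

lemma csc_zero_right [simp]: "c *\<^sub>c 0 = 0"
  using csc_add_right[of c 0 0] by simp

lemma csc_minus_left [simp]: "(- c) *\<^sub>c x = - (c *\<^sub>c x)"
  using csc_add_left[of c "- c" x] by (simp add: eq_neg_iff_add_eq_0 add.commute)

lemma csc_minus_right [simp]: "c *\<^sub>c (- x) = - (c *\<^sub>c x)"
  using csc_add_right[of c x "- x"] by (simp add: eq_neg_iff_add_eq_0 add.commute)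

lemma csc_diff_left: "(c - d) *\<^sub>c x = c *\<^sub>c x - d *\<^sub>c x"
  using csc_add_left[of c "- d" x] by simp

lemma csc_diff_right: "c *\<^sub>c (x - y) = c *\<^sub>c x - c *\<^sub>c y"
  using csc_add_right[of c x "- y"] by simp

lemma csc_sum_right: "c *\<^sub>c sum g A = (\<Sum>a\<in>A. c *\<^sub>c g a)"
  by (induct A rule: infinite_finite_induct) (auto simp: csc_add_right)

lemma csc_eq_0_iff [simp]: "c *\<^sub>c x = 0 \<longleftrightarrow> c = 0 \<or> x = 0"
proof
  assume a: "c *\<^sub>c x = 0"
  show "c = 0 \<or> x = 0"
  proof (rule disjCI)
    assume "x \<noteq> 0"
    show "c = 0"
    proof (rule ccontr)
      assume "c \<noteq> 0"
      then have "x = inverse c *\<^sub>c c *\<^sub>c x" by simp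
      with a \<open>x \<noteq> 0\<close> show False by simp
    qed
  qed
qed auto

lemma csc_cancel: "c \<noteq> 0 \<Longrightarrow> c *\<^sub>c x = c *\<^sub>c y \<longleftrightarrow> x = y"
  using csc_eq_0_iff[of c "x - y"] by (simp add: csc_diff_right)

lemma csc_power: "(c *\<^sub>c x) ^ n = c ^ n *\<^sub>c x ^ n"
  by (induct n) (auto simp: mult_ac)

definition br :: "'a \<Rightarrow> 'a \<Rightarrow> 'a" where "br x y = x * y - y * x"

lemma br_self [simp]: "br x x = 0" by (simp add: br_def)
lemma br_swap: "br x y = - br y x" by (simp add: br_def)
lemma br_zero [simp]: "br 0 x = 0" "br x 0 = 0" by (simp_all add: br_def)
lemma br_minus [simp]: "br (- x) y = - br x y" "br x (- y) = - br x y"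
  by (simp_all add: br_def)
lemma br_csc [simp]: "br (c *\<^sub>c x) y = c *\<^sub>c br x y" "br x (c *\<^sub>c y) = c *\<^sub>c br x y"
  by (simp_all add: br_def csc_diff_right)
lemma br_add: "br (x + x') y = br x y + br x' y" "br x (y + y') = br x y + br x y'"
  by (simp_all add: br_def algebra_simps)
lemma br_leibniz_right: "br a (br x y) = br (br a x) y + br x (br a y)"
  by (simp add: br_def algebra_simps)
lemma br_leibniz_left: "br (br x y) a = br (br x a) y + br x (br y a)"
  by (simp add: br_def algebra_simps)
end

section \<open>The loop algebra from Chevalley generators\<close>

text \<open>\<open>e k\<close> and \<open>f k\<close> stand for e and f times t^k, and
  \<open>h0\<close>, \<open>h1\<close>, \<open>h1'\<close> for h times 1, t, t^-1. The shifts are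
  given in all degrees, the other brackets only in a few low ones; the rest is forced by bracketing
  these with Cartan elements.\<close>

locale loop_skeleton =
  fixes e f :: "int \<Rightarrow> 'a::complex_alg" and h0 h1 h1' :: 'a
  assumes h1_e: "br h1 (e k) = 2 *\<^sub>c e (k + 1)"
    and h1'_e: "br h1' (e k) = 2 *\<^sub>c e (k - 1)"
    and h1_f: "br h1 (f k) = - (2 *\<^sub>c f (k + 1))"
    and h1'_f: "br h1' (f k) = - (2 *\<^sub>c f (k - 1))"
    and h0_e: "br h0 (e k) = 2 *\<^sub>c e k"
    and h0_f: "br h0 (f k) = - (2 *\<^sub>c f k)"
    and e0_f0: "br (e 0) (f 0) = h0"
    and em_f1: "br (e (- 1)) (f 1) = h0"
    and e0_f1: "br (e 0) (f 1) = h1"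
    and em_f0: "br (e (- 1)) (f 0) = h1'"
    and e_comm: "br (e 0) (e 1) = 0" "br (e 0) (e (- 1)) = 0" "br (e (- 1)) (e (- 2)) = 0"
    and f_comm: "br (f 0) (f 1) = 0" "br (f 0) (f (- 1)) = 0" "br (f 1) (f 2) = 0"
begin

text \<open>Inverting t negates degrees; the extra shifts by -1 and 1 preserve the degrees 0, -1 of
  e and 0, 1 of f that occur in the assumptions. Results in nonnegative total degree thus carry over
  to negative ones.\<close>

lemma mirror: "loop_skeleton (\<lambda>k. e (- 1 - k)) (\<lambda>k. f (1 - k)) h0 h1' h1"
proof
  show "br (e (- 1 - 0)) (e (- 1 - (- 1))) = 0" using e_comm(2) br_swap[of "e (- 1)" "e 0"] by simp
  show "br (f (1 - 0)) (f (1 - 1)) = 0" using f_comm(1) br_swap[of "f 1" "f 0"] by simp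
qed (use e_comm f_comm e0_f0 em_f1 e0_f1 em_f0 in
  \<open>simp_all add: h1_e h1'_e h1_f h1'_f h0_e h0_f algebra_simps\<close>)

text \<open>The Chevalley involution composed with inversion of t; it yields the brackets of the f's
  from those of the e's.\<close>

lemma flip: "loop_skeleton (\<lambda>k. f (- k)) (\<lambda>k. e (- k)) (- h0) (- h1') (- h1)"
proof
  show "br (f (- 0)) (e (- 0)) = - h0" using br_swap[of "f 0" "e 0"] by (simp add: e0_f0)
  show "br (f (- (- 1))) (e (- 1)) = - h0" using br_swap[of "f 1" "e (- 1)"] by (simp add: em_f1)
  show "br (f (- 0)) (e (- 1)) = - h1'" using br_swap[of "f 0" "e (- 1)"] by (simp add: em_f0)
  show "br (f (- (- 1))) (e (- 0)) = - h1" using br_swap[of "f 1" "e 0"] by (simp add: e0_f1)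
qed (use e_comm f_comm in \<open>simp_all add: h1_e h1'_e h1_f h1'_f h0_e h0_f\<close>)

section \<open>Brackets among the e's\<close>

lemma h1_ee: "br h1 (br (e k) (e m)) = 2 *\<^sub>c (br (e (k + 1)) (e m) + br (e k) (e (m + 1)))"
  by (subst br_leibniz_right) (simp add: h1_e csc_add_right)

lemma h1'_ee: "br h1' (br (e k) (e m)) = 2 *\<^sub>c (br (e (k - 1)) (e m) + br (e k) (e (m - 1)))"
  by (subst br_leibniz_right) (simp add: h1'_e csc_add_right)

lemma h1_ef: "br h1 (br (e k) (f m)) = 2 *\<^sub>c (br (e (k + 1)) (f m) - br (e k) (f (m + 1)))"
  by (subst br_leibniz_right) (simp add: h1_e h1_f csc_diff_right)

lemma h1'_ef: "br h1' (br (e k) (f m)) = 2 *\<^sub>c (br (e (k - 1)) (f m) - br (e k) (f (m - 1)))"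
  by (subst br_leibniz_right) (simp add: h1'_e h1'_f csc_diff_right)

text \<open>Bracketing a vanishing expression of degree d with \<open>h1\<close> relates two
  brackets of degree d + 1, one of which is already known. Alternating \<open>h1\<close> and
  \<open>h1'\<close> zigzags outwards from the assumed cases within the degrees -1, 0, 1.\<close>

lemma ee_low_nat:
  "br (e (int k)) (e (- int k)) = 0 \<and> br (e (int k + 1)) (e (- int k)) = 0 \<and>
   br (e (int k)) (e (- int k - 1)) = 0"
proof (induct k)
  case 0
  show ?case using e_comm br_swap[of "e 1" "e 0"] by simp
next
  case (Suc k)
  have 1: "br (e (int k + 1)) (e (- int k - 1)) = 0"
    using h1_ee[of "int k" "- int k - 1"] Suc by simp
  have 2: "br (e (int k + 2)) (e (- int k - 1)) = 0"
    using h1_ee[of "int k + 1" "- int k - 1"] 1 Suc by (simp add: algebra_simps minus_diff_commute)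
  have 3: "br (e (int k + 1)) (e (- int k - 2)) = 0"
    using h1'_ee[of "int k + 1" "- int k - 1"] 1 Suc by (simp add: algebra_simps minus_diff_commute)
  from 1 2 3 show ?case by (simp add: algebra_simps minus_diff_commute)
qed

lemma ee_low: "k + m \<in> {- 1, 0, 1} \<Longrightarrow> br (e k) (e m) = 0"
proof -
  have *: "br (e k) (e m) = 0" if "k + m \<in> {- 1, 0, 1}" "k \<ge> m" for k m
  proof (cases "k \<ge> 0")
    case True
    then obtain n where n: "k = int n" using nonneg_int_cases by blast
    show ?thesis
    proof (cases "k + m = 1")
      case True
      show ?thesis
      proof (cases n)
        case 0
        then show ?thesis using True that n by simp
      next
        case (Suc j)
        then have "m = - int j" using True n by simp
        then show ?thesis using ee_low_nat[of j] n Suc by (simp add: add.commute)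
      qed
    next
      case False
      then have "m = - int n \<or> m = - int n - 1" using that n by auto
      then show ?thesis using ee_low_nat[of n] n by auto
    qed
  next
    case False
    then have "k = m" using that by auto
    then show ?thesis by simp
  qed
  assume "k + m \<in> {- 1, 0, 1}"
  then show ?thesis using *[of k m] *[of m k] br_swap[of "e k" "e m"]
    by (cases "k \<ge> m") (auto simp: add.commute)
qed

text \<open>This is h times t^2. In odd total degree the recursion obtained from \<open>h1\<close>
  only says that neighbouring brackets differ by a sign, which is compatible with antisymmetry and
  does not force them to vanish; hence a second shift.\<close>

definition h2 where "h2 = br (e 1) (f 1)"

lemma h1_h0: "br h1 h0 = 0"
  unfolding e0_f1[symmetric]
  by (subst br_leibniz_left) (simp add: br_swap[of "e 0" h0] br_swap[of "f 1" h0] h0_e h0_f)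

lemma h1'_h0: "br h1' h0 = 0"
  unfolding em_f0[symmetric]
  by (subst br_leibniz_left) (simp add: br_swap[of "e (-1)" h0] br_swap[of "f 0" h0] h0_e h0_f)

lemma e1_f0: "br (e 1) (f 0) = h1"
  using h1_ef[of 0 0] by (simp add: e0_f0 h1_h0 e0_f1)

lemma em_f0': "br (e 0) (f (- 1)) = h1'"
  using h1'_ef[of 0 0] by (simp add: e0_f0 h1'_h0 em_f0)

lemma h1_h1': "br h1 h1' = 0"
  using h1_ef[of "- 1" 0] by (simp add: e0_f0 em_f0 em_f1)

lemma h2_eq: "h2 = br (e 0) (f 2)"
  using h1_ef[of 0 1] by (simp add: e0_f1 h2_def)

lemma h2_h1': "br h2 h1' = 0"
proof -
  have "br h1' h2 = 0"
    unfolding h2_def by (simp add: h1'_ef e0_f1 e1_f0)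
  then show ?thesis using br_swap[of h2 h1'] by simp
qed

lemma h2_e0: "br h2 (e 0) = 2 *\<^sub>c e 2"
  unfolding h2_def
  by (subst br_leibniz_left)
     (use e_comm br_swap[of "e 1" "e 0"] br_swap[of "f 1" "e 0"] br_swap[of "e 1" h1] h1_e[of 1]
       in \<open>simp add: e0_f1\<close>)

lemma h2_f1: "br h2 (f 1) = - (2 *\<^sub>c f 3)"
  unfolding h2_eq
  by (subst br_leibniz_left)
     (use f_comm br_swap[of "f 2" "f 1"] h1_f[of 2] in \<open>simp add: e0_f1\<close>)

text \<open>The two forms of \<open>h2\<close> give two expressions for \<open>br h1 h2\<close>,
  whose sum is the expression for \<open>br h2 h1\<close> obtained from
  \<open>h1 = br (e 0) (f 1)\<close>. So \<open>br h2 h1\<close> equals minus twice itself.\<close>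

lemma h2_h1: "br h2 h1 = 0"
proof -
  have a: "br h2 h1 = 2 *\<^sub>c (br (e 2) (f 1) - br (e 0) (f 3))"
    unfolding e0_f1[symmetric]
    by (subst br_leibniz_right) (simp add: h2_e0 h2_f1 csc_diff_right)
  have b: "br h1 h2 = 2 *\<^sub>c (br (e 2) (f 1) - br (e 1) (f 2))"
    unfolding h2_def by (simp add: h1_ef)
  have c: "br h1 h2 = 2 *\<^sub>c (br (e 1) (f 2) - br (e 0) (f 3))"
    unfolding h2_eq by (simp add: h1_ef)
  have "2 *\<^sub>c br h2 h1 = 2 *\<^sub>c (br h1 h2 + br h1 h2)"
    unfolding a by (subst b, subst c) (simp add: csc_diff_right csc_add_right)
  then have "br h2 h1 = - (br h2 h1 + br h2 h1)"
    by (simp add: csc_cancel br_swap[of h1 h2])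
  then have "br h2 h1 + (br h2 h1 + br h2 h1) = 0"
    by (simp only: eq_neg_iff_add_eq_0)
  then have "3 *\<^sub>c br h2 h1 = 0"
    using csc_add_left[of 2 1 "br h2 h1"] csc_add_left[of 1 1 "br h2 h1"]
    by (simp add: add.assoc)
  then show ?thesis by simp
qed

text \<open>\<open>h2\<close> commutes with \<open>h1\<close> and \<open>h1'\<close>, which reach
  every \<open>e k\<close> from \<open>e 0\<close> up to factors 2.\<close>

lemma h2_e: "br h2 (e k) = 2 *\<^sub>c e (k + 2)"
proof (induct k rule: int_induct[where k = 0])
  case base
  show ?case by (simp add: h2_e0)
next
  case (step1 i)
  have "2 *\<^sub>c br h2 (e (i + 1)) = br h2 (br h1 (e i))" by (simp add: h1_e)
  also have "\<dots> = br h1 (br h2 (e i))" by (subst br_leibniz_right) (simp add: h2_h1)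
  also have "\<dots> = 2 *\<^sub>c 2 *\<^sub>c e (i + 3)"
    using h1_e[of "i + 2"] unfolding step1 by (simp add: add.commute)
  finally show ?case by (simp add: csc_cancel del: csc_csc) (simp add: algebra_simps)
next
  case (step2 i)
  have "2 *\<^sub>c br h2 (e (i - 1)) = br h2 (br h1' (e i))" by (simp add: h1'_e)
  also have "\<dots> = br h1' (br h2 (e i))" by (subst br_leibniz_right) (simp add: h2_h1')
  also have "\<dots> = 2 *\<^sub>c 2 *\<^sub>c e (i + 1)"
    using h1'_e[of "i + 2"] unfolding step2 by (simp add: add.commute)
  finally show ?case by (simp add: csc_cancel add.commute del: csc_csc)
qed

text \<open>If the brackets of total degree \<open>l\<close> vanish, comparing \<open>ad h\<^sub>2\<close> with \<open>(ad h\<^sub>1)\<^sup>2\<close> on them kills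
  the mixed terms in degree \<open>l + 2\<close>.\<close>

lemma ee_step:
  assumes "\<And>k m. k + m = l \<Longrightarrow> br (e k) (e m) = 0" and "k + m = l + 2"
  shows "br (e k) (e m) = 0"
proof -
  have z: "br (e (k - 1)) (e (m - 1)) = 0" using assms by simp
  have "br h2 (br (e (k - 1)) (e (m - 1))) = 2 *\<^sub>c (br (e (k + 1)) (e (m - 1)) + br (e (k - 1)) (e (m + 1)))"
    by (subst br_leibniz_right) (simp add: h2_e csc_add_right algebra_simps)
  with z have 1: "br (e (k + 1)) (e (m - 1)) + br (e (k - 1)) (e (m + 1)) = 0" by simp
  have 2: "br (e k) (e (m - 1)) + br (e (k - 1)) (e m) = 0"
    using h1_ee[of "k - 1" "m - 1"] z by simp
  have "br h1 (br (e k) (e (m - 1)) + br (e (k - 1)) (e m)) =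
    2 *\<^sub>c ((br (e (k + 1)) (e (m - 1)) + br (e (k - 1)) (e (m + 1))) + 2 *\<^sub>c br (e k) (e m))"
    using csc_add_left[of 1 1 "br (e k) (e m)"]
    by (simp add: br_add h1_ee csc_add_right algebra_simps)
  with 1 2 show ?thesis by simp
qed

lemma ee_nonneg: "k + m = int n \<Longrightarrow> br (e k) (e m) = 0"
proof (induct n arbitrary: k m rule: less_induct)
  case (less n)
  show ?case
  proof (cases "n < 2")
    case True
    then have "n = 0 \<or> n = 1" by auto
    then show ?thesis using less(2) ee_low[of k m] by auto
  next
    case False
    show ?thesis
      proof (rule ee_step[of "int (n - 2)"])
      show "br (e k') (e m') = 0" if "k' + m' = int (n - 2)" for k' m'
        using less(1)[of "n - 2" k' m'] that False by simp
    qed (use less(2) False in simp)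
  qed
qed

end

text \<open>The mirrored skeleton turns total degree d into -2 - d, so its nonnegative degrees cover
  d \<le> -2, and only d = -1 remains.\<close>

lemma (in loop_skeleton) ee: "br (e k) (e m) = 0"
proof -
  interpret m: loop_skeleton "\<lambda>k. e (- 1 - k)" "\<lambda>k. f (1 - k)" h0 h1' h1 by (rule mirror)
  show ?thesis
  proof (cases "k + m \<ge> 0")
    case True
    then show ?thesis using ee_nonneg[of k m "nat (k + m)"] by simp
  next
    case False
    show ?thesis
    proof (cases "k + m = - 1")
      case True
      then show ?thesis using ee_low[of k m] by simp
    next
      case neq: False
      show ?thesis using m.ee_nonneg[of "- 1 - k" "- 1 - m" "nat (- 2 - k - m)"] False neq by simp
    qed
  qed
qed

lemma (in loop_skeleton) ff: "br (f k) (f m) = 0"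
proof -
  interpret m: loop_skeleton "\<lambda>k. f (- k)" "\<lambda>k. e (- k)" "- h0" "- h1'" "- h1" by (rule flip)
  show ?thesis using m.ee[of "- k" "- m"] by simp
qed

section \<open>Brackets of the e's with the f's\<close>

context loop_skeleton
begin

lemma ef_low:
  "br (e k) (f (- k)) = h0 \<and> br (e (k + 1)) (f (- k)) = h1 \<and> br (e k) (f (- k - 1)) = h1'"
proof (induct k rule: int_induct[where k = 0])
  case base
  show ?case by (simp add: e0_f0 e1_f0 em_f0')
next
  case (step1 i)
  have 1: "br (e (i + 1)) (f (- i - 1)) = h0"
    using h1_ef[of i "- i - 1"] step1 by (simp add: h1_h1')
  have 2: "br (e (i + 2)) (f (- i - 1)) = h1"
    using h1_ef[of "i + 1" "- i - 1"] step1 1 by (simp add: h1_h0 algebra_simps minus_diff_commute)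
  have 3: "br (e (i + 1)) (f (- i - 2)) = h1'"
    using h1'_ef[of "i + 1" "- i - 1"] step1 1 by (simp add: h1'_h0 algebra_simps minus_diff_commute)
  from 1 2 3 show ?case by (simp add: algebra_simps minus_diff_commute)
next
  case (step2 i)
  have 0: "br (e (i - 1)) (f (- i)) = h1'"
    using h1'_ef[of i "- i"] step2 by (simp add: h1'_h0)
  have 1: "br (e (i - 1)) (f (1 - i)) = h0"
    using h1_ef[of "i - 1" "- i"] step2 0 by (simp add: h1_h1' algebra_simps)
  have 2: "br (e i) (f (1 - i)) = h1"
    using h1_ef[of i "- i"] step2 by (simp add: h1_h0 algebra_simps)
  from 0 1 2 show ?case by (simp add: algebra_simps minus_diff_commute)
qed

text \<open>Brackets of degree n + 1 agree because \<open>h1\<close> kills those of degree n; let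
  \<open>H\<close> be their common value. To keep the induction going, \<open>h1\<close> must kill
  \<open>H\<close> too. Now \<open>H\<close> acts on all e and f like h times t^(n+1), and
  evaluating \<open>br H h1\<close> through \<open>h1 = br (e 0) (f 1)\<close> gives a positive
  multiple of \<open>br h1 H\<close>, which contradicts antisymmetry unless both vanish.\<close>

lemma ef_nat:
  "(\<forall>k m. k + m = int n \<longrightarrow> br (e k) (f m) = br (e (int n)) (f 0)) \<and> br h1 (br (e (int n)) (f 0)) = 0"
proof (induct n)
  case 0
  have "br (e k) (f m) = h0" if "k + m = 0" for k m
    using ef_low[of k] that by (simp add: eq_neg_iff_add_eq_0[symmetric] add.commute)
  then show ?case by (simp add: e0_f0 h1_h0)
next
  case (Suc n)
  define H where "H = br (e (int (Suc n))) (f 0)"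
  have step: "br (e (k + 1)) (f m) = br (e k) (f (m + 1))" if "k + m = int n" for k m
    proof -
    have "br h1 (br (e k) (f m)) = 0" using Suc that by metis
    then show ?thesis unfolding h1_ef by simp
  qed
  have shift: "br (e k) (f m) = br (e (k + j)) (f (m - j))" if "k + m = int n + 1" for k m j
  proof (induct j rule: int_induct[where k = 0])
    case (step1 i)
    then show ?case using step[of "k + i" "m - i - 1"] that by (simp add: algebra_simps)
  next
    case (step2 i)
    then show ?case using step[of "k + i - 1" "m - i"] that by (simp add: algebra_simps)
  qed simp
  have H: "br (e k) (f m) = H" if "k + m = int n + 1" for k m
    using shift[of k m m] that by (simp add: H_def algebra_simps)
  \<comment> \<open>Among the equal expressions for \<open>H\<close> the one with
    \<open>f (- m)\<close> is chosen, as its bracket with \<open>e m\<close> is known.\<close>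
  have He: "br H (e m) = 2 *\<^sub>c e (m + int n + 1)" for m
  proof -
    have "br (br (e (m + int n + 1)) (f (- m))) (e m) = 2 *\<^sub>c e (m + int n + 1)"
      by (subst br_leibniz_left)
         (use ef_low[of m] br_swap[of "f (- m)" "e m"] br_swap[of "e (m + int n + 1)" h0] in
           \<open>simp add: ee h0_e\<close>)
    then show ?thesis using H[of "m + int n + 1" "- m"] by simp
  qed
  have Hf: "br H (f m) = - (2 *\<^sub>c f (m + int n + 1))" for m
  proof -
    have "br (br (e (- m)) (f (m + int n + 1))) (f m) = - (2 *\<^sub>c f (m + int n + 1))"
      by (subst br_leibniz_left) (use ef_low[of "- m"] in \<open>simp add: ff h0_f\<close>)
    then show ?thesis using H[of "- m" "m + int n + 1"] by simp
  qed
  define y where "y = (1/2) *\<^sub>c br h1 H"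
  have y: "br h1 H = 2 *\<^sub>c y" by (simp add: y_def)
  have dy: "br (e (k + 1)) (f m) = br (e k) (f (m + 1)) + y" if "k + m = int n + 1" for k m
  proof -
    have "2 *\<^sub>c y = 2 *\<^sub>c (br (e (k + 1)) (f m) - br (e k) (f (m + 1)))"
      using h1_ef[of k m] unfolding H[OF that] y .
    then have "y = br (e (k + 1)) (f m) - br (e k) (f (m + 1))"
      by (subst (asm) csc_cancel) simp_all
    then show ?thesis by simp
  qed
  \<comment> \<open>In degree n + 2 each unit of degree moved from f to e adds the same
    \<open>y\<close>.\<close>
  have tele: "br (e (int k)) (f (int n + 2 - int k)) = br (e 0) (f (int n + 2)) + of_nat k *\<^sub>c y" for k
  proof (induct k)
    case (Suc k)
    then show ?case using dy[of "int k" "int n + 1 - int k"]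
      by (simp add: algebra_simps csc_add_left)
  qed simp
  have "br H h1 = 2 *\<^sub>c (br (e (int n + 1)) (f 1) - br (e 0) (f (int n + 2)))"
    unfolding e0_f1[symmetric]
    by (subst br_leibniz_right) (simp add: He Hf csc_diff_right algebra_simps)
  also have "\<dots> = 2 *\<^sub>c of_nat (Suc n) *\<^sub>c y"
    using tele[of "Suc n"] by (simp add: algebra_simps)
  finally have "- (2 *\<^sub>c y) = 2 *\<^sub>c of_nat (Suc n) *\<^sub>c y"
    using br_swap[of H h1] y by simp
  then have "2 *\<^sub>c of_nat (Suc n) *\<^sub>c y + 2 *\<^sub>c y = 0" by (metis add.left_inverse)
  then have "(2 * of_nat (Suc n) + 2) *\<^sub>c y = 0"
    unfolding csc_csc csc_add_left .
  moreover have "(2 * of_nat (Suc n) + 2 :: complex) \<noteq> 0"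
  proof -
    have "(2 * of_nat (Suc n) + 2 :: complex) = of_nat (2 * Suc n + 2)" by simp
    then show ?thesis by (simp only: of_nat_eq_0_iff)
  qed
  ultimately have "y = 0" by (simp only: csc_eq_0_iff) simp
  then have "br h1 H = 0" using y by simp
  moreover have "br (e k) (f m) = H" if "k + m = int (Suc n)" for k m
    by (rule H) (use that in simp)
  ultimately show ?case unfolding H_def[symmetric] by blast
qed

end

lemma (in loop_skeleton) ef: "br (e k) (f m) = br (e (k + m)) (f 0)"
proof (cases "k + m \<ge> 0")
  case True
  then obtain n where n: "k + m = int n" using nonneg_int_cases by blast
  show ?thesis using ef_nat[of n, THEN conjunct1, rule_format, OF n] unfolding n .
next
  case False
  interpret m: loop_skeleton "\<lambda>k. e (- 1 - k)" "\<lambda>k. f (1 - k)" h0 h1' h1 by (rule mirror)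
  have "br (e k') (f m') = br (e (- 1 - int n)) (f 1)" if "k' + m' = - int n" for n k' m'
    using m.ef_nat[of n, THEN conjunct1, rule_format, of "- 1 - k'" "1 - m'"] that by simp
  from this[of k m "nat (- k - m)"] this[of "k + m" 0 "nat (- k - m)"] False show ?thesis
    by simp
qed

context loop_skeleton
begin

definition h where "h k = br (e k) (f 0)"

lemma e_f: "br (e k) (f m) = h (k + m)"
  using ef by (simp add: h_def)

lemma h_zero: "h 0 = h0" by (simp add: h_def e0_f0)

lemma h_e: "br (h k) (e m) = 2 *\<^sub>c e (k + m)"
proof -
  have "br (br (e (k + m)) (f (- m))) (e m) = 2 *\<^sub>c e (k + m)"
    by (subst br_leibniz_left)
      (use e_f[of m "- m"] br_swap[of "f (- m)" "e m"] br_swap[of "e (k + m)" h0] in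
       \<open>simp add: ee h0_e h_zero\<close>)
  then show ?thesis by (simp add: e_f)
qed

lemma h_f: "br (h k) (f m) = - (2 *\<^sub>c f (k + m))"
proof -
  have "br (br (e (- m)) (f (k + m))) (f m) = - (2 *\<^sub>c f (k + m))"
    by (subst br_leibniz_left) (use e_f[of "- m" m] in \<open>simp add: ff h0_f h_zero\<close>)
  then show ?thesis by (simp add: e_f)
qed

lemma h_h: "br (h k) (h m) = 0"
  unfolding h_def[of m] by (subst br_leibniz_right) (simp add: h_e h_f e_f add.commute)

end

text \<open>A lowest weight vector for \<open>(e, f, h)\<close> of positive weight generates vectors of arbitrarily high
  weight under \<open>ad e\<close>; where these cannot exist, the vector is zero.\<close>

lemma sl2_ladder:
  fixes e f h x :: "'a::complex_alg"
  assumes "br h e = 2 *\<^sub>c e" "br e f = h" "br f x = 0" "br h x = w *\<^sub>c x"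
  defines "X \<equiv> \<lambda>k. (br e ^^ k) x"
  shows "br h (X k) = (w + 2 * of_nat k) *\<^sub>c X k"
    and "br f (X (Suc k)) = (- (of_nat (Suc k) * (w + of_nat k))) *\<^sub>c X k"
proof -
  have X: "X (Suc k) = br e (X k)" for k by (simp add: X_def)
  have H: "br h (X k) = (w + 2 * of_nat k) *\<^sub>c X k" for k
  proof (induct k)
    case 0
    then show ?case using assms by (simp add: X_def)
  next
    case (Suc k)
    show ?case unfolding X
      by (subst br_leibniz_right) (simp add: Suc assms(1) csc_add_left[symmetric] algebra_simps)
  qed
  show "br h (X k) = (w + 2 * of_nat k) *\<^sub>c X k" by (rule H)
  show "br f (X (Suc k)) = (- (of_nat (Suc k) * (w + of_nat k))) *\<^sub>c X k"
  proof (induct k)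
    case 0
    have "br f (br e x) = - br h x"
      by (subst br_leibniz_right) (use assms br_swap[of f e] in simp)
    then show ?case using assms by (simp add: X_def)
  next
    case (Suc k)
    have "br f (X (Suc (Suc k))) = - br h (X (Suc k)) + br e (br f (X (Suc k)))"
      unfolding X[of "Suc k"]
      by (subst br_leibniz_right) (use assms br_swap[of f e] in simp)
    also have "\<dots> = (- (w + 2 * of_nat (Suc k)) - (of_nat (Suc k) * (w + of_nat k))) *\<^sub>c X (Suc k)"
      unfolding Suc H by (simp only: csc_diff_left csc_minus_left br_csc X) simp
    also have "- (w + 2 * of_nat (Suc k)) - (of_nat (Suc k) * (w + of_nat k)) =
        - (of_nat (Suc (Suc k)) * (w + of_nat (Suc k)))"
      by (simp add: algebra_simps)
    finally show ?case .
  qed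
qed

lemma sl2_bounded_zero:
  fixes e f h x :: "'a::complex_alg"
  assumes "br h e = 2 *\<^sub>c e" "br e f = h" "br f x = 0" "br h x = of_nat w *\<^sub>c x" "w > 0"
    and bounded: "\<And>y n. n \<ge> M \<Longrightarrow> br h y = of_nat n *\<^sub>c y \<Longrightarrow> y = 0"
  shows "x = 0"
proof -
  note ladder = sl2_ladder[OF assms(1-4)]
  define X where "X = (\<lambda>k. (br e ^^ k) x)"
  have "X M = 0"
  proof (rule bounded)
    show "br h (X M) = of_nat (w + 2 * M) *\<^sub>c X M" using ladder(1)[of M] by (simp add: X_def)
  qed simp
  \<comment> \<open>From the top down: \<open>br f\<close> takes each member of the ladder to a
    multiple of the previous one, and the factor is nonzero since \<open>w > 0\<close>.\<close>
  then have "X (M - j) = 0" for j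
  proof (induct j)
    case (Suc j)
    show ?case
    proof (cases "j < M")
      case True
      then have "X (Suc (M - Suc j)) = 0" using Suc by (simp add: Suc_diff_Suc)
      then have "(- (of_nat (Suc (M - Suc j)) * (of_nat w + of_nat (M - Suc j)))) *\<^sub>c X (M - Suc j) = 0"
        using ladder(2)[of "M - Suc j"] unfolding X_def by (metis br_zero(2))
      moreover have "- (of_nat (Suc (M - Suc j)) * (of_nat w + of_nat (M - Suc j))) \<noteq> (0::complex)"
      proof -
        have "of_nat (Suc (M - Suc j)) * (of_nat w + of_nat (M - Suc j)) =
          (of_nat (Suc (M - Suc j) * (w + (M - Suc j))) :: complex)"
          by (simp only: of_nat_mult of_nat_add)
        then show ?thesis using \<open>w > 0\<close> by (simp only: neg_equal_0_iff_equal of_nat_eq_0_iff) simp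
      qed
      ultimately show ?thesis by (simp only: csc_eq_0_iff) simp
    qed (use Suc in simp)
  qed simp
  from this[of M] show ?thesis by (simp add: X_def)
qed

text \<open>For w = -2 and k = 2 the factor w + k of the ladder is zero, so the third power is again
  killed by \<open>br f\<close>. It is then a lowest weight vector of weight 4, which boundedness
  excludes unless it is zero.\<close>

lemma serre_of_bounded:
  fixes e f h x :: "'a::complex_alg"
  assumes "br h e = 2 *\<^sub>c e" "br e f = h" "br f x = 0" "br h x = - (2 *\<^sub>c x)"
    and bounded: "\<And>y n. n \<ge> M \<Longrightarrow> br h y = of_nat n *\<^sub>c y \<Longrightarrow> y = 0"
  shows "br e (br e (br e x)) = 0"
proof -
  have w: "br h x = (- 2) *\<^sub>c x" using assms(4) by simp
  note ladder = sl2_ladder[OF assms(1-3) w]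
  have *: "(br e ^^ 3) x = br e (br e (br e x))" by (simp add: eval_nat_numeral)
  show ?thesis unfolding *[symmetric]
  proof (rule sl2_bounded_zero[OF assms(1,2) _ _ _ bounded])
    show "br f ((br e ^^ 3) x) = 0" using ladder(2)[of 2] by (simp add: eval_nat_numeral)
    show "br h ((br e ^^ 3) x) = of_nat 4 *\<^sub>c (br e ^^ 3) x" using ladder(1)[of 3] by simp
  qed simp_all
qed

text \<open>Here \<open>e0, f0, e', f1\<close> play the roles of \<open>e, f, e \<otimes> t\<^sup>-\<^sup>1, f \<otimes> t\<close>.\<close>

locale chevalley =
  fixes e0 f0 e' f1 h0 :: "'a::complex_alg"
  assumes e0_f0: "br e0 f0 = h0" and e'_f1: "br e' f1 = h0"
    and h0_e0: "br h0 e0 = 2 *\<^sub>c e0" and h0_e': "br h0 e' = 2 *\<^sub>c e'"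
    and h0_f0: "br h0 f0 = - (2 *\<^sub>c f0)" and h0_f1: "br h0 f1 = - (2 *\<^sub>c f1)"
    and e0_e': "br e0 e' = 0" and f0_f1: "br f0 f1 = 0"
    and serre_e0: "br e0 (br e0 (br e0 f1)) = 0"
    and serre_e': "br e' (br e' (br e' f0)) = 0"
    and serre_f0: "br f0 (br f0 (br f0 e')) = 0"
    and serre_f1: "br f1 (br f1 (br f1 e0)) = 0"
begin

definition "h1 = br e0 f1"
definition "h1' = br e' f0"
definition "up x = (1/2) *\<^sub>c br h1 x"
definition "down x = (1/2) *\<^sub>c br h1' x"

text \<open>Both families start from two adjacent given elements and are iterated outwards. As
  \<open>up\<close> and \<open>down\<close> commute, one undoes the other by acting on the innermost
  element, where this is known. On the f's the shift is minus \<open>up\<close>, because [h, f] =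
  -2f.\<close>

definition e :: "int \<Rightarrow> 'a" where
  "e k = (if k \<ge> 0 then (up ^^ nat k) e0 else (down ^^ nat (- 1 - k)) e')"

definition f :: "int \<Rightarrow> 'a" where
  "f k = (if k \<ge> 1 then ((\<lambda>x. - up x) ^^ nat (k - 1)) f1 else ((\<lambda>x. - down x) ^^ nat (- k)) f0)"

lemma h1_e': "br h1 e' = 2 *\<^sub>c e0"
  unfolding h1_def by (subst br_leibniz_left)
    (simp add: e0_e' br_swap[of f1 e'] e'_f1 br_swap[of e0 h0] h0_e0)

lemma h1_f0: "br h1 f0 = - (2 *\<^sub>c f1)"
  unfolding h1_def by (subst br_leibniz_left)
    (simp add: e0_f0 br_swap[of f1 f0] f0_f1 h0_f1)

lemma h1'_e0: "br h1' e0 = 2 *\<^sub>c e'"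
  unfolding h1'_def by (subst br_leibniz_left)
    (simp add: e0_e' br_swap[of e' e0] br_swap[of f0 e0] e0_f0 br_swap[of e' h0] h0_e')

lemma h1'_f1: "br h1' f1 = - (2 *\<^sub>c f0)"
  unfolding h1'_def by (subst br_leibniz_left)
    (simp add: e'_f1 f0_f1 h0_f0)

lemma h1_h1': "br h1 h1' = 0"
proof -
  have "br h1 h1' = 2 *\<^sub>c (br e0 f0 - br e' f1)"
    unfolding h1'_def by (subst br_leibniz_right) (simp add: h1_e' h1_f0 csc_diff_right)
  then show ?thesis by (simp add: e0_f0 e'_f1)
qed

lemma h0_h1: "br h0 h1 = 0" "br h0 h1' = 0"
  unfolding h1_def h1'_def by (subst br_leibniz_right, simp add: h0_e0 h0_e' h0_f0 h0_f1)+

lemma up_down: "up (down x) = down (up x)"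
proof -
  have "br h1 (br h1' x) = br h1' (br h1 x)" by (subst br_leibniz_right) (simp add: h1_h1')
  then show ?thesis by (simp add: up_def down_def)
qed

lemma up_simps [simp]: "up e' = e0" "up f0 = - f1" "down e0 = e'" "down f1 = - f0"
  by (simp_all add: up_def down_def h1_e' h1_f0 h1'_e0 h1'_f1)

lemma up_minus [simp]: "up (- x) = - up x" "down (- x) = - down x"
  by (simp_all add: up_def down_def)

lemma iterate_commute: "(\<And>x. g (g' x) = g' (g x)) \<Longrightarrow> g ((g' ^^ n) x) = (g' ^^ n) (g x)"
  by (induct n) simp_all

lemma up_e: "up (e k) = e (k + 1)"
proof -
  consider "k \<ge> 0" | "k = - 1" | "k \<le> - 2" by linarith
  then show ?thesis
  proof cases
    case 3
    define n where "n = nat (- 2 - k)"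
    with 3 have k: "k = - 2 - int n" by simp
    from k have "e k = down ((down ^^ n) e')" "e (k + 1) = (down ^^ n) e'"
      by (simp_all add: e_def nat_add_distrib)
    moreover have "up (down ((down ^^ n) e')) = (down ^^ n) e'"
      using iterate_commute[of up down "Suc n" e'] up_down by (simp add: funpow_swap1)
    ultimately show ?thesis by simp
  qed (simp_all add: e_def nat_add_distrib)
qed

lemma down_e: "down (e k) = e (k - 1)"
proof -
  consider "k < 0" | "k = 0" | "k \<ge> 1" by linarith
  then show ?thesis
  proof cases
    case 1
    then have "nat (- 1 - (k - 1)) = Suc (nat (- 1 - k))" by simp
    with 1 show ?thesis by (simp add: e_def del: nat_diff_distrib)
  next
    case 3
    define n where "n = nat (k - 1)"
    with 3 have k: "k = 1 + int n" by simp
    from k have "e k = up ((up ^^ n) e0)" "e (k - 1) = (up ^^ n) e0"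
      by (simp_all add: e_def nat_add_distrib)
    moreover have "down (up ((up ^^ n) e0)) = (up ^^ n) e0"
      using iterate_commute[of down up "Suc n" e0] up_down by (simp add: funpow_swap1)
    ultimately show ?thesis by simp
  qed (simp_all add: e_def)
qed

lemma up_f: "up (f k) = - f (k + 1)"
proof -
  consider "k \<ge> 1" | "k = 0" | "k \<le> - 1" by linarith
  then show ?thesis
  proof cases
    case 1
    then have "nat (k + 1 - 1) = Suc (nat (k - 1))" by simp
    with 1 show ?thesis by (simp add: f_def)
  next
    case 3
    define n where "n = nat (- 1 - k)"
    with 3 have k: "k = - 1 - int n" by simp
    define g where "g = (\<lambda>x. - down x)"
    from k have "f k = g ((g ^^ n) f0)" "f (k + 1) = (g ^^ n) f0"
      by (simp_all add: f_def nat_add_distrib g_def)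
    moreover have "up (g ((g ^^ n) f0)) = - (g ^^ n) f0"
    proof -
      have "- up (g ((g ^^ n) f0)) = g ((g ^^ n) (- up f0))"
        using iterate_commute[of "\<lambda>x. - up x" g "Suc n" f0] by (simp add: g_def up_down)
      also have "\<dots> = (g ^^ n) (g f1)" by (simp add: funpow_swap1)
      also have "g f1 = f0" by (simp add: g_def)
      finally show ?thesis by (metis add.inverse_inverse)
    qed
    ultimately show ?thesis by simp
  qed (simp_all add: f_def)
qed

lemma down_f: "down (f k) = - f (k - 1)"
proof -
  consider "k \<le> 0" | "k = 1" | "k \<ge> 2" by linarith
  then show ?thesis
  proof cases
    case 1
    then have "nat (- (k - 1)) = Suc (nat (- k))" by simp
    with 1 show ?thesis by (simp add: f_def)
  next
    case 3
    define n where "n = nat (k - 2)"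
    with 3 have k: "k = 2 + int n" by simp
    define g where "g = (\<lambda>x. - up x)"
    from k have "f k = g ((g ^^ n) f1)" "f (k - 1) = (g ^^ n) f1"
      by (simp_all add: f_def nat_add_distrib g_def)
    moreover have "down (g ((g ^^ n) f1)) = - (g ^^ n) f1"
    proof -
      have "- down (g ((g ^^ n) f1)) = g ((g ^^ n) (- down f1))"
        using iterate_commute[of "\<lambda>x. - down x" g "Suc n" f1] by (simp add: g_def up_down)
      also have "\<dots> = (g ^^ n) (g f0)" by (simp add: funpow_swap1)
      also have "g f0 = f1" by (simp add: g_def)
      finally show ?thesis by (metis add.inverse_inverse)
    qed
    ultimately show ?thesis by simp
  qed (simp_all add: f_def)
qed

lemma br_up: "br h1 x = 2 *\<^sub>c up x" "br h1' x = 2 *\<^sub>c down x"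
  by (simp_all add: up_def down_def)

lemma h0_up: "br h0 (up x) = up (br h0 x)" "br h0 (down x) = down (br h0 x)"
  unfolding up_def down_def br_csc by (subst br_leibniz_right, simp add: h0_h1)+

lemma up_csc [simp]: "up (c *\<^sub>c x) = c *\<^sub>c up x" "down (c *\<^sub>c x) = c *\<^sub>c down x"
  by (simp_all add: up_def down_def mult.commute)

lemma initial_values: "e 0 = e0" "e (- 1) = e'" "f 0 = f0" "f 1 = f1"
  by (simp_all add: e_def f_def)

sublocale skeleton: loop_skeleton e f h0 h1 h1'
proof
  show "br h1 (e k) = 2 *\<^sub>c e (k + 1)" "br h1' (e k) = 2 *\<^sub>c e (k - 1)"
    "br h1 (f k) = - (2 *\<^sub>c f (k + 1))" "br h1' (f k) = - (2 *\<^sub>c f (k - 1))" for k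
    by (simp_all add: br_up up_e down_e up_f down_f)
  show "br h0 (e k) = 2 *\<^sub>c e k" for k
  proof (induct k rule: int_induct[where k = 0])
    case (step1 i)
    then show ?case using h0_up(1)[of "e i"] by (simp add: up_e)
  next
    case (step2 i)
    then show ?case using h0_up(2)[of "e i"] by (simp add: down_e)
  qed (simp add: initial_values h0_e0)
  show "br h0 (f k) = - (2 *\<^sub>c f k)" for k
  proof (induct k rule: int_induct[where k = 0])
    case (step1 i)
    then show ?case using h0_up(1)[of "f i"] by (simp add: up_f minus_equation_iff[of "br h0 _"])
  next
    case (step2 i)
    then show ?case using h0_up(2)[of "f i"] by (simp add: down_f minus_equation_iff[of "br h0 _"])
  qed (simp add: initial_values h0_f0)
  have swap: "h1 = - br f1 e0" "h1' = - br f0 e'"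
    by (simp_all add: h1_def h1'_def br_swap[of e0 f1] br_swap[of e' f0])
  \<comment> \<open>Since \<open>h1\<close> and \<open>h1'\<close> are brackets of generators, the
    four remaining commutation assumptions are the four Serre relations up to a factor.\<close>
  have up': "br x (up x) = (- 1/2) *\<^sub>c br x (br x h1)"
    and down': "br x (down x) = (- 1/2) *\<^sub>c br x (br x h1')" for x
    by (simp_all add: up_def down_def br_swap[of h1 x] br_swap[of h1' x])
  have "br (e 0) (up (e 0)) = 0"
    unfolding up' initial_values using serre_e0 by (simp add: h1_def)
  then show "br (e 0) (e 1) = 0" by (simp add: up_e)
  have "br (e (- 1)) (down (e (- 1))) = 0"
    unfolding down' initial_values using serre_e' by (simp add: h1'_def)
  then show "br (e (- 1)) (e (- 2)) = 0" by (simp add: down_e)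
  have "br (f 1) (up (f 1)) = 0"
    unfolding up' initial_values swap using serre_f1 by simp
  then show "br (f 1) (f 2) = 0" by (simp add: up_f)
  have "br (f 0) (down (f 0)) = 0"
    unfolding down' initial_values swap using serre_f0 by simp
  then show "br (f 0) (f (- 1)) = 0" by (simp add: down_f)
qed (simp_all add: initial_values e0_f0 e'_f1 h1_def h1'_def e0_e' f0_f1)

abbreviation "h \<equiv> skeleton.h"

text \<open>Used to show that the whole image of the loop algebra consists of matrices absorbed by
  the projection onto the sector.\<close>

lemma closure:
  assumes Q: "Q e0" "Q f0" "Q e'" "Q f1"
    and br: "\<And>x y. Q x \<Longrightarrow> Q y \<Longrightarrow> Q (br x y)" and csc: "\<And>c x. Q x \<Longrightarrow> Q (c *\<^sub>c x)"
  shows "Q (e k)" "Q (f k)" "Q (h k)"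
proof -
  have "Q h1" "Q h1'" using Q by (simp_all add: h1_def h1'_def br)
  then have ud: "Q (up x)" "Q (down x)" if "Q x" for x
    using that by (simp_all add: up_def down_def br csc)
  have e: "Q (e k)" for k
  proof (induct k rule: int_induct[where k = 0])
    case (step1 i)
    then show ?case using ud(1)[of "e i"] by (simp add: up_e)
  next
    case (step2 i)
    then show ?case using ud(2)[of "e i"] by (simp add: down_e)
  qed (simp add: initial_values Q)
  have f: "Q (f k)" for k
  proof (induct k rule: int_induct[where k = 0])
    case (step1 i)
    then show ?case using csc[OF ud(1)[of "f i"], of "- 1"] by (simp add: up_f)
  next
    case (step2 i)
    then show ?case using csc[OF ud(2)[of "f i"], of "- 1"] by (simp add: down_f)
  qed (simp add: initial_values Q)
  show "Q (e k)" "Q (f k)" "Q (h k)"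
    by (simp_all add: e f skeleton.h_def br)
qed

end

section \<open>Laurent polynomial coefficients and the loop representation\<close>

lemma sum_induct_closed:
  assumes "Q 0" "\<And>x y. Q x \<Longrightarrow> Q y \<Longrightarrow> Q (x + y)" "\<And>i. i \<in> I \<Longrightarrow> Q (g i)"
  shows "Q (sum g I :: 'b::comm_monoid_add)"
  using assms by (induct I rule: infinite_finite_induct) auto

text \<open>The linear map on Laurent polynomials that sends t^k to \<open>g k\<close>.\<close>

definition laurent_ap :: "(int \<Rightarrow> 'a::complex_alg) \<Rightarrow> laurent \<Rightarrow> 'a" where
  "laurent_ap g p = (\<Sum>k\<in>Poly_Mapping.keys p. Poly_Mapping.lookup p k *\<^sub>c g k)"

lemma laurent_ap_zero [simp]: "laurent_ap g 0 = 0"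
  by (simp add: laurent_ap_def)

lemma laurent_ap_add: "laurent_ap g (p + r) = laurent_ap g p + laurent_ap g r"
  unfolding laurent_ap_def
  by (rule setsum_keys_plus_distrib) (auto simp: csc_add_left)

lemma laurent_ap_single [simp]: "laurent_ap g (Poly_Mapping.single k c) = c *\<^sub>c g k"
  by (cases "c = 0") (simp_all add: laurent_ap_def)

lemma laurent_ap_minus [simp]: "laurent_ap g (- p) = - laurent_ap g p"
  using laurent_ap_add[of g p "- p"] by (simp add: eq_neg_iff_add_eq_0 add.commute)

lemma laurent_ap_diff: "laurent_ap g (p - r) = laurent_ap g p - laurent_ap g r"
  using laurent_ap_add[of g p "- r"] by simp

lemma laurent_induct [case_names zero add]:
  assumes "Q 0" and "\<And>p k c. Q p \<Longrightarrow> Q (p + Poly_Mapping.single k c)"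
  shows "Q (p :: laurent)"
proof (induct p rule: update_induct)
  case const
  show ?case by (rule assms(1))
next
  case (update p k c)
  have "Poly_Mapping.update k c p = p + Poly_Mapping.single k c"
    using update(1) by (intro poly_mapping_eqI) (auto simp: lookup_update lookup_add lookup_single in_keys_iff when_def)
  then show ?case using update assms(2) by simp
qed

lemma laurent_ap_const: "laurent_ap g (laurent_const c * p) = c *\<^sub>c laurent_ap g p"
  by (induct p rule: laurent_induct)
    (simp_all add: distrib_left laurent_ap_add mult_single csc_add_right)

lemma br_laurent_ap:
  assumes "\<And>k m. br (g k) (g' m) = g'' (k + m)"
  shows "br (laurent_ap g p) (laurent_ap g' r) = laurent_ap g'' (p * r)"
proof (induct p rule: laurent_induct)
  case (add p k c)
  have "br (c *\<^sub>c g k) (laurent_ap g' r) = laurent_ap g'' (Poly_Mapping.single k c * r)"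
    by (induct r rule: laurent_induct)
      (simp_all add: assms distrib_left laurent_ap_add mult_single br_add csc_add_right mult.commute add.commute)
  then show ?case using add by (simp add: distrib_right laurent_ap_add br_add)
qed simp

context chevalley
begin

text \<open>By tracelessness the fourth entry carries no further information.\<close>

definition loop_rep :: "laurent mat \<Rightarrow> 'a" where
  "loop_rep X = laurent_ap e (X $$ (0, 1)) + laurent_ap f (X $$ (1, 0)) + laurent_ap h (X $$ (0, 0))"

lemma loop_rep_add:
  assumes "X \<in> loop_sl2" "Y \<in> loop_sl2"
  shows "loop_rep (X + Y) = loop_rep X + loop_rep Y"
proof -
  have "dim_row X = 2" "dim_col X = 2" "dim_row Y = 2" "dim_col Y = 2"
    using assms unfolding loop_sl2_def by auto
  then show ?thesis by (simp add: loop_rep_def laurent_ap_add)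
qed

lemma loop_rep_smult:
  assumes "X \<in> loop_sl2"
  shows "loop_rep (laurent_const c \<cdot>\<^sub>m X) = c *\<^sub>c loop_rep X"
proof -
  have "dim_row X = 2" "dim_col X = 2"
    using assms unfolding loop_sl2_def by auto
  then show ?thesis by (simp add: loop_rep_def laurent_ap_const csc_add_right)
qed

lemma laurent_ap_scaled: "laurent_ap (\<lambda>k. c *\<^sub>c g k) p = c *\<^sub>c laurent_ap g p"
  by (simp add: laurent_ap_def csc_sum_right mult.commute)

lemma loop_rep_commutator:
  assumes "X \<in> loop_sl2" "Y \<in> loop_sl2"
  shows "loop_rep (commutator X Y) = br (loop_rep X) (loop_rep Y)"
proof -
  have X: "X \<in> carrier_mat 2 2" "X $$ (Suc 0, Suc 0) = - X $$ (0, 0)"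
    and Y: "Y \<in> carrier_mat 2 2" "Y $$ (Suc 0, Suc 0) = - Y $$ (0, 0)"
    using assms by (auto simp: loop_sl2_def eq_neg_iff_add_eq_0 add.commute)
  have dims: "dim_row X = 2" "dim_col X = 2" "dim_row Y = 2" "dim_col Y = 2"
    using X Y by auto
  note entry = commutator_def scalar_prod_def numeral_2_eq_2 sum.atLeast0_lessThan_Suc
  \<comment> \<open>Eliminating the (1, 1) entries by tracelessness doubles the off-diagonal terms,
    which matches the factor 2 in [h, e] = 2e and [h, f] = -2f.\<close>
  have c01: "commutator X Y $$ (0, 1) = (X $$ (0, 0) * Y $$ (0, 1) - X $$ (0, 1) * Y $$ (0, 0)) +
      (X $$ (0, 0) * Y $$ (0, 1) - X $$ (0, 1) * Y $$ (0, 0))"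
    and c10: "commutator X Y $$ (1, 0) = (X $$ (1, 0) * Y $$ (0, 0) - X $$ (0, 0) * Y $$ (1, 0)) +
      (X $$ (1, 0) * Y $$ (0, 0) - X $$ (0, 0) * Y $$ (1, 0))"
    and c00: "commutator X Y $$ (0, 0) = X $$ (0, 1) * Y $$ (1, 0) - X $$ (1, 0) * Y $$ (0, 1)"
    using X Y dims by (simp_all add: entry algebra_simps)
  note rel = skeleton.e_f skeleton.h_e skeleton.h_f
  have ee: "br (laurent_ap e p) (laurent_ap e r) = 0" for p r
    using br_laurent_ap[of e e "\<lambda>_. 0" p r] by (simp add: skeleton.ee laurent_ap_def)
  have ff: "br (laurent_ap f p) (laurent_ap f r) = 0" for p r
    using br_laurent_ap[of f f "\<lambda>_. 0" p r] by (simp add: skeleton.ff laurent_ap_def)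
  have hh: "br (laurent_ap h p) (laurent_ap h r) = 0" for p r
    using br_laurent_ap[of h h "\<lambda>_. 0" p r] by (simp add: skeleton.h_h laurent_ap_def)
  have ef: "br (laurent_ap e p) (laurent_ap f r) = laurent_ap h (p * r)" for p r
    using br_laurent_ap[of e f h] by (simp add: skeleton.e_f)
  have he: "br (laurent_ap h p) (laurent_ap e r) = 2 *\<^sub>c laurent_ap e (p * r)" for p r
    using br_laurent_ap[of h e "\<lambda>k. 2 *\<^sub>c e k"] by (simp add: skeleton.h_e laurent_ap_scaled)
  have hf: "br (laurent_ap h p) (laurent_ap f r) = - (2 *\<^sub>c laurent_ap f (p * r))" for p r
    using br_laurent_ap[of h f "\<lambda>k. (- 2) *\<^sub>c f k"] unfolding laurent_ap_scaled
    by (simp add: skeleton.h_f)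
  have fe: "br (laurent_ap f p) (laurent_ap e r) = - laurent_ap h (p * r)" for p r
    using ef[of r p] by (simp add: br_swap[of "laurent_ap f p"] mult.commute)
  have eh: "br (laurent_ap e p) (laurent_ap h r) = - (2 *\<^sub>c laurent_ap e (p * r))" for p r
    using he[of r p] by (simp add: br_swap[of "laurent_ap e p"] mult.commute)
  have fh: "br (laurent_ap f p) (laurent_ap h r) = 2 *\<^sub>c laurent_ap f (p * r)" for p r
    using hf[of r p] by (simp add: br_swap[of "laurent_ap f p"] mult.commute)
  have two: "2 *\<^sub>c x = x + x" for x :: 'a using csc_add_left[of 1 1 x] by simp
  have "laurent_ap e (commutator X Y $$ (0, 1)) = 2 *\<^sub>c laurent_ap e (X $$ (0, 0) * Y $$ (0, 1)) -
      2 *\<^sub>c laurent_ap e (X $$ (0, 1) * Y $$ (0, 0))"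
    unfolding c01 laurent_ap_add laurent_ap_diff two by (simp only: add_diff_eq diff_add_eq diff_diff_eq)
  moreover have "laurent_ap f (commutator X Y $$ (1, 0)) = 2 *\<^sub>c laurent_ap f (X $$ (1, 0) * Y $$ (0, 0)) -
      2 *\<^sub>c laurent_ap f (X $$ (0, 0) * Y $$ (1, 0))"
    unfolding c10 laurent_ap_add laurent_ap_diff two by (simp only: add_diff_eq diff_add_eq diff_diff_eq)
  ultimately show ?thesis
    unfolding loop_rep_def c00 by (simp add: br_add ee ff hh ef he hf fe eh fh laurent_ap_diff)
qed

lemma loop_rep_values:
  "loop_rep (loop_E 0) = f1" "loop_rep (loop_F 0) = e'" "loop_rep (loop_H 0) = - h0"
  "loop_rep (loop_E 1) = e0" "loop_rep (loop_F 1) = f0" "loop_rep (loop_H 1) = h0"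
proof -
  have one: "laurent_ap g 1 = g 0" for g :: "int \<Rightarrow> 'a"
    using laurent_ap_single[of g 0 1] by simp
  show "loop_rep (loop_E 0) = f1" "loop_rep (loop_F 0) = e'" "loop_rep (loop_H 0) = - h0"
  "loop_rep (loop_E 1) = e0" "loop_rep (loop_F 1) = f0" "loop_rep (loop_H 1) = h0"
    by (simp_all add: loop_rep_def loop_E_def loop_F_def loop_H_def unit_mat2_def one
        initial_values skeleton.h_zero)
qed

lemma loop_rep_closure:
  assumes Q: "Q e0" "Q f0" "Q e'" "Q f1" "Q 0"
    and add: "\<And>x y. Q x \<Longrightarrow> Q y \<Longrightarrow> Q (x + y)"
    and br: "\<And>x y. Q x \<Longrightarrow> Q y \<Longrightarrow> Q (br x y)" and csc: "\<And>c x. Q x \<Longrightarrow> Q (c *\<^sub>c x)"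
  shows "Q (loop_rep X)"
proof -
  note cl = closure[of Q, OF Q(1-4) br csc]
  have "Q (laurent_ap g p)" if g: "\<And>k. Q (g k)" for g p
    unfolding laurent_ap_def
    by (rule sum_induct_closed[of Q]) (simp_all add: Q add g csc)
  then show ?thesis unfolding loop_rep_def by (simp add: add cl)
qed

end

section \<open>Quantum integers and divided powers\<close>

text \<open>The argument is an integer, as weights and the upper entries of Gaussian binomials can
  be negative.\<close>

definition qi :: "complex \<Rightarrow> int \<Rightarrow> complex" where
  "qi s m = (s powi (2 * m) - s powi (- (2 * m))) / (s\<^sup>2 - inverse (s\<^sup>2))"

lemma q_int_eq_qi: "q_int s m = qi s (int m)"
proof -
  have "(s\<^sup>2) ^ m = s powi (2 * int m)" "inverse (s\<^sup>2) ^ m = s powi (- (2 * int m))"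
    by (simp_all add: power_int_minus power_inverse power_mult power_int_def nat_mult_distrib)
  then show ?thesis by (simp add: q_int_def qi_def)
qed

lemma qi_0 [simp]: "qi s 0 = 0"
  by (simp add: qi_def)

lemma qi_minus: "qi s (- m) = - qi s m"
  by (simp add: qi_def diff_divide_distrib)

text \<open>Half of the generators satisfy their relations with s inverted; because of this
  invariance their divided powers need not distinguish s from its inverse.\<close>

lemma qi_inverse: "qi (inverse s) m = qi s m"
proof -
  have "inverse s powi m = s powi (- m)" for m
    by (simp add: power_int_inverse power_int_minus)
  moreover have "(inverse s)\<^sup>2 - inverse ((inverse s)\<^sup>2) = - (s\<^sup>2 - inverse (s\<^sup>2))"
    by (simp add: power_inverse)
  moreover have "(b - a) / (- d) = (a - b) / d" for a b d :: complex
    by (metis minus_diff_eq minus_divide_divide)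
  ultimately show ?thesis
    unfolding qi_def by (simp only: add.inverse_inverse)
qed

lemma qi_add:
  assumes "s \<noteq> 0"
  shows "qi s (a + b) = s powi (2 * b) * qi s a + s powi (- (2 * a)) * qi s b"
  using assms
  by (simp add: qi_def add_divide_distrib[symmetric] algebra_simps power_int_add power_int_diff power_int_minus divide_inverse)

text \<open>The identity behind the induction step of Kac's formula.\<close>

lemma qi_exchange:
  assumes "s \<noteq> 0"
  shows "qi s (a - t) * qi s (b - t) + qi s t * qi s (a + b - t) = qi s a * qi s b"
proof -
  define x y z where "x = s powi (2 * a)" and "y = s powi (2 * b)" and "z = s powi (2 * t)"
  have nz: "x \<noteq> 0" "y \<noteq> 0" "z \<noteq> 0" using assms by (simp_all add: x_def y_def z_def)
  have p: "s powi (2 * (a - t)) = x / z" "s powi (- (2 * (a - t))) = z / x"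
    "s powi (2 * (b - t)) = y / z" "s powi (- (2 * (b - t))) = z / y"
    "s powi (2 * (a + b - t)) = x * y / z" "s powi (- (2 * (a + b - t))) = z / (x * y)"
    "s powi (2 * a) = x" "s powi (- (2 * a)) = 1 / x" "s powi (2 * b) = y" "s powi (- (2 * b)) = 1 / y"
    "s powi (2 * t) = z" "s powi (- (2 * t)) = 1 / z"
    using assms by (simp_all add: x_def y_def z_def power_int_add power_int_diff power_int_minus
        right_diff_distrib distrib_left divide_inverse mult_ac)
  have "(x / z - z / x) * (y / z - z / y) + (z - 1 / z) * (x * y / z - z / (x * y)) = (x - 1 / x) * (y - 1 / y)"
    using nz by (simp add: divide_simps) (simp add: algebra_simps)
  then show ?thesis
    unfolding qi_def p times_divide_times_eq add_divide_distrib[symmetric] by simp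
qed

lemma qi_1: "s\<^sup>2 - inverse (s\<^sup>2) \<noteq> 0 \<Longrightarrow> qi s 1 = 1"
  by (simp add: qi_def power_int_minus)

text \<open>For \<open>n = N\<close> at the root of unity the factor is 1 / 0, which is 0 by
  convention. Order N is therefore used only near that point; lower orders may be evaluated
  there.\<close>

definition dpow :: "complex \<Rightarrow> nat \<Rightarrow> 'a::complex_alg \<Rightarrow> 'a" where
  "dpow s n X = (1 / q_fact s n) *\<^sub>c X ^ n"

lemma q_fact_0 [simp]: "q_fact s 0 = 1"
  by (simp add: q_fact_def)

lemma q_fact_Suc: "q_fact s (Suc n) = q_fact s n * qi s (int (Suc n))"
  by (simp add: q_fact_def q_int_eq_qi)

lemma dpow_0 [simp]: "dpow s 0 X = 1"
  by (simp add: dpow_def)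

lemma dpow_Suc_left:
  assumes "qi s (int (Suc n)) \<noteq> 0"
  shows "X * dpow s n X = qi s (int (Suc n)) *\<^sub>c dpow s (Suc n) X"
  using assms by (simp add: dpow_def q_fact_Suc del: of_nat_Suc)

section \<open>Divided powers of q-commuting elements\<close>

lemma power_intertwine:
  fixes X K :: "'a::complex_alg"
  assumes "K * X = u *\<^sub>c (X * K)"
  shows "K * X ^ n = u ^ n *\<^sub>c (X ^ n * K)"
proof (induct n)
  case (Suc n)
  have "K * X ^ Suc n = (K * X ^ n) * X" by (simp add: power_commutes mult.assoc)
  also have "\<dots> = u ^ n *\<^sub>c (X ^ n * (K * X))" by (simp add: Suc mult.assoc)
  also have "\<dots> = u ^ Suc n *\<^sub>c (X ^ Suc n * K)"
    by (simp add: assms mult.assoc[symmetric] power_commutes mult.commute)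
  finally show ?case .
qed simp

lemma dpow_intertwine:
  fixes X K :: "'a::complex_alg"
  assumes "K * X = u *\<^sub>c (X * K)"
  shows "K * dpow s n X = u ^ n *\<^sub>c (dpow s n X * K)"
  using power_intertwine[OF assms, of n] by (simp add: dpow_def mult.commute)

lemma assoc_rule: "x * y = y' * x' \<Longrightarrow> x * (y * z) = y' * (x' * (z :: 'a::semigroup_mult))"
  by (metis mult.assoc)

lemma assoc_rule_csc: "x * y = c *\<^sub>c (y' * x') \<Longrightarrow> x * (y * z) = c *\<^sub>c (y' * (x' * (z :: 'a::complex_alg)))"
  by (metis mult.assoc csc_mult_left)

text \<open>Dividing by q-factorials absorbs the Gaussian binomials of the usual formula, so that
  only powers q^(a(n - a)) remain. When a further X + Y is multiplied from the left, the two
  contributions to a term combine by \<open>qi_add\<close>.\<close>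

lemma dpow_q_binomial:
  fixes X Y :: "'a::complex_alg"
  assumes "s \<noteq> 0" and YX: "Y * X = s ^ 4 *\<^sub>c (X * Y)"
    and nz: "\<And>m. 1 \<le> m \<Longrightarrow> m \<le> n \<Longrightarrow> qi s (int m) \<noteq> 0"
  shows "dpow s n (X + Y) = (\<Sum>a\<le>n. s ^ (2 * a * (n - a)) *\<^sub>c (dpow s a X * dpow s (n - a) Y))"
  using nz
proof (induct n)
  case (Suc n)
  define c where "c n a = s ^ (2 * a * (n - a))" for n a
  define S where "S n = (\<Sum>a\<le>n. c n a *\<^sub>c (dpow s a X * dpow s (n - a) Y))" for n
  have ih: "dpow s n (X + Y) = S n" using Suc by (simp add: S_def c_def)
  \<comment> \<open>The a-th term arises from X times term a - 1 and from Y times term a. For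
    \<open>a = 0\<close> the truncated index \<open>a - 1\<close> is harmless because
    \<open>qi s 0 = 0\<close>; for \<open>a = Suc n\<close> the second contribution is
    absent.\<close>
  have coeff: "c n (a - 1) * qi s (int a) + (if a \<le> n then c n a * s ^ (4 * a) * qi s (int (Suc n - a)) else 0)
      = qi s (int (Suc n)) * c (Suc n) a" if "a \<le> Suc n" for a
  proof -
    consider "a = 0" | "a = Suc n" "a \<noteq> 0" | "1 \<le> a" "a \<le> n" using \<open>a \<le> Suc n\<close> by linarith
    then show ?thesis
    proof cases
      case 3
      then obtain a' b' where ab: "a = Suc a'" "n = Suc (a' + b')"
        by (metis One_nat_def Suc_le_D add_Suc le_Suc_ex)
      have powi: "s powi (2 * int k) = s ^ (2 * k)" "s powi (- (2 * int k)) = inverse (s ^ (2 * k))" for k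
        by (simp_all add: power_int_minus power_int_def nat_mult_distrib power_inverse)
      have "c (Suc n) a = c n (a - 1) * s ^ (2 * Suc b')"
        unfolding c_def power_add[symmetric] using ab by (intro arg_cong[of _ _ "(^) s"]) (simp add: algebra_simps)
      then have 1: "c n (a - 1) = c (Suc n) a * s powi (- (2 * int (Suc b')))"
        unfolding powi using \<open>s \<noteq> 0\<close> by (simp add: mult.assoc del: power_Suc mult_Suc_right)
      have "c n a * s ^ (4 * a) = c (Suc n) a * s ^ (2 * a)"
        unfolding c_def power_add[symmetric] using ab by (intro arg_cong[of _ _ "(^) s"]) (simp add: algebra_simps)
      then have 2: "c n a * s ^ (4 * a) = c (Suc n) a * s powi (2 * int a)"
        unfolding powi .
      have "qi s (int (Suc n)) = s powi (2 * int a) * qi s (int (Suc b')) + s powi (- (2 * int (Suc b'))) * qi s (int a)"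
        using qi_add[OF \<open>s \<noteq> 0\<close>, of "int (Suc b')" "int a"] ab by (simp add: add.commute)
      moreover have "Suc n - a = Suc b'" using ab by simp
      ultimately show ?thesis using 3 unfolding 1 2 by (simp add: algebra_simps del: of_nat_Suc)
    qed (simp_all add: c_def)
  qed
  have "(X + Y) * S n = X * S n + Y * S n" by (rule distrib_right)
  also have "X * S n = (\<Sum>a\<le>n. (c n a * qi s (int (Suc a))) *\<^sub>c (dpow s (Suc a) X * dpow s (n - a) Y))"
    unfolding S_def sum_distrib_left
  proof (intro sum.cong refl)
    fix a assume "a \<in> {..n}"
    then have "X * dpow s a X = qi s (int (Suc a)) *\<^sub>c dpow s (Suc a) X"
      using Suc(2)[of "Suc a"] by (intro dpow_Suc_left) (auto simp del: of_nat_Suc)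
    then show "X * c n a *\<^sub>c (dpow s a X * dpow s (n - a) Y) =
        (c n a * qi s (int (Suc a))) *\<^sub>c (dpow s (Suc a) X * dpow s (n - a) Y)"
      by (simp add: mult.assoc[symmetric])
  qed
  also have "\<dots> = (\<Sum>a\<le>Suc n. (c n (a - 1) * qi s (int a)) *\<^sub>c (dpow s a X * dpow s (Suc n - a) Y))"
    unfolding sum.atMost_Suc_shift by simp
  also have "Y * S n = (\<Sum>a\<le>n. (c n a * s ^ (4 * a) * qi s (int (Suc n - a))) *\<^sub>c (dpow s a X * dpow s (Suc n - a) Y))"
    unfolding S_def sum_distrib_left
  proof (intro sum.cong refl)
    fix a assume a: "a \<in> {..n}"
    then have 1: "Y * dpow s (n - a) Y = qi s (int (Suc n - a)) *\<^sub>c dpow s (Suc n - a) Y"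
      using Suc(2)[of "Suc n - a"] dpow_Suc_left[of s "n - a" Y] by (simp add: Suc_diff_le)
    have 2: "Y * dpow s a X = s ^ (4 * a) *\<^sub>c (dpow s a X * Y)"
      using dpow_intertwine[OF YX, of s a] by (simp add: power_mult)
    show "Y * c n a *\<^sub>c (dpow s a X * dpow s (n - a) Y) =
        (c n a * s ^ (4 * a) * qi s (int (Suc n - a))) *\<^sub>c (dpow s a X * dpow s (Suc n - a) Y)"
      by (simp add: assoc_rule_csc[OF 2] 1 mult.assoc)
  qed
  also have "\<dots> = (\<Sum>a\<le>Suc n. (if a \<le> n then c n a * s ^ (4 * a) * qi s (int (Suc n - a)) else 0) *\<^sub>c (dpow s a X * dpow s (Suc n - a) Y))"
    by (simp add: sum.atMost_Suc)
  also have "(\<Sum>a\<le>Suc n. (c n (a - 1) * qi s (int a)) *\<^sub>c (dpow s a X * dpow s (Suc n - a) Y)) + \<dots> =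
      (\<Sum>a\<le>Suc n. (qi s (int (Suc n)) * c (Suc n) a) *\<^sub>c (dpow s a X * dpow s (Suc n - a) Y))"
    unfolding sum.distrib[symmetric] csc_add_left[symmetric]
    by (intro sum.cong refl) (simp only: coeff atMost_iff)
  also have "\<dots> = qi s (int (Suc n)) *\<^sub>c S (Suc n)"
    by (simp only: S_def csc_sum_right csc_csc)
  finally have "qi s (int (Suc n)) *\<^sub>c dpow s (Suc n) (X + Y) = qi s (int (Suc n)) *\<^sub>c S (Suc n)"
    using ih dpow_Suc_left[of s n "X + Y"] Suc(2)[of "Suc n"] by simp
  then show ?case using Suc(2)[of "Suc n"] by (simp add: csc_cancel S_def c_def)
qed simp

text \<open>The Gaussian binomial of x over t, for an arbitrary integer x.\<close>

definition qbin :: "complex \<Rightarrow> int \<Rightarrow> nat \<Rightarrow> complex" where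
  "qbin s x t = (\<Prod>j<t. qi s (x - int j)) / q_fact s t"

lemma qbin_0 [simp]: "qbin s x 0 = 1"
  by (simp add: qbin_def)

lemma qbin_Suc: "qbin s x (Suc t) * qi s (int (Suc t)) = qbin s x t * qi s (x - int t)"
  if "qi s (int (Suc t)) \<noteq> 0"
  using that by (simp add: qbin_def q_fact_Suc)

lemma qbin_Suc': "qbin s (x + 1) (Suc t) * qi s (int (Suc t)) = qi s (x + 1) * qbin s x t"
  if "qi s (int (Suc t)) \<noteq> 0"
proof -
  have "(\<Prod>j<Suc t. qi s (x + 1 - int j)) = qi s (x + 1) * (\<Prod>j<t. qi s (x - int j))"
    unfolding prod.lessThan_Suc_shift by simp
  then show ?thesis using that by (simp add: qbin_def q_fact_Suc)
qed

text \<open>\<open>Q\<close> stands for a projection onto vectors of weight \<open>w\<close>, i.e. on which \<open>K\<close> acts as \<open>q\<^sup>w\<close>.\<close>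

locale quantum_sl2 =
  fixes s :: complex and E F K K' :: "'a::complex_alg"
  assumes s: "s \<noteq> 0" "s\<^sup>2 - inverse (s\<^sup>2) \<noteq> 0"
    and EF: "(s\<^sup>2 - inverse (s\<^sup>2)) *\<^sub>c (E * F - F * E) = K - K'"
    and KE: "K * E = s ^ 4 *\<^sub>c (E * K)" and K'E: "K' * E = inverse (s ^ 4) *\<^sub>c (E * K')"
    and KF: "K * F = inverse (s ^ 4) *\<^sub>c (F * K)" and K'F: "K' * F = s ^ 4 *\<^sub>c (F * K')"
begin

definition weight :: "int \<Rightarrow> 'a \<Rightarrow> bool" where
  "weight w Q \<longleftrightarrow> K * Q = s powi (2 * w) *\<^sub>c Q \<and> K' * Q = s powi (- (2 * w)) *\<^sub>c Q"

lemma powi_shift: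
  "s ^ 4 * s powi (2 * w) = s powi (2 * (w + 2))"
  "s powi (2 * w) * s ^ 4 = s powi (2 * (w + 2))"
  "inverse (s ^ 4) * s powi (2 * w) = s powi (2 * (w - 2))"
  "s ^ 4 * s powi (- (2 * w)) = s powi (- (2 * (w - 2)))"
  "inverse (s ^ 4) * s powi (- (2 * w)) = s powi (- (2 * (w + 2)))"
  using s by (simp_all add: power_int_add power_int_diff power_int_minus distrib_left right_diff_distrib divide_inverse)

lemma weight_E: "weight w Q \<Longrightarrow> weight (w + 2) (E * Q)"
  unfolding weight_def
  by (simp only: assoc_rule_csc[OF KE] assoc_rule_csc[OF K'E] csc_mult_right csc_csc powi_shift simp_thms)

lemma weight_F: "weight w Q \<Longrightarrow> weight (w - 2) (F * Q)"
  unfolding weight_def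
  by (simp only: assoc_rule_csc[OF KF] assoc_rule_csc[OF K'F] csc_mult_right csc_csc powi_shift simp_thms)

lemma weight_csc: "weight w Q \<Longrightarrow> weight w (c *\<^sub>c Q)"
  by (simp add: weight_def mult.commute)

lemma weight_E_power: "weight w Q \<Longrightarrow> weight (w + 2 * int n) (E ^ n * Q)"
proof (induct n)
  case (Suc n)
  then show ?case using weight_E[of "w + 2 * int n" "E ^ n * Q"] by (simp add: mult.assoc algebra_simps)
qed simp

lemma weight_F_power: "weight w Q \<Longrightarrow> weight (w - 2 * int n) (F ^ n * Q)"
proof (induct n)
  case (Suc n)
  then show ?case using weight_F[of "w - 2 * int n" "F ^ n * Q"] by (simp add: mult.assoc algebra_simps)
qed simp

lemma EF_weight: "weight w Q \<Longrightarrow> E * (F * Q) = F * (E * Q) + qi s w *\<^sub>c Q"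
proof -
  assume "weight w Q"
  moreover have "(s\<^sup>2 - inverse (s\<^sup>2)) * qi s w = s powi (2 * w) - s powi (- (2 * w))"
    using s(2) by (simp add: qi_def)
  ultimately have "(K - K') * Q = ((s\<^sup>2 - inverse (s\<^sup>2)) * qi s w) *\<^sub>c Q"
    by (simp add: weight_def left_diff_distrib csc_diff_left)
  then have "(s\<^sup>2 - inverse (s\<^sup>2)) *\<^sub>c (E * (F * Q) - F * (E * Q)) =
    (s\<^sup>2 - inverse (s\<^sup>2)) *\<^sub>c qi s w *\<^sub>c Q"
    unfolding EF[symmetric] by (simp only: csc_mult_left left_diff_distrib mult.assoc csc_csc)
  then have "E * (F * Q) - F * (E * Q) = qi s w *\<^sub>c Q"
    by (rule csc_cancel[THEN iffD1, OF s(2)])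
  then show ?thesis by (simp add: algebra_simps)
qed

text \<open>Moving E past one more F adds the quantum integer of the current weight;
  \<open>qi_exchange\<close> at t = 1 collapses the sum of these to a product.\<close>

lemma E_F_power:
  "weight w Q \<Longrightarrow> E * (F ^ Suc n * Q) = F ^ Suc n * (E * Q) + (qi s (int (Suc n)) * qi s (w - int n)) *\<^sub>c (F ^ n * Q)"
proof (induct n)
  case 0
  then show ?case using EF_weight[of w Q] s by (simp add: qi_1)
next
  case (Suc n)
  have "E * (F ^ Suc (Suc n) * Q) = E * (F * (F ^ Suc n * Q))" by (simp add: mult.assoc)
  also have "\<dots> = F * (E * (F ^ Suc n * Q)) + qi s (w - 2 * int (Suc n)) *\<^sub>c (F ^ Suc n * Q)"
    using EF_weight[OF weight_F_power[OF Suc(2), of "Suc n"]] .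
  also have "\<dots> = F ^ Suc (Suc n) * (E * Q) +
      (qi s (int (Suc n)) * qi s (w - int n) + qi s (w - 2 * int (Suc n))) *\<^sub>c (F ^ Suc n * Q)"
    unfolding Suc(1)[OF Suc(2)] by (simp add: distrib_left mult.assoc csc_add_left)
  also have "qi s (int (Suc n)) * qi s (w - int n) + qi s (w - 2 * int (Suc n)) =
      qi s (int (Suc (Suc n))) * qi s (w - int (Suc n))"
  proof -
    have "qi s (w - int (Suc n)) * qi s (- int (Suc (Suc n))) + qi s (w - 2 * int (Suc n)) =
        qi s (w - int n) * qi s (- int (Suc n))"
      using qi_exchange[OF s(1), of "w - int n" 1 "- int (Suc n)"] qi_1[OF s(2)]
      by (simp add: algebra_simps)
    then show ?thesis unfolding qi_minus by (simp add: algebra_simps)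
  qed
  finally show ?case .
qed

lemma E_F_dpow:
  assumes "weight w Q" "qi s (int (Suc n)) \<noteq> 0"
  shows "E * (dpow s (Suc n) F * Q) = dpow s (Suc n) F * (E * Q) + qi s (w - int n) *\<^sub>c (dpow s n F * Q)"
  using E_F_power[OF assms(1), of n] assms(2)
  by (simp add: dpow_def q_fact_Suc csc_add_right del: power_Suc of_nat_Suc)

lemma weight_E_dpow: "weight w Q \<Longrightarrow> weight (w + 2 * int n) (dpow s n E * Q)"
  by (simp add: dpow_def weight_csc weight_E_power)

text \<open>Induction on m with n fixed: a further E meets a vector of weight w + 2(m - t), and
  \<open>E_F_dpow\<close> moves it through the power of F. The upper entry of the binomial grows by
  one together with m.\<close>

lemma kac_formula:
  assumes "weight w Q" and nz: "\<And>j. 1 \<le> j \<Longrightarrow> j \<le> n \<Longrightarrow> qi s (int j) \<noteq> 0" and "m \<le> n"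
  shows "dpow s m E * (dpow s n F * Q) =
    (\<Sum>t\<le>m. qbin s (int m - int n + w) t *\<^sub>c (dpow s (n - t) F * (dpow s (m - t) E * Q)))"
  using \<open>m \<le> n\<close>
proof (induct m)
  case (Suc m)
  define x where "x = int m - int n + w"
  define G where "G t = dpow s (n - t) F * (dpow s (Suc m - t) E * Q)" for t
  have E: "E * (dpow s (n - t) F * (dpow s (m - t) E * Q)) =
      qi s (int (Suc m - t)) *\<^sub>c G t + qi s (x + int m - int t + 1) *\<^sub>c G (Suc t)" if "t \<le> m" for t
  proof -
    have n: "n - t = Suc (n - Suc t)" using that Suc by simp
    have m: "Suc m - t = Suc (m - t)" using that by simp
    have "E * (dpow s (n - t) F * (dpow s (m - t) E * Q)) =
      dpow s (n - t) F * (E * (dpow s (m - t) E * Q)) +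
      qi s (w + 2 * int (m - t) - int (n - Suc t)) *\<^sub>c (dpow s (n - Suc t) F * (dpow s (m - t) E * Q))"
      using E_F_dpow[OF weight_E_dpow[OF assms(1)], of "n - Suc t" "m - t"] nz[of "n - t"] n by simp
    also have "E * (dpow s (m - t) E * Q) = qi s (int (Suc m - t)) *\<^sub>c (dpow s (Suc m - t) E * Q)"
      using dpow_Suc_left[of s "m - t" E] nz[of "Suc m - t"] that Suc(2) m by (simp add: mult.assoc[symmetric])
    also have "w + 2 * int (m - t) - int (n - Suc t) = x + int m - int t + 1"
      using that Suc(2) by (simp add: x_def of_nat_diff)
    finally show ?thesis by (simp add: G_def)
  qed
  \<comment> \<open>A Pascal-type rule: after multiplication by [t] all binomials become multiples
    of the one of x over t - 1, and \<open>qi_exchange\<close> compares the factors.\<close>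
  have coeff: "qbin s x t * qi s (int (Suc m - t)) + (if t = 0 then 0 else qbin s x (t - 1) * qi s (x + int m - int t + 2))
     = qi s (int (Suc m)) * qbin s (x + 1) t" if "t \<le> Suc m" for t
  proof (cases t)
    case (Suc j)
    have j: "qi s (int (Suc j)) \<noteq> 0" using nz[of "Suc j"] that Suc \<open>Suc m \<le> n\<close> by (simp del: of_nat_Suc)
    have "(qbin s x t * qi s (int (Suc m - t)) + qbin s x j * qi s (x + int m - int t + 2)) * qi s (int t)
        = qbin s x j * (qi s (x + 1 - int t) * qi s (int (Suc m) - int t) + qi s (int t) * qi s (x + 1 + int (Suc m) - int t))"
      using qbin_Suc[OF j, of x] that unfolding Suc
      by (simp add: algebra_simps of_nat_diff)
    also have "\<dots> = qbin s x j * (qi s (x + 1) * qi s (int (Suc m)))"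
      by (simp only: qi_exchange[OF s(1)])
    also have "\<dots> = qi s (int (Suc m)) * qbin s (x + 1) t * qi s (int t)"
      using qbin_Suc'[OF j, of x] unfolding Suc by (simp add: algebra_simps)
    finally show ?thesis using j Suc by simp
  qed simp
  have "qi s (int (Suc m)) *\<^sub>c (dpow s (Suc m) E * (dpow s n F * Q)) = E * (dpow s m E * (dpow s n F * Q))"
    using dpow_Suc_left[of s m E] nz[of "Suc m"] Suc(2) by (simp add: mult.assoc[symmetric])
  also have "\<dots> = (\<Sum>t\<le>m. qbin s x t *\<^sub>c (qi s (int (Suc m - t)) *\<^sub>c G t + qi s (x + int m - int t + 1) *\<^sub>c G (Suc t)))"
    using Suc E by (simp add: x_def sum_distrib_left)
  also have "\<dots> = (\<Sum>t\<le>m. (qbin s x t * qi s (int (Suc m - t))) *\<^sub>c G t) +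
      (\<Sum>t\<le>m. (qbin s x t * qi s (x + int m - int t + 1)) *\<^sub>c G (Suc t))"
    by (simp add: csc_add_right sum.distrib)
  also have "(\<Sum>t\<le>m. (qbin s x t * qi s (int (Suc m - t))) *\<^sub>c G t) =
      (\<Sum>t\<le>Suc m. (qbin s x t * qi s (int (Suc m - t))) *\<^sub>c G t)"
    by simp
  also have "(\<Sum>t\<le>m. (qbin s x t * qi s (x + int m - int t + 1)) *\<^sub>c G (Suc t)) =
      (\<Sum>t\<le>Suc m. (if t = 0 then 0 else qbin s x (t - 1) * qi s (x + int m - int t + 2)) *\<^sub>c G t)"
    unfolding sum.atMost_Suc_shift by (simp add: algebra_simps)
  also have "(\<Sum>t\<le>Suc m. (qbin s x t * qi s (int (Suc m - t))) *\<^sub>c G t) + \<dots> =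
     (\<Sum>t\<le>Suc m. (qi s (int (Suc m)) * qbin s (x + 1) t) *\<^sub>c G t)"
    unfolding sum.distrib[symmetric] csc_add_left[symmetric]
    by (intro sum.cong refl) (simp only: coeff atMost_iff)
  also have "\<dots> = qi s (int (Suc m)) *\<^sub>c (\<Sum>t\<le>Suc m. qbin s (x + 1) t *\<^sub>c G t)"
    by (simp only: csc_sum_right csc_csc)
  finally show ?case
    using nz[of "Suc m"] Suc(2) by (simp add: csc_cancel G_def x_def algebra_simps)
qed simp

end

section \<open>Chains of sites\<close>

primrec oprod :: "(nat \<Rightarrow> 'a::monoid_mult) \<Rightarrow> nat \<Rightarrow> 'a" where
  "oprod k 0 = 1"
| "oprod k (Suc l) = oprod k l * k (Suc l)"

text \<open>\<open>\<Sum>\<^sub>i k'\<^sub>1 \<cdots> k'\<^bsub>i-1\<^esub> X\<^sub>i k\<^bsub>i+1\<^esub> \<cdots> k\<^sub>l\<close>\<close>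

primrec xsum :: "(nat \<Rightarrow> 'a::ring_1) \<Rightarrow> (nat \<Rightarrow> 'a) \<Rightarrow> (nat \<Rightarrow> 'a) \<Rightarrow> nat \<Rightarrow> 'a" where
  "xsum k k' X 0 = 0"
| "xsum k k' X (Suc l) = xsum k k' X l * k (Suc l) + oprod k' l * X (Suc l)"

text \<open>The reversed order is that of the monodromy matrix, where later sites stand on the
  left.\<close>

primrec rprod :: "(nat \<Rightarrow> 'a::monoid_mult) \<Rightarrow> nat \<Rightarrow> 'a" where
  "rprod M 0 = 1"
| "rprod M (Suc l) = M (Suc l) * rprod M l"

lemma commute_mult: "y * a = a * y \<Longrightarrow> y * b = b * y \<Longrightarrow> y * (a * b) = (a * b) * (y :: 'a::semigroup_mult)"
  by (metis mult.assoc)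

lemma oprod_commute: "(\<And>i. i \<in> {1..l} \<Longrightarrow> y * k i = k i * y) \<Longrightarrow> y * oprod k l = oprod k l * y"
  by (induct l) (simp_all add: commute_mult)

lemma rprod_commute: "(\<And>i. i \<in> {1..l} \<Longrightarrow> y * k i = k i * y) \<Longrightarrow> y * rprod k l = rprod k l * y"
  by (induct l) (simp_all add: commute_mult)

lemma xsum_commute:
  assumes "\<And>i. i \<in> {1..l} \<Longrightarrow> y * k i = k i * y" "\<And>i. i \<in> {1..l} \<Longrightarrow> y * k' i = k' i * y"
    "\<And>i. i \<in> {1..l} \<Longrightarrow> y * X i = X i * y"
  shows "y * xsum k k' X l = xsum k k' X l * y"
  using assms
proof (induct l)
  case (Suc l)
  have "y * (xsum k k' X l * k (Suc l)) = (xsum k k' X l * k (Suc l)) * y"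
    by (rule commute_mult) (use Suc in simp_all)
  moreover have "y * (oprod k' l * X (Suc l)) = (oprod k' l * X (Suc l)) * y"
    by (intro commute_mult oprod_commute) (use Suc in simp_all)
  ultimately show ?case by (simp add: algebra_simps)
qed simp

text \<open>\<open>S i\<close> plays the role of the operators on the i-th tensor factor. Only
  commutation across sites is fixed here; the relations within a site vary with the lemma.\<close>

locale sites =
  fixes S :: "nat \<Rightarrow> 'a::complex_alg set" and n :: nat
  assumes site_commute: "i \<in> {1..n} \<Longrightarrow> j \<in> {1..n} \<Longrightarrow> i \<noteq> j \<Longrightarrow> x \<in> S i \<Longrightarrow> y \<in> S j \<Longrightarrow> x * y = y * x"
begin

lemma later_commute:
  assumes "l < n" "y \<in> S (Suc l)" "\<And>i. i \<in> {1..n} \<Longrightarrow> k i \<in> S i"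
  shows "y * oprod k l = oprod k l * y"
  by (rule oprod_commute, rule site_commute) (use assms in auto)

lemma later_commute_xsum:
  assumes "l < n" "y \<in> S (Suc l)" "\<And>i. i \<in> {1..n} \<Longrightarrow> k i \<in> S i"
    "\<And>i. i \<in> {1..n} \<Longrightarrow> k' i \<in> S i" "\<And>i. i \<in> {1..n} \<Longrightarrow> X i \<in> S i"
  shows "y * xsum k k' X l = xsum k k' X l * y"
  by (rule xsum_commute; rule site_commute) (use assms in auto)

lemma oprod_oprod:
  assumes "l \<le> n" "\<And>i. i \<in> {1..n} \<Longrightarrow> k i \<in> S i" "\<And>i. i \<in> {1..n} \<Longrightarrow> k' i \<in> S i"
    "\<And>i. i \<in> {1..n} \<Longrightarrow> k i * k' i = k' i * k i"
  shows "oprod k l * oprod k' l = oprod k' l * oprod k l"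
proof -
  have "k i * oprod k' l = oprod k' l * k i" if "i \<in> {1..l}" for i
  proof (rule oprod_commute)
    fix j assume "j \<in> {1..l}"
    then show "k i * k' j = k' j * k i"
      using that assms site_commute[of i j "k i" "k' j"] by (cases "i = j") auto
  qed
  then have "oprod k' l * oprod k l = oprod k l * oprod k' l"
    by (intro oprod_commute) simp
  then show ?thesis by simp
qed

text \<open>Each summand of \<open>xsum\<close> contains exactly one X, which contributes the factor
  u; everything else commutes.\<close>

lemma oprod_xsum:
  assumes "l \<le> n" and S: "\<And>i. i \<in> {1..n} \<Longrightarrow> K i \<in> S i" "\<And>i. i \<in> {1..n} \<Longrightarrow> k i \<in> S i"
    "\<And>i. i \<in> {1..n} \<Longrightarrow> k' i \<in> S i" "\<And>i. i \<in> {1..n} \<Longrightarrow> X i \<in> S i"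
    and comm: "\<And>i. i \<in> {1..n} \<Longrightarrow> K i * k i = k i * K i" "\<And>i. i \<in> {1..n} \<Longrightarrow> K i * k' i = k' i * K i"
    and KX: "\<And>i. i \<in> {1..n} \<Longrightarrow> K i * X i = u *\<^sub>c (X i * K i)"
  shows "oprod K l * xsum k k' X l = u *\<^sub>c (xsum k k' X l * oprod K l)"
  using assms(1)
proof (induct l)
  case (Suc l)
  let ?A = "oprod K l" and ?A' = "oprod k' l" and ?B = "xsum k k' X l" and ?j = "Suc l"
  have l: "l < n" "l \<le> n" "?j \<in> {1..n}" using Suc by auto
  have 1: "?A * ?B = u *\<^sub>c (?B * ?A)" using Suc by simp
  have 2: "K ?j * ?B = ?B * K ?j" by (rule later_commute_xsum) (use l S in auto)
  have 3: "?A * k ?j = k ?j * ?A" by (rule later_commute[symmetric]) (use l S in auto)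
  have 4: "?A * X ?j = X ?j * ?A" by (rule later_commute[symmetric]) (use l S in auto)
  have 5: "K ?j * ?A' = ?A' * K ?j" by (rule later_commute) (use l S in auto)
  have 6: "?A * ?A' = ?A' * ?A" by (rule oprod_oprod) (use l S comm in auto)
  note r = 1 2 3 4 5 6 comm(1)[OF l(3)] comm(2)[OF l(3)] KX[OF l(3)]
  note r' = assoc_rule_csc[OF 1] assoc_rule[OF 2] assoc_rule[OF 3] assoc_rule[OF 4] assoc_rule[OF 5]
    assoc_rule[OF 6] assoc_rule[OF comm(1)[OF l(3)]] assoc_rule[OF comm(2)[OF l(3)]]
    assoc_rule_csc[OF KX[OF l(3)]]
  show ?case by (simp add: distrib_left distrib_right mult.assoc r r' csc_add_right)
qed simp

text \<open>One u comes from the earlier k' passing \<open>xsum\<close>, the other from X passing k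
  at the new site. With u = q this is the relation that the q-binomial formula requires.\<close>

lemma xsum_q_commute:
  assumes "l < n" and S: "\<And>i. i \<in> {1..n} \<Longrightarrow> k i \<in> S i"
    "\<And>i. i \<in> {1..n} \<Longrightarrow> k' i \<in> S i" "\<And>i. i \<in> {1..n} \<Longrightarrow> X i \<in> S i"
    and comm: "\<And>i. i \<in> {1..n} \<Longrightarrow> k i * k' i = k' i * k i"
    and kX: "\<And>i. i \<in> {1..n} \<Longrightarrow> k' i * X i = u *\<^sub>c (X i * k' i)" "\<And>i. i \<in> {1..n} \<Longrightarrow> X i * k i = u *\<^sub>c (k i * X i)"
  shows "(oprod k' l * X (Suc l)) * (xsum k k' X l * k (Suc l)) =
    u\<^sup>2 *\<^sub>c ((xsum k k' X l * k (Suc l)) * (oprod k' l * X (Suc l)))"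
proof -
  let ?A' = "oprod k' l" and ?B = "xsum k k' X l" and ?j = "Suc l"
  have l: "l \<le> n" "?j \<in> {1..n}" using assms(1) by auto
  have 1: "?A' * ?B = u *\<^sub>c (?B * ?A')" by (rule oprod_xsum) (use l S comm kX in auto)
  have 2: "X ?j * ?B = ?B * X ?j" by (rule later_commute_xsum) (use assms l S in auto)
  have 3: "k ?j * ?A' = ?A' * k ?j" by (rule later_commute) (use assms l S in auto)
  note kX' = kX(2)[OF l(2)]
  show ?thesis
    by (simp add: mult.assoc 1 2 3 kX' assoc_rule_csc[OF 1] assoc_rule[OF 2] assoc_rule[OF 3] assoc_rule_csc[OF kX']
        power2_eq_square)
qed

text \<open>When a site is added, the cross terms cancel because X and Y pick up inverse factors u
  and v. What remains telescopes: the old difference is multiplied by the new k^2, and the new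
  difference by the old product of the k'^2.\<close>

lemma xsum_commutator:
  assumes "l \<le> n" and S: "\<And>i. i \<in> {1..n} \<Longrightarrow> k i \<in> S i" "\<And>i. i \<in> {1..n} \<Longrightarrow> k' i \<in> S i"
    "\<And>i. i \<in> {1..n} \<Longrightarrow> X i \<in> S i" "\<And>i. i \<in> {1..n} \<Longrightarrow> Y i \<in> S i"
    and comm: "\<And>i. i \<in> {1..n} \<Longrightarrow> k i * k' i = k' i * k i"
    and k'X: "\<And>i. i \<in> {1..n} \<Longrightarrow> k' i * X i = u *\<^sub>c (X i * k' i)"
    and kX: "\<And>i. i \<in> {1..n} \<Longrightarrow> X i * k i = u *\<^sub>c (k i * X i)"
    and k'Y: "\<And>i. i \<in> {1..n} \<Longrightarrow> k' i * Y i = v *\<^sub>c (Y i * k' i)"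
    and kY: "\<And>i. i \<in> {1..n} \<Longrightarrow> Y i * k i = v *\<^sub>c (k i * Y i)"
    and uv: "u * v = 1"
    and YX: "\<And>i. i \<in> {1..n} \<Longrightarrow> d *\<^sub>c (Y i * X i - X i * Y i) = k i * k i - k' i * k' i"
  shows "d *\<^sub>c (xsum k k' Y l * xsum k k' X l - xsum k k' X l * xsum k k' Y l) =
    oprod k l * oprod k l - oprod k' l * oprod k' l"
  using assms(1)
proof (induct l)
  case (Suc l)
  let ?A = "oprod k l" and ?A' = "oprod k' l" and ?B = "xsum k k' X l" and ?C = "xsum k k' Y l" and ?j = "Suc l"
  have l: "l < n" "l \<le> n" "?j \<in> {1..n}" using Suc by auto
  have 1: "?A' * ?B = u *\<^sub>c (?B * ?A')" by (rule oprod_xsum) (use l S comm k'X in auto)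
  have 2: "?A' * ?C = v *\<^sub>c (?C * ?A')" by (rule oprod_xsum) (use l S comm k'Y in auto)
  have 3: "X ?j * ?B = ?B * X ?j" "Y ?j * ?B = ?B * Y ?j" "k ?j * ?B = ?B * k ?j"
    by (rule later_commute_xsum; use l S in auto)+
  have 4: "X ?j * ?C = ?C * X ?j" "Y ?j * ?C = ?C * Y ?j" "k ?j * ?C = ?C * k ?j"
    by (rule later_commute_xsum; use l S in auto)+
  have 5: "X ?j * ?A' = ?A' * X ?j" "Y ?j * ?A' = ?A' * Y ?j" "k ?j * ?A' = ?A' * k ?j" "k' ?j * ?A' = ?A' * k' ?j"
    by (rule later_commute; use l S in auto)+
  have 6: "k ?j * ?A = ?A * k ?j"
    by (rule later_commute; use l S in auto)+
  note j = kX[OF l(3)] kY[OF l(3)]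
  note r = 1 2 3 4 5 6 j assoc_rule_csc[OF 1] assoc_rule_csc[OF 2] 3[THEN assoc_rule] 4[THEN assoc_rule]
    5[THEN assoc_rule] 6[THEN assoc_rule] j[THEN assoc_rule_csc]
  have uv': "v * u = 1" using uv by (simp add: mult.commute)
  have "xsum k k' Y (Suc l) * xsum k k' X (Suc l) - xsum k k' X (Suc l) * xsum k k' Y (Suc l) =
    (?C * ?B - ?B * ?C) * (k ?j * k ?j) + (?A' * ?A') * (Y ?j * X ?j - X ?j * Y ?j)"
    by (simp add: distrib_left distrib_right left_diff_distrib right_diff_distrib mult.assoc r uv uv')
  then have "d *\<^sub>c (xsum k k' Y (Suc l) * xsum k k' X (Suc l) - xsum k k' X (Suc l) * xsum k k' Y (Suc l)) =
    (d *\<^sub>c (?C * ?B - ?B * ?C)) * (k ?j * k ?j) + (?A' * ?A') * (d *\<^sub>c (Y ?j * X ?j - X ?j * Y ?j))"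
    by (simp add: csc_add_right)
  also have "\<dots> = (?A * ?A - ?A' * ?A') * (k ?j * k ?j) + (?A' * ?A') * (k ?j * k ?j - k' ?j * k' ?j)"
    unfolding YX[OF l(3)] using Suc l by simp
  also have "\<dots> = oprod k (Suc l) * oprod k (Suc l) - oprod k' (Suc l) * oprod k' (Suc l)"
    by (simp add: left_diff_distrib right_diff_distrib mult.assoc r)
  finally show ?case .
qed simp

text \<open>Since k and k' are exchanged in the second sum, both orders of each cross term pick up
  the same factor, u or v.\<close>

lemma xsum_xsum_commute:
  assumes "l \<le> n" and S: "\<And>i. i \<in> {1..n} \<Longrightarrow> k i \<in> S i" "\<And>i. i \<in> {1..n} \<Longrightarrow> k' i \<in> S i"
    "\<And>i. i \<in> {1..n} \<Longrightarrow> X i \<in> S i" "\<And>i. i \<in> {1..n} \<Longrightarrow> Y i \<in> S i"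
    and comm: "\<And>i. i \<in> {1..n} \<Longrightarrow> k i * k' i = k' i * k i"
    and kX: "\<And>i. i \<in> {1..n} \<Longrightarrow> k i * X i = u *\<^sub>c (X i * k i)" "\<And>i. i \<in> {1..n} \<Longrightarrow> k' i * X i = v *\<^sub>c (X i * k' i)"
    and kY: "\<And>i. i \<in> {1..n} \<Longrightarrow> k i * Y i = u *\<^sub>c (Y i * k i)" "\<And>i. i \<in> {1..n} \<Longrightarrow> k' i * Y i = v *\<^sub>c (Y i * k' i)"
    and XY: "\<And>i. i \<in> {1..n} \<Longrightarrow> X i * Y i = Y i * X i"
  shows "xsum k k' X l * xsum k' k Y l = xsum k' k Y l * xsum k k' X l"
  using assms(1)
proof (induct l)
  case (Suc l)
  let ?A = "oprod k l" and ?A' = "oprod k' l" and ?B = "xsum k k' X l" and ?C = "xsum k' k Y l" and ?j = "Suc l"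
  have l: "l < n" "l \<le> n" "?j \<in> {1..n}" using Suc by auto
  have 1: "?A * ?B = u *\<^sub>c (?B * ?A)" "?A' * ?B = v *\<^sub>c (?B * ?A')"
    by (rule oprod_xsum; use l S comm kX in auto)+
  have 2: "?A * ?C = u *\<^sub>c (?C * ?A)" "?A' * ?C = v *\<^sub>c (?C * ?A')"
    by (rule oprod_xsum; use l S comm kY in auto)+
  have 3: "X ?j * ?B = ?B * X ?j" "Y ?j * ?B = ?B * Y ?j" "k ?j * ?B = ?B * k ?j" "k' ?j * ?B = ?B * k' ?j"
    by (rule later_commute_xsum; use l S in auto)+
  have 4: "X ?j * ?C = ?C * X ?j" "Y ?j * ?C = ?C * Y ?j" "k ?j * ?C = ?C * k ?j" "k' ?j * ?C = ?C * k' ?j"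
    by (rule later_commute_xsum; use l S in auto)+
  have 5: "X ?j * ?A' = ?A' * X ?j" "Y ?j * ?A' = ?A' * Y ?j" "k ?j * ?A' = ?A' * k ?j" "k' ?j * ?A' = ?A' * k' ?j"
    by (rule later_commute; use l S in auto)+
  have 6: "X ?j * ?A = ?A * X ?j" "Y ?j * ?A = ?A * Y ?j" "k ?j * ?A = ?A * k ?j" "k' ?j * ?A = ?A * k' ?j"
    by (rule later_commute; use l S in auto)+
  have 7: "?A * ?A' = ?A' * ?A" by (rule oprod_oprod) (use l S comm in auto)
  note j = kX[OF l(3)] kY[OF l(3)]
  note r = 1 2 3 4 5 6 7 j comm[OF l(3)] XY[OF l(3)] 1[THEN assoc_rule_csc] 2[THEN assoc_rule_csc] 3[THEN assoc_rule]
    4[THEN assoc_rule] 5[THEN assoc_rule] 6[THEN assoc_rule] 7[THEN assoc_rule] j[THEN assoc_rule_csc]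
    comm[OF l(3), THEN assoc_rule] XY[OF l(3), THEN assoc_rule]
  have ih: "?B * ?C = ?C * ?B" using Suc by simp
  show ?case
    by (simp add: distrib_left distrib_right mult.assoc r ih assoc_rule[OF ih])
qed simp

end

text \<open>The coproduct step of the intertwining relation: \<open>M\<^sub>l \<cdots> M\<^sub>1\<close> carries the auxiliary space
  past the sites one at a time.\<close>

lemma chain_weight:
  fixes M g k :: "nat \<Rightarrow> 'r::ring_1" and G :: 'r
  assumes "\<And>i. i \<in> {1..l} \<Longrightarrow> M i * (G * k i) = G * k i * M i"
    and "\<And>i j. i \<in> {1..l} \<Longrightarrow> j \<in> {1..l} \<Longrightarrow> i \<noteq> j \<Longrightarrow> M i * k j = k j * M i"
    and "\<And>i. i \<in> {1..l} \<Longrightarrow> G * k i = k i * G"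
  shows "rprod M l * (G * oprod k l) = G * oprod k l * rprod M l"
  using assms
proof (induct l)
  case (Suc l)
  let ?A = "oprod k l" and ?T = "rprod M l" and ?j = "Suc l"
  have 1: "?T * k ?j = k ?j * ?T" by (rule rprod_commute[symmetric]) (use Suc in auto)
  have 2: "M ?j * ?A = ?A * M ?j" by (rule oprod_commute) (use Suc in auto)
  have 3: "G * ?A = ?A * G" by (rule oprod_commute) (use Suc in auto)
  have ih: "?T * (G * ?A) = G * ?A * ?T" by (rule Suc(1)) (use Suc in auto)
  have G: "M ?j * (G * k ?j) = G * k ?j * M ?j" "G * k ?j = k ?j * G" using Suc by auto
  have "rprod M ?j * (G * oprod k ?j) = M ?j * (?T * (G * ?A)) * k ?j" by (simp add: mult.assoc)
  also have "\<dots> = M ?j * (?A * G) * (?T * k ?j)" unfolding ih unfolding 3 by (simp add: mult.assoc)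
  also have "\<dots> = ?A * (M ?j * (G * k ?j)) * ?T" unfolding 1 by (simp add: mult.assoc assoc_rule[OF 2])
  also have "\<dots> = G * oprod k ?j * rprod M ?j"
    unfolding G(1) by (simp add: mult.assoc assoc_rule[OF 3])
  finally show ?case .
qed simp

text \<open>The relation \<open>site\<close> has \<open>\<phi> (i - 1)\<close> on the right and
  \<open>\<phi> i\<close> on the left; along the chain these match up, and only
  \<open>\<phi> 0\<close> and \<open>\<phi> l\<close> survive at the ends. The relations
  \<open>w\<close> let the summands located at other sites pass.\<close>

lemma chain_intertwine:
  fixes M k k' X \<phi> :: "nat \<Rightarrow> 'r::ring_1" and g g' :: 'r
  assumes site: "\<And>i. i \<in> {1..l} \<Longrightarrow> M i * (g' * X i + \<phi> (i - 1) * k i) = (g * X i + \<phi> i * k' i) * M i"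
    and w: "\<And>i. i \<in> {1..l} \<Longrightarrow> M i * (g * k i) = g * k i * M i"
      "\<And>i. i \<in> {1..l} \<Longrightarrow> M i * (g' * k' i) = g' * k' i * M i"
    and M: "\<And>i j. i \<in> {1..l} \<Longrightarrow> j \<in> {1..l} \<Longrightarrow> i \<noteq> j \<Longrightarrow> M i * k j = k j * M i"
      "\<And>i j. i \<in> {1..l} \<Longrightarrow> j \<in> {1..l} \<Longrightarrow> i \<noteq> j \<Longrightarrow> M i * k' j = k' j * M i"
      "\<And>i j. i \<in> {1..l} \<Longrightarrow> j \<in> {1..l} \<Longrightarrow> i \<noteq> j \<Longrightarrow> M i * X j = X j * M i"
    and g: "\<And>i. i \<in> {1..l} \<Longrightarrow> g * k i = k i * g" "\<And>i. i \<in> {1..l} \<Longrightarrow> g * k' i = k' i * g"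
      "\<And>i. i \<in> {1..l} \<Longrightarrow> g * X i = X i * g"
      "\<And>i. i \<in> {1..l} \<Longrightarrow> g' * k' i = k' i * g'"
      "\<And>i j. i \<in> {1..l} \<Longrightarrow> j \<in> {0..l} \<Longrightarrow> \<phi> j * k' i = k' i * \<phi> j"
    and kX: "\<And>i j. i \<in> {1..l} \<Longrightarrow> j \<in> {1..l} \<Longrightarrow> i \<noteq> j \<Longrightarrow> k i * X j = X j * k i"
      "\<And>i j. i \<in> {1..l} \<Longrightarrow> j \<in> {1..l} \<Longrightarrow> k i * k' j = k' j * k i"
      "\<And>i j. i \<in> {1..l} \<Longrightarrow> j \<in> {1..l} \<Longrightarrow> k i * k j = k j * k i"
      "\<And>i j. i \<in> {1..l} \<Longrightarrow> j \<in> {1..l} \<Longrightarrow> k' i * k' j = k' j * k' i"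
  shows "rprod M l * (\<phi> 0 * oprod k l + g' * xsum k k' X l) =
    (g * xsum k k' X l + \<phi> l * oprod k' l) * rprod M l"
  using assms
proof (induct l)
  case (Suc l)
  let ?A = "oprod k l" and ?A' = "oprod k' l" and ?B = "xsum k k' X l" and ?T = "rprod M l" and ?j = "Suc l"
  have 1: "?T * k ?j = k ?j * ?T" "?T * X ?j = X ?j * ?T"
    by (rule rprod_commute[symmetric]; use Suc.prems in auto)+
  have 2: "M ?j * ?A' = ?A' * M ?j" by (rule oprod_commute) (use Suc.prems in auto)
  have 3: "M ?j * ?B = ?B * M ?j" by (rule xsum_commute) (use Suc.prems in auto)
  have 4: "g * ?A' = ?A' * g" "\<phi> l * ?A' = ?A' * \<phi> l" "\<phi> ?j * ?A' = ?A' * \<phi> ?j" "k' ?j * ?A' = ?A' * k' ?j"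
      "k ?j * ?A' = ?A' * k ?j"
    by (rule oprod_commute; use Suc.prems in auto)+
  have 5: "g * ?B = ?B * g" by (rule xsum_commute) (use Suc.prems in auto)
  have 6: "k ?j * ?B = ?B * k ?j" by (rule xsum_commute) (use Suc.prems in auto)
  have G: "?T * (g' * ?A') = g' * ?A' * ?T" by (rule chain_weight) (use Suc.prems in auto)
  have 7: "g' * ?A' = ?A' * g'" by (rule oprod_commute) (use Suc.prems in auto)
  have ih: "?T * (\<phi> 0 * ?A + g' * ?B) = (g * ?B + \<phi> l * ?A') * ?T"
    by (rule Suc.hyps) (use Suc.prems in auto)
  have site: "M ?j * (g' * X ?j + \<phi> l * k ?j) = (g * X ?j + \<phi> ?j * k' ?j) * M ?j"
    using Suc.prems(1)[of ?j] by simp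
  have w: "M ?j * (g * k ?j) = g * k ?j * M ?j" using Suc.prems(2)[of ?j] by simp
  have "rprod M ?j * (\<phi> 0 * oprod k ?j + g' * xsum k k' X ?j) =
      M ?j * (?T * (\<phi> 0 * ?A + g' * ?B)) * k ?j + M ?j * (?T * (g' * ?A')) * X ?j"
    by (simp add: algebra_simps)
  also have "\<dots> = M ?j * (?B * g + ?A' * \<phi> l) * k ?j * ?T + M ?j * (?A' * g') * X ?j * ?T"
    unfolding ih G unfolding 4(2) 5 7 by (simp add: algebra_simps 1)
  also have "\<dots> = ?B * (M ?j * (g * k ?j)) * ?T + ?A' * (M ?j * (g' * X ?j + \<phi> l * k ?j)) * ?T"
    by (simp add: algebra_simps assoc_rule[OF 2] assoc_rule[OF 3])
  also have "\<dots> = (?B * (g * k ?j) + ?A' * (g * X ?j + \<phi> ?j * k' ?j)) * rprod M ?j"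
    unfolding w site by (simp add: algebra_simps)
  also have "?B * (g * k ?j) + ?A' * (g * X ?j + \<phi> ?j * k' ?j) = g * xsum k k' X ?j + \<phi> ?j * oprod k' ?j"
    by (simp add: algebra_simps 4[THEN assoc_rule] assoc_rule[OF 5])
  finally show ?case .
qed simp

section \<open>Two by two matrices over a ring\<close>

text \<open>The auxiliary space. As 2 by 2 matrices over a noncommutative ring form a ring again,
  the chain lemmas apply to monodromy matrices directly.\<close>

datatype 'a m2 = M2 (e00: 'a) (e01: 'a) (e10: 'a) (e11: 'a)

instantiation m2 :: (ring_1) ring_1
begin

definition "0 = M2 0 0 0 0"
definition "1 = M2 1 0 0 1"
definition "x + y = M2 (e00 x + e00 y) (e01 x + e01 y) (e10 x + e10 y) (e11 x + e11 y)"
definition "x - y = M2 (e00 x - e00 y) (e01 x - e01 y) (e10 x - e10 y) (e11 x - e11 y)"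
definition "- x = M2 (- e00 x) (- e01 x) (- e10 x) (- e11 x)"
definition "x * y = M2 (e00 x * e00 y + e01 x * e10 y) (e00 x * e01 y + e01 x * e11 y)
  (e10 x * e00 y + e11 x * e10 y) (e10 x * e01 y + e11 x * e11 y)"

instance
  by standard (simp_all add: zero_m2_def one_m2_def plus_m2_def minus_m2_def uminus_m2_def times_m2_def algebra_simps)

end

lemma m2_simps [simp]:
  "M2 a b c d * M2 a' b' c' d' = M2 (a * a' + b * c') (a * b' + b * d') (c * a' + d * c') (c * b' + d * d')"
  "M2 a b c d + M2 a' b' c' d' = M2 (a + a') (b + b') (c + c') (d + d')"
  by (simp_all add: plus_m2_def times_m2_def)

definition emb :: "'a::ring_1 \<Rightarrow> 'a m2" where
  "emb x = M2 x 0 0 x"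

lemma emb_oprod: "oprod (\<lambda>i. emb (k i)) l = emb (oprod k l)"
  by (induct l) (simp_all add: emb_def one_m2_def)

lemma emb_xsum: "xsum (\<lambda>i. emb (k i)) (\<lambda>i. emb (k' i)) (\<lambda>i. emb (X i)) l = emb (xsum k k' X l)"
  by (induct l) (simp_all add: emb_oprod, simp_all add: emb_def zero_m2_def)

section \<open>Powers past the transfer matrix\<close>

lemma qi_Suc: "s \<noteq> 0 \<Longrightarrow> s\<^sup>2 - inverse (s\<^sup>2) \<noteq> 0 \<Longrightarrow>
    qi s (int (Suc n)) = s ^ (2 * n) + inverse (s\<^sup>2) * qi s (int n)"
  using qi_add[of s 1 "int n"]
  by (simp add: qi_1 power_int_minus power_int_def nat_mult_distrib power_inverse)

text \<open>Each X that a passes leaves a term with b K behind. As b commutes with X and K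
  contributes inverse powers of r^2, these terms form a geometric sum, which is a quantum
  integer.\<close>

lemma transfer_power_a:
  fixes a b X K :: "'a::complex_alg"
  assumes r: "r \<noteq> 0" "r\<^sup>2 - inverse (r\<^sup>2) \<noteq> 0"
    and aX: "a * X = r\<^sup>2 *\<^sub>c (X * a) - c *\<^sub>c (b * K)"
    and bX: "b * X = X * b" and KX: "K * X = inverse (r\<^sup>2) *\<^sub>c (X * K)"
  shows "a * X ^ Suc n = r ^ (2 * Suc n) *\<^sub>c (X ^ Suc n * a) - (c * qi r (int (Suc n))) *\<^sub>c (X ^ n * (b * K))"
proof (induct n)
  case 0
  then show ?case using aX r by (simp add: qi_1 power2_eq_square)
next
  case (Suc n)
  have bKX: "b * (K * X) = inverse (r\<^sup>2) *\<^sub>c (X * (b * K))"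
    using KX bX by (simp add: assoc_rule[OF bX])
  have "a * X ^ Suc (Suc n) = (a * X ^ Suc n) * X" by (simp only: power_Suc2 mult.assoc)
  also have "\<dots> = r ^ (2 * Suc n) *\<^sub>c (X ^ Suc n * (a * X)) - (c * qi r (int (Suc n))) *\<^sub>c (X ^ n * (b * (K * X)))"
    unfolding Suc by (simp add: left_diff_distrib mult.assoc)
  also have "\<dots> = r ^ (2 * Suc n) *\<^sub>c (X ^ Suc n * (r\<^sup>2 *\<^sub>c (X * a) - c *\<^sub>c (b * K)))
      - (c * qi r (int (Suc n))) *\<^sub>c (X ^ n * (inverse (r\<^sup>2) *\<^sub>c (X * (b * K))))"
    unfolding aX bKX ..
  also have "\<dots> = (r ^ (2 * Suc n) * r\<^sup>2) *\<^sub>c (X ^ Suc n * X * a)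
      - (r ^ (2 * Suc n) * c) *\<^sub>c (X ^ Suc n * (b * K))
      - (c * qi r (int (Suc n)) * inverse (r\<^sup>2)) *\<^sub>c (X ^ n * X * (b * K))"
    by (simp add: right_diff_distrib csc_diff_right mult.assoc del: power_Suc)
  also have "X ^ Suc n * X = X ^ Suc (Suc n)" by (simp only: power_Suc2)
  also have "X ^ n * X = X ^ Suc n" by (simp only: power_Suc2)
  also have "r ^ (2 * Suc n) * r\<^sup>2 = r ^ (2 * Suc (Suc n))" by (simp add: power_add[symmetric])
  finally show ?case
    unfolding qi_Suc[OF r, of "Suc n"]
    by (simp add: distrib_left csc_add_left mult.commute mult.left_commute del: power_Suc mult_Suc_right of_nat_Suc)
qed

text \<open>In the last term [n + 1] cancels against the q-factorial, which leaves a divided power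
  of order n. The relation for d is the one for a with r inverted, and quantum integers are
  invariant under this.\<close>

lemma transfer_dpow:
  fixes a b d X K K' :: "'a::complex_alg"
  assumes r: "r \<noteq> 0" "r\<^sup>2 - inverse (r\<^sup>2) \<noteq> 0" "qi r (int (Suc n)) \<noteq> 0"
    and aX: "a * X = r\<^sup>2 *\<^sub>c (X * a) - (r * y) *\<^sub>c (b * K)"
    and dX: "d * X = inverse (r\<^sup>2) *\<^sub>c (X * d) + (r * x) *\<^sub>c (b * K')"
    and bX: "b * X = X * b" and KX: "K * X = inverse (r\<^sup>2) *\<^sub>c (X * K)" and K'X: "K' * X = r\<^sup>2 *\<^sub>c (X * K')"
  shows "(a + d) * dpow r (Suc n) X - dpow r (Suc n) X * (a + d) =
    (r ^ (2 * Suc n) - 1) *\<^sub>c (dpow r (Suc n) X * a) + (inverse r ^ (2 * Suc n) - 1) *\<^sub>c (dpow r (Suc n) X * d)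
    + r *\<^sub>c (dpow r n X * b * (x *\<^sub>c K' - y *\<^sub>c K))"
proof -
  have a: "a * X ^ Suc n = r ^ (2 * Suc n) *\<^sub>c (X ^ Suc n * a) - (r * y * qi r (int (Suc n))) *\<^sub>c (X ^ n * (b * K))"
    by (rule transfer_power_a[OF r(1,2) aX bX KX])
  have d: "d * X ^ Suc n = inverse r ^ (2 * Suc n) *\<^sub>c (X ^ Suc n * d) + (r * x * qi r (int (Suc n))) *\<^sub>c (X ^ n * (b * K'))"
  proof -
    have "d * X ^ Suc n = inverse r ^ (2 * Suc n) *\<^sub>c (X ^ Suc n * d) - (- (r * x) * qi (inverse r) (int (Suc n))) *\<^sub>c (X ^ n * (b * K'))"
    proof (rule transfer_power_a)
      show "d * X = (inverse r)\<^sup>2 *\<^sub>c (X * d) - (- (r * x)) *\<^sub>c (b * K')"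
        unfolding dX by (simp add: power_inverse)
      show "K' * X = inverse ((inverse r)\<^sup>2) *\<^sub>c (X * K')"
        unfolding K'X by (simp add: power_inverse)
      show "(inverse r)\<^sup>2 - inverse ((inverse r)\<^sup>2) \<noteq> 0"
        using r(2) by (metis power_inverse inverse_inverse_eq right_minus_eq)
    qed (use r bX in simp_all)
    then show ?thesis unfolding qi_inverse mult_minus_left csc_minus_left by (simp only: diff_minus_eq_add)
  qed
  have "(a + d) * X ^ Suc n - X ^ Suc n * (a + d) =
    (r ^ (2 * Suc n) - 1) *\<^sub>c (X ^ Suc n * a) + (inverse r ^ (2 * Suc n) - 1) *\<^sub>c (X ^ Suc n * d)
    + qi r (int (Suc n)) *\<^sub>c r *\<^sub>c (X ^ n * b * (x *\<^sub>c K' - y *\<^sub>c K))"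
    unfolding distrib_right a d
    by (simp add: distrib_left csc_diff_left csc_diff_right right_diff_distrib mult.assoc mult_ac del: power_Suc mult_Suc_right of_nat_Suc)
  then have "(1 / q_fact r (Suc n)) *\<^sub>c ((a + d) * X ^ Suc n - X ^ Suc n * (a + d)) = (1 / q_fact r (Suc n)) *\<^sub>c
    ((r ^ (2 * Suc n) - 1) *\<^sub>c (X ^ Suc n * a) + (inverse r ^ (2 * Suc n) - 1) *\<^sub>c (X ^ Suc n * d)
    + qi r (int (Suc n)) *\<^sub>c r *\<^sub>c (X ^ n * b * (x *\<^sub>c K' - y *\<^sub>c K)))"
    by simp
  moreover have "1 / q_fact r (Suc n) * (qi r (int (Suc n)) * r) = r * (1 / q_fact r n)"
    using r(3) by (simp add: q_fact_Suc)
  ultimately show ?thesis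
    unfolding dpow_def csc_mult_left csc_mult_right csc_csc csc_add_right csc_diff_right
    by (simp add: mult.commute del: power_Suc mult_Suc_right of_nat_Suc)
qed

section \<open>Matrices as elements of a complex algebra\<close>

text \<open>Matrices of size \<open>n\<close> do not form a type. They act block-diagonally on sequences, through the
  index modulo \<open>n\<close>, which embeds them unitally into one algebra that does not depend on \<open>n\<close>.\<close>

typedef op = "{f :: (nat \<Rightarrow> complex) \<Rightarrow> nat \<Rightarrow> complex.
    (\<forall>v w. f (\<lambda>a. v a + w a) = (\<lambda>a. f v a + f w a)) \<and> (\<forall>c v. f (\<lambda>a. c * v a) = (\<lambda>a. c * f v a))}"
  morphisms app Abs_op
  by (rule exI[of _ "\<lambda>v. v"]) simp

setup_lifting type_definition_op

instantiation op :: complex_alg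
begin

lift_definition zero_op :: op is "\<lambda>v a. 0" by simp
lift_definition one_op :: op is "\<lambda>v. v" by simp
lift_definition plus_op :: "op \<Rightarrow> op \<Rightarrow> op" is "\<lambda>f g v a. f v a + g v a" by (simp add: algebra_simps)
lift_definition minus_op :: "op \<Rightarrow> op \<Rightarrow> op" is "\<lambda>f g v a. f v a - g v a" by (simp add: algebra_simps)
lift_definition uminus_op :: "op \<Rightarrow> op" is "\<lambda>f v a. - f v a" by simp
lift_definition times_op :: "op \<Rightarrow> op \<Rightarrow> op" is "\<lambda>f g v. f (g v)" by simp
lift_definition csc_op :: "complex \<Rightarrow> op \<Rightarrow> op" is "\<lambda>c f v a. c * f v a" by (simp add: algebra_simps)

instance
proof
  show "(0::op) \<noteq> 1"
  proof
    assume "(0::op) = 1"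
    then have "app 0 (\<lambda>_. 1) = app 1 (\<lambda>_. 1)" by simp
    then show False by transfer (metis zero_neq_one)
  qed
qed (transfer; simp add: fun_eq_iff algebra_simps)+

end

lemma app_simps [simp]:
  "app 0 v = (\<lambda>a. 0)" "app 1 v = v" "app (x + y) v = (\<lambda>a. app x v a + app y v a)"
  "app (x - y) v = (\<lambda>a. app x v a - app y v a)" "app (- x) v = (\<lambda>a. - app x v a)"
  "app (x * y) v = app x (app y v)" "app (c *\<^sub>c x) v = (\<lambda>a. c * app x v a)"
  by (transfer; simp)+

lemma app_add: "app x (\<lambda>a. v a + w a) = (\<lambda>a. app x v a + app x w a)"
  and app_scale: "app x (\<lambda>a. c * v a) = (\<lambda>a. c * app x v a)"
  by (transfer; blast)+

lemma app_zero: "app x (\<lambda>a. 0) = (\<lambda>a. 0)"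
  using app_scale[of x 0 "\<lambda>_. 0"] by simp

lemma app_sum: "app x (\<lambda>a. \<Sum>i\<in>I. v i a) = (\<lambda>a. \<Sum>i\<in>I. app x (v i) a)"
proof (induct I rule: infinite_finite_induct)
  case (insert i I)
  then show ?case using app_add[of x "v i" "\<lambda>a. \<Sum>i\<in>I. v i a"] by simp
qed (simp_all add: app_zero)

lemma op_eqI: "(\<And>v. app x v = app y v) \<Longrightarrow> x = y"
  by (simp add: app_inject[symmetric] fun_eq_iff)

lift_definition diag :: "(nat \<Rightarrow> complex) \<Rightarrow> op" is "\<lambda>d v a. d a * v a"
  by (simp add: algebra_simps)

lemma app_diag [simp]: "app (diag d) v = (\<lambda>a. d a * v a)"
  by transfer simp

text \<open>\<open>y\<close> raises eigenvalues of the diagonal operator by c, hence leads out of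
  the range of d. Sequences may have infinite support, so values on unit sequences do not determine
  \<open>y\<close>; a finite range makes the splitting into eigenvectors a finite sum.\<close>

lemma diag_bounded:
  assumes "finite (range d)" and bound: "\<And>a b. d a - d b \<noteq> c" and "br (diag d) y = c *\<^sub>c y"
  shows "y = 0"
proof (rule op_eqI)
  fix v :: "nat \<Rightarrow> complex"
  define w where "w t = (\<lambda>a. if d a = t then v a else 0)" for t
  have v: "v = (\<lambda>a. \<Sum>t\<in>range d. w t a)"
    using assms(1) by (simp add: w_def fun_eq_iff)
  have "app y (w t) a = 0" if "t \<in> range d" for t a
  proof -
    obtain b where b: "t = d b" using \<open>t \<in> range d\<close> by auto
    have "(\<lambda>a. d a * w t a) = (\<lambda>a. t * w t a)" by (auto simp: w_def)
    then have "app (br (diag d) y) (w t) a = (d a - t) * app y (w t) a"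
      by (simp add: br_def app_scale algebra_simps)
    then have "(d a - t - c) * app y (w t) a = 0"
      using assms(3) by (simp add: algebra_simps)
    then show ?thesis using bound[of a b] b by simp
  qed
  then show "app y v = app 0 v"
    unfolding v app_sum by simp
qed

section \<open>Embedding of matrices as block-diagonal operators\<close>

definition block_op :: "nat \<Rightarrow> complex mat \<Rightarrow> op" where
  "block_op n M = Abs_op (\<lambda>v a. \<Sum>b<n. M $$ (a mod n, b) * v (n * (a div n) + b))"

lemma app_block_op: "app (block_op n M) v = (\<lambda>a. \<Sum>b<n. M $$ (a mod n, b) * v (n * (a div n) + b))"
  unfolding block_op_def
  by (subst Abs_op_inverse) (simp_all add: distrib_left sum.distrib sum_distrib_left mult_ac)

lemma block_mod_div: "b < n \<Longrightarrow> (n * (a div n) + b) mod n = b" "b < n \<Longrightarrow> (n * (a div n) + b) div n = a div n"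
  for a b n :: nat
  by simp_all

lemma block_op_add: "M \<in> carrier_mat n n \<Longrightarrow> M' \<in> carrier_mat n n \<Longrightarrow> block_op n (M + M') = block_op n M + block_op n M'"
  by (rule op_eqI, cases "n = 0") (auto simp: app_block_op fun_eq_iff algebra_simps sum.distrib[symmetric] intro!: sum.cong)

lemma block_op_diff: "M \<in> carrier_mat n n \<Longrightarrow> M' \<in> carrier_mat n n \<Longrightarrow> block_op n (M - M') = block_op n M - block_op n M'"
  by (rule op_eqI, cases "n = 0") (auto simp: app_block_op fun_eq_iff algebra_simps sum_subtractf[symmetric] intro!: sum.cong)

lemma block_op_uminus: "M \<in> carrier_mat n n \<Longrightarrow> block_op n (- M) = - block_op n M"
  by (rule op_eqI, cases "n = 0") (auto simp: app_block_op fun_eq_iff sum_negf[symmetric] intro!: sum.cong)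

lemma block_op_smult: "M \<in> carrier_mat n n \<Longrightarrow> block_op n (c \<cdot>\<^sub>m M) = c *\<^sub>c block_op n M"
  by (rule op_eqI, cases "n = 0") (auto simp: app_block_op fun_eq_iff algebra_simps sum_distrib_left intro!: sum.cong)

lemma block_op_zero: "block_op n (0\<^sub>m n n) = 0"
  by (rule op_eqI, cases "n = 0") (auto simp: app_block_op fun_eq_iff)

lemma block_op_one: "n > 0 \<Longrightarrow> block_op n (1\<^sub>m n) = 1"
proof (rule op_eqI, rule ext)
  fix v a assume n: "n > 0"
  have "app (block_op n (1\<^sub>m n)) v a = (\<Sum>b<n. if b = a mod n then v (n * (a div n) + b) else 0)"
    unfolding app_block_op using n by (intro sum.cong) auto
  then show "app (block_op n (1\<^sub>m n)) v a = app 1 v a" using n by simp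
qed

lemma block_op_mult:
  assumes "M \<in> carrier_mat n n" "M' \<in> carrier_mat n n"
  shows "block_op n (M * M') = block_op n M * block_op n M'"
proof (rule op_eqI, rule ext)
  fix v a
  have "app (block_op n (M * M')) v a =
      (\<Sum>b<n. \<Sum>c<n. M $$ (a mod n, c) * M' $$ (c, b) * v (n * (a div n) + b))"
    unfolding app_block_op using assms
    by (cases "n = 0") (auto simp: scalar_prod_def sum_distrib_right atLeast0LessThan intro!: sum.cong)
  also have "\<dots> = (\<Sum>c<n. \<Sum>b<n. M $$ (a mod n, c) * M' $$ (c, b) * v (n * (a div n) + b))"
    by (rule sum.swap)
  also have "\<dots> = app (block_op n M * block_op n M') v a"
    by (simp add: app_block_op block_mod_div sum_distrib_left mult.assoc)
  finally show "app (block_op n (M * M')) v a = app (block_op n M * block_op n M') v a" .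
qed

lemma block_op_power:
  assumes "n > 0" "M \<in> carrier_mat n n"
  shows "block_op n (M ^\<^sub>m k) = block_op n M ^ k"
proof (induct k)
  case (Suc k)
  have "block_op n (M ^\<^sub>m Suc k) = block_op n (M ^\<^sub>m k) * block_op n M"
    using assms(2) by (simp add: block_op_mult[of _ n] pow_carrier_mat)
  then show ?case using Suc by (simp add: power_commutes)
qed (use assms in \<open>simp add: block_op_one carrier_matD\<close>)

definition ent :: "op \<Rightarrow> nat \<Rightarrow> nat \<Rightarrow> complex" where
  "ent x a b = app x (\<lambda>c. if c = b then 1 else 0) a"

lemma ent_simps [simp]: "ent 0 a b = 0" "ent (x + y) a b = ent x a b + ent y a b"
  "ent (x - y) a b = ent x a b - ent y a b" "ent (- x) a b = - ent x a b" "ent (c *\<^sub>c x) a b = c * ent x a b"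
  "ent 1 a b = (if a = b then 1 else 0)"
  by (simp_all add: ent_def)

lemma ent_sum: "ent (\<Sum>i\<in>I. x i) a b = (\<Sum>i\<in>I. ent (x i) a b)"
  by (induct I rule: infinite_finite_induct) simp_all

lemma ent_block_op: "a < n \<Longrightarrow> b < n \<Longrightarrow> ent (block_op n M) a b = M $$ (a, b)"
proof -
  assume ab: "a < n" "b < n"
  have "ent (block_op n M) a b = (\<Sum>c<n. if c = b then M $$ (a, c) else 0)"
    unfolding ent_def app_block_op using ab by (intro sum.cong) auto
  then show ?thesis using ab by simp
qed

definition Ops :: "nat \<Rightarrow> op set" where
  "Ops n = block_op n ` carrier_mat n n"

lemma OpsE: "x \<in> Ops n \<Longrightarrow> x = block_op n (mat n n (\<lambda>(a, b). ent x a b))"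
  unfolding Ops_def
proof safe
  fix M :: "complex mat" assume "M \<in> carrier_mat n n"
  then have "M = mat n n (\<lambda>(a, b). ent (block_op n M) a b)"
    by (intro eq_matI) (auto simp: ent_block_op)
  then show "block_op n M = block_op n (mat n n (\<lambda>(a, b). ent (block_op n M) a b))"
    by simp
qed

lemma Ops_eqI:
  assumes "x \<in> Ops n" "y \<in> Ops n" "\<And>a b. a < n \<Longrightarrow> b < n \<Longrightarrow> ent x a b = ent y a b"
  shows "x = y"
proof -
  have "mat n n (\<lambda>(a, b). ent x a b) = mat n n (\<lambda>(a, b). ent y a b)"
    using assms by (intro eq_matI) auto
  then show ?thesis using OpsE[OF assms(1)] OpsE[OF assms(2)] by simp
qed

lemma block_op_in_Ops [intro]: "M \<in> carrier_mat n n \<Longrightarrow> block_op n M \<in> Ops n"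
  by (simp add: Ops_def)

lemma Ops_closed:
  "0 \<in> Ops n" "n > 0 \<Longrightarrow> 1 \<in> Ops n" "x \<in> Ops n \<Longrightarrow> y \<in> Ops n \<Longrightarrow> x + y \<in> Ops n"
  "x \<in> Ops n \<Longrightarrow> y \<in> Ops n \<Longrightarrow> x - y \<in> Ops n"
  "x \<in> Ops n \<Longrightarrow> y \<in> Ops n \<Longrightarrow> x * y \<in> Ops n" "x \<in> Ops n \<Longrightarrow> c *\<^sub>c x \<in> Ops n"
proof -
  show "0 \<in> Ops n" using block_op_zero[of n] block_op_in_Ops[of "0\<^sub>m n n" n] by simp
  show "n > 0 \<Longrightarrow> 1 \<in> Ops n" using block_op_one[of n] block_op_in_Ops[of "1\<^sub>m n" n] by simp
  assume "x \<in> Ops n"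
  then obtain M where M: "x = block_op n M" "M \<in> carrier_mat n n" by (auto simp: Ops_def)
  show "c *\<^sub>c x \<in> Ops n"
    unfolding M(1) block_op_smult[OF M(2), symmetric] by (rule block_op_in_Ops) (use M in simp)
  assume "y \<in> Ops n"
  then obtain M' where M': "y = block_op n M'" "M' \<in> carrier_mat n n" by (auto simp: Ops_def)
  show "x + y \<in> Ops n" "x - y \<in> Ops n" "x * y \<in> Ops n"
    unfolding M(1) M'(1) block_op_add[OF M(2) M'(2), symmetric] block_op_diff[OF M(2) M'(2), symmetric]
      block_op_mult[OF M(2) M'(2), symmetric]
    by (intro block_op_in_Ops add_carrier_mat minus_carrier_mat mult_carrier_mat[OF M(2)] M'(2))+
qed

lemma Ops_power: "n > 0 \<Longrightarrow> x \<in> Ops n \<Longrightarrow> x ^ k \<in> Ops n"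
  by (induct k) (simp_all add: Ops_closed)

lemma Ops_sum: "(\<And>i. i \<in> I \<Longrightarrow> x i \<in> Ops n) \<Longrightarrow> (\<Sum>i\<in>I. x i) \<in> Ops n"
  by (induct I rule: infinite_finite_induct) (simp_all add: Ops_closed)

lemma Ops_dpow: "n > 0 \<Longrightarrow> x \<in> Ops n \<Longrightarrow> dpow s k x \<in> Ops n"
  by (simp add: dpow_def Ops_closed Ops_power)

lemma ent_mult:
  assumes "x \<in> Ops n" "y \<in> Ops n" "a < n" "b < n"
  shows "ent (x * y) a b = (\<Sum>c<n. ent x a c * ent y c b)"
proof -
  obtain M M' where M: "x = block_op n M" "M \<in> carrier_mat n n" "y = block_op n M'" "M' \<in> carrier_mat n n"
    using assms by (auto simp: Ops_def)
  then show ?thesis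
    using assms by (simp add: block_op_mult[symmetric] ent_block_op scalar_prod_def atLeast0LessThan)
qed

text \<open>Entrywise convergence on the first block. Membership in \<open>Ops n\<close> is included
  because it turns products into finite sums over entries, so that limits respect
  multiplication.\<close>

definition op_lim :: "nat \<Rightarrow> complex filter \<Rightarrow> (complex \<Rightarrow> op) \<Rightarrow> op \<Rightarrow> bool" where
  "op_lim n F X x \<longleftrightarrow> x \<in> Ops n \<and> (\<forall>\<^sub>F s in F. X s \<in> Ops n) \<and>
     (\<forall>a<n. \<forall>b<n. ((\<lambda>s. ent (X s) a b) \<longlongrightarrow> ent x a b) F)"

lemma op_lim_cong:
  assumes "\<forall>\<^sub>F s in F. X s = Y s" "op_lim n F Y x"
  shows "op_lim n F X x"
  unfolding op_lim_def
proof (intro conjI allI impI)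
  show "x \<in> Ops n" using assms by (simp add: op_lim_def)
  have "\<forall>\<^sub>F s in F. Y s \<in> Ops n" using assms(2) by (simp add: op_lim_def)
  with assms(1) show "\<forall>\<^sub>F s in F. X s \<in> Ops n" by eventually_elim simp
  fix a b assume "a < n" "b < n"
  then have "((\<lambda>s. ent (Y s) a b) \<longlongrightarrow> ent x a b) F" using assms(2) by (simp add: op_lim_def)
  moreover have "\<forall>\<^sub>F s in F. ent (Y s) a b = ent (X s) a b" using assms(1) by eventually_elim simp
  ultimately show "((\<lambda>s. ent (X s) a b) \<longlongrightarrow> ent x a b) F" by (rule Lim_transform_eventually)
qed

lemma op_lim_const: "x \<in> Ops n \<Longrightarrow> op_lim n F (\<lambda>_. x) x"
  by (simp add: op_lim_def)

lemma op_lim_add: "op_lim n F X x \<Longrightarrow> op_lim n F Y y \<Longrightarrow> op_lim n F (\<lambda>s. X s + Y s) (x + y)"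
  unfolding op_lim_def
  by (auto simp: Ops_closed elim: eventually_elim2 intro!: tendsto_add)

lemma op_lim_diff: "op_lim n F X x \<Longrightarrow> op_lim n F Y y \<Longrightarrow> op_lim n F (\<lambda>s. X s - Y s) (x - y)"
  unfolding op_lim_def
  by (auto simp: Ops_closed elim: eventually_elim2 intro!: tendsto_diff)

lemma op_lim_csc: "(c \<longlongrightarrow> c') F \<Longrightarrow> op_lim n F X x \<Longrightarrow> op_lim n F (\<lambda>s. c s *\<^sub>c X s) (c' *\<^sub>c x)"
  unfolding op_lim_def
  by (auto simp: Ops_closed elim: eventually_mono intro!: tendsto_mult)

lemma op_lim_mult:
  assumes "op_lim n F X x" "op_lim n F Y y"
  shows "op_lim n F (\<lambda>s. X s * Y s) (x * y)"
  unfolding op_lim_def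
proof (intro conjI allI impI)
  show xy: "x * y \<in> Ops n" using assms by (simp add: op_lim_def Ops_closed)
  have ev: "\<forall>\<^sub>F s in F. X s \<in> Ops n \<and> Y s \<in> Ops n"
    using assms by (simp add: op_lim_def eventually_conj)
  then show "\<forall>\<^sub>F s in F. X s * Y s \<in> Ops n" by eventually_elim (simp add: Ops_closed)
  fix a b assume ab: "a < n" "b < n"
  have "((\<lambda>s. \<Sum>c<n. ent (X s) a c * ent (Y s) c b) \<longlongrightarrow> (\<Sum>c<n. ent x a c * ent y c b)) F"
    using assms ab by (intro tendsto_sum tendsto_mult) (auto simp: op_lim_def)
  also have "(\<Sum>c<n. ent x a c * ent y c b) = ent (x * y) a b"
    using assms ab by (simp add: op_lim_def ent_mult[of x n y])
  finally show "((\<lambda>s. ent (X s * Y s) a b) \<longlongrightarrow> ent (x * y) a b) F"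
    by (rule Lim_transform_eventually) (use ev in eventually_elim, simp add: ent_mult[of _ n] ab)
qed

lemma op_lim_power: "n > 0 \<Longrightarrow> op_lim n F X x \<Longrightarrow> op_lim n F (\<lambda>s. X s ^ k) (x ^ k)"
  by (induct k) (simp_all add: op_lim_mult op_lim_const Ops_closed)

lemma op_lim_sum: "(\<And>i. i \<in> I \<Longrightarrow> op_lim n F (X i) (x i)) \<Longrightarrow> op_lim n F (\<lambda>s. \<Sum>i\<in>I. X i s) (\<Sum>i\<in>I. x i)"
  by (induct I rule: infinite_finite_induct) (simp_all add: op_lim_add op_lim_const Ops_closed)

lemma op_lim_unique:
  assumes "F \<noteq> bot" "op_lim n F X x" "op_lim n F X y"
  shows "x = y"
proof (rule Ops_eqI[of _ n])
  fix a b assume "a < n" "b < n"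
  then have "((\<lambda>s. ent (X s) a b) \<longlongrightarrow> ent x a b) F" "((\<lambda>s. ent (X s) a b) \<longlongrightarrow> ent y a b) F"
    using assms by (simp_all add: op_lim_def)
  then show "ent x a b = ent y a b" by (rule tendsto_unique[OF assms(1)])
qed (use assms in \<open>simp_all add: op_lim_def\<close>)

lemma op_lim_block_op:
  assumes "\<And>s. M s \<in> carrier_mat n n" "M' \<in> carrier_mat n n"
    "\<And>a b. a < n \<Longrightarrow> b < n \<Longrightarrow> ((\<lambda>s. M s $$ (a, b)) \<longlongrightarrow> M' $$ (a, b)) F"
  shows "op_lim n F (\<lambda>s. block_op n (M s)) (block_op n M')"
  using assms by (simp add: op_lim_def block_op_in_Ops ent_block_op)

text \<open>\<open>Lim\<close> is the limit only if there is one, so convergence has to be known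
  beforehand.\<close>

lemma block_op_mat_lim:
  assumes "F \<noteq> bot" "\<And>s. M s \<in> carrier_mat n n" "op_lim n F (\<lambda>s. block_op n (M s)) x"
  shows "block_op n (mat_lim n F M) = x"
proof (rule Ops_eqI[of _ n])
  show "block_op n (mat_lim n F M) \<in> Ops n" by (rule block_op_in_Ops) (simp add: mat_lim_def)
  show "x \<in> Ops n" using assms by (simp add: op_lim_def)
  fix a b assume ab: "a < n" "b < n"
  then have "((\<lambda>s. M s $$ (a, b)) \<longlongrightarrow> ent x a b) F"
    using assms(3) by (simp add: op_lim_def ent_block_op)
  then show "ent (block_op n (mat_lim n F M)) a b = ent x a b"
    using ab assms(1) by (simp add: ent_block_op mat_lim_def tendsto_Lim)
qed

text \<open>A vector fills the first block and is continued by zero; \<open>op_vec\<close> reads off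
  the first block of the result.\<close>

definition seq_of :: "nat \<Rightarrow> complex vec \<Rightarrow> nat \<Rightarrow> complex" where
  "seq_of n v = (\<lambda>a. if a < n then v $ a else 0)"

definition op_vec :: "nat \<Rightarrow> op \<Rightarrow> complex vec \<Rightarrow> complex vec" where
  "op_vec n x v = vec n (app x (seq_of n v))"

lemma op_vec_block_op:
  assumes "M \<in> carrier_mat n n" "v \<in> carrier_vec n"
  shows "op_vec n (block_op n M) v = M *\<^sub>v v"
  using assms
  by (intro eq_vecI) (auto simp: op_vec_def app_block_op seq_of_def scalar_prod_def atLeast0LessThan intro!: sum.cong)

lemma op_vec_carrier [simp]: "op_vec n x v \<in> carrier_vec n"
  by (simp add: op_vec_def)

lemma op_vec_add_right:
  assumes "v \<in> carrier_vec n" "w \<in> carrier_vec n"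
  shows "op_vec n x (v + w) = op_vec n x v + op_vec n x w"
proof -
  have "seq_of n (v + w) = (\<lambda>a. seq_of n v a + seq_of n w a)"
    using assms by (auto simp: seq_of_def)
  then show ?thesis by (intro eq_vecI) (simp_all add: op_vec_def app_add)
qed

lemma op_vec_smult_right:
  assumes "v \<in> carrier_vec n"
  shows "op_vec n x (c \<cdot>\<^sub>v v) = c \<cdot>\<^sub>v op_vec n x v"
proof -
  have "seq_of n (c \<cdot>\<^sub>v v) = (\<lambda>a. c * seq_of n v a)"
    using assms by (auto simp: seq_of_def)
  then show ?thesis by (intro eq_vecI) (simp_all add: op_vec_def app_scale)
qed

lemma op_vec_add_left: "op_vec n (x + y) v = op_vec n x v + op_vec n y v"
  and op_vec_csc_left: "op_vec n (c *\<^sub>c x) v = c \<cdot>\<^sub>v op_vec n x v"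
  and op_vec_diff_left: "op_vec n (x - y) v = op_vec n x v - op_vec n y v"
  by (intro eq_vecI; simp add: op_vec_def)+

section \<open>Tensor products\<close>

lemma dim_kronecker [simp]:
  "dim_row (X \<otimes>\<^sub>K Y) = dim_row X * dim_row Y" "dim_col (X \<otimes>\<^sub>K Y) = dim_col X * dim_col Y"
  by (simp_all add: kronecker_def)

lemma kronecker_carrier:
  "X \<in> carrier_mat m m' \<Longrightarrow> Y \<in> carrier_mat n n' \<Longrightarrow> X \<otimes>\<^sub>K Y \<in> carrier_mat (m * n) (m' * n')"
  by (auto intro: carrier_matI)

lemma kronecker_index:
  "X \<in> carrier_mat m m' \<Longrightarrow> Y \<in> carrier_mat n n' \<Longrightarrow> a < m * n \<Longrightarrow> b < m' * n' \<Longrightarrow>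
    (X \<otimes>\<^sub>K Y) $$ (a, b) = X $$ (a div n, b div n') * Y $$ (a mod n, b mod n')"
  by (auto simp: kronecker_def)

lemma div_mod_less: "a < m * n \<Longrightarrow> a div n < m \<and> a mod n < n" for a m n :: nat
  by (metis less_mult_imp_div_less mod_less_divisor mult_0_right neq0_conv not_less_zero)

lemma div_less_of_mult: "a < m * n \<Longrightarrow> a div n < m"
  and mod_less_of_mult: "a < m * n \<Longrightarrow> a mod n < n" for a m n :: nat
  using div_mod_less by blast+

lemma sum_div_mod: "(\<Sum>k<m * n. g (k div n) (k mod n)) = (\<Sum>i<m. \<Sum>j<n. g i j)" for m n :: nat
proof -
  have "(\<Sum>k<m * n. g (k div n) (k mod n)) = (\<Sum>i<m. \<Sum>k\<in>{i * n..<i * n + n}. g (k div n) (k mod n))"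
    by (rule sum.nat_group[symmetric])
  also have "\<dots> = (\<Sum>i<m. \<Sum>j<n. g i j)"
  proof (rule sum.cong[OF refl])
    fix i assume "i \<in> {..<m}"
    show "(\<Sum>k\<in>{i * n..<i * n + n}. g (k div n) (k mod n)) = (\<Sum>j<n. g i j)"
      using sum.shift_bounds_nat_ivl[of "\<lambda>k. g (k div n) (k mod n)" 0 "i * n" n]
      by (simp add: add.commute lessThan_atLeast0)
  qed
  finally show ?thesis .
qed

lemma kronecker_mult:
  assumes X: "X \<in> carrier_mat m c" "X' \<in> carrier_mat c m'" and Y: "Y \<in> carrier_mat n d" "Y' \<in> carrier_mat d n'"
  shows "(X \<otimes>\<^sub>K Y) * (X' \<otimes>\<^sub>K Y') = (X * X') \<otimes>\<^sub>K (Y * Y')"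
proof (rule eq_matI)
  fix a b assume "a < dim_row ((X * X') \<otimes>\<^sub>K (Y * Y'))" "b < dim_col ((X * X') \<otimes>\<^sub>K (Y * Y'))"
  then have ab: "a < m * n" "b < m' * n'" using X Y by auto
  note dm = div_mod_less[OF ab(1)] div_mod_less[OF ab(2)]
  have "((X \<otimes>\<^sub>K Y) * (X' \<otimes>\<^sub>K Y')) $$ (a, b) = (\<Sum>k<c * d. (X \<otimes>\<^sub>K Y) $$ (a, k) * (X' \<otimes>\<^sub>K Y') $$ (k, b))"
    using ab X Y by (auto simp: scalar_prod_def atLeast0LessThan)
  also have "\<dots> = (\<Sum>k<c * d. (X $$ (a div n, k div d) * X' $$ (k div d, b div n')) *
      (Y $$ (a mod n, k mod d) * Y' $$ (k mod d, b mod n')))"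
    using ab by (intro sum.cong refl) (simp add: kronecker_index[OF X(1) Y(1)] kronecker_index[OF X(2) Y(2)])
  also have "\<dots> = (\<Sum>i<c. \<Sum>j<d. (X $$ (a div n, i) * X' $$ (i, b div n')) * (Y $$ (a mod n, j) * Y' $$ (j, b mod n')))"
    by (rule sum_div_mod)
  also have "\<dots> = (\<Sum>i<c. X $$ (a div n, i) * X' $$ (i, b div n')) * (\<Sum>j<d. Y $$ (a mod n, j) * Y' $$ (j, b mod n'))"
    by (simp add: sum_product)
  also have "\<dots> = (X * X') $$ (a div n, b div n') * (Y * Y') $$ (a mod n, b mod n')"
    using dm X Y by (auto simp: scalar_prod_def atLeast0LessThan)
  also have "\<dots> = ((X * X') \<otimes>\<^sub>K (Y * Y')) $$ (a, b)"
    using kronecker_index[of "X * X'" m m' "Y * Y'" n n' a b] X Y ab by simp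
  finally show "((X \<otimes>\<^sub>K Y) * (X' \<otimes>\<^sub>K Y')) $$ (a, b) = ((X * X') \<otimes>\<^sub>K (Y * Y')) $$ (a, b)" .
qed (use X Y in auto)

lemma kronecker_one: "1\<^sub>m m \<otimes>\<^sub>K 1\<^sub>m n = 1\<^sub>m (m * n)"
proof (rule eq_matI)
  fix a b assume ab: "a < dim_row (1\<^sub>m (m * n))" "b < dim_col (1\<^sub>m (m * n))"
  then have "a div n = b div n \<and> a mod n = b mod n \<longleftrightarrow> a = b" by (metis div_mult_mod_eq)
  then show "(1\<^sub>m m \<otimes>\<^sub>K 1\<^sub>m n) $$ (a, b) = 1\<^sub>m (m * n) $$ (a, b)"
    using ab div_mod_less[of a m n] div_mod_less[of b m n] by (auto simp: kronecker_def)
qed auto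

text \<open>Factors given by a function on 1, ..., L instead of a list, which suits induction on the
  number of sites and factorwise changes.\<close>

primrec tens :: "nat \<Rightarrow> (nat \<Rightarrow> complex mat) \<Rightarrow> complex mat" where
  "tens 0 F = 1\<^sub>m 1"
| "tens (Suc L) F = F 1 \<otimes>\<^sub>K tens L (\<lambda>j. F (Suc j))"

lemma tens_cong: "(\<And>j. 1 \<le> j \<Longrightarrow> j \<le> L \<Longrightarrow> F j = G j) \<Longrightarrow> tens L F = tens L G"
proof (induct L arbitrary: F G)
  case (Suc L)
  have "F 1 = G 1" using Suc(2)[of 1] by simp
  moreover have "tens L (\<lambda>j. F (Suc j)) = tens L (\<lambda>j. G (Suc j))"
    by (rule Suc(1)) (use Suc(2) in auto)
  ultimately show ?case by simp
qed simp

lemma tensor_list_eq_tens: "tensor_list Xs = tens (length Xs) (\<lambda>j. Xs ! (j - 1))"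
proof (induct Xs)
  case (Cons X Xs)
  have "tens (length Xs) (\<lambda>j. (X # Xs) ! (Suc j - 1)) = tens (length Xs) (\<lambda>j. Xs ! (j - 1))"
    by (rule tens_cong) (simp add: nth_Cons')
  then show ?case using Cons by (simp add: tensor_list_def)
qed (simp add: tensor_list_def)

lemma tens_carrier:
  "(\<And>j. 1 \<le> j \<Longrightarrow> j \<le> L \<Longrightarrow> F j \<in> carrier_mat N N) \<Longrightarrow> tens L F \<in> carrier_mat (N ^ L) (N ^ L)"
  by (induct L arbitrary: F) (simp_all add: kronecker_carrier)

lemma tens_mult:
  "(\<And>j. 1 \<le> j \<Longrightarrow> j \<le> L \<Longrightarrow> F j \<in> carrier_mat N N) \<Longrightarrow> (\<And>j. 1 \<le> j \<Longrightarrow> j \<le> L \<Longrightarrow> G j \<in> carrier_mat N N) \<Longrightarrow>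
    tens L F * tens L G = tens L (\<lambda>j. F j * G j)"
proof (induct L arbitrary: F G)
  case (Suc L)
  have "tens L (\<lambda>j. F (Suc j)) \<in> carrier_mat (N ^ L) (N ^ L)" "tens L (\<lambda>j. G (Suc j)) \<in> carrier_mat (N ^ L) (N ^ L)"
    by (rule tens_carrier; use Suc in simp)+
  then have "tens (Suc L) F * tens (Suc L) G = (F 1 * G 1) \<otimes>\<^sub>K (tens L (\<lambda>j. F (Suc j)) * tens L (\<lambda>j. G (Suc j)))"
    using Suc(2,3)[of 1] by (simp add: kronecker_mult)
  then show ?case using Suc by simp
qed simp

lemma tens_one: "tens L (\<lambda>_. 1\<^sub>m N) = 1\<^sub>m (N ^ L)"
  by (induct L) (simp_all add: kronecker_one)

lemma kronecker_add_left:
  "X \<in> carrier_mat m m' \<Longrightarrow> X' \<in> carrier_mat m m' \<Longrightarrow> (X + X') \<otimes>\<^sub>K Y = X \<otimes>\<^sub>K Y + X' \<otimes>\<^sub>K Y"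
  by (rule eq_matI) (auto simp: kronecker_def algebra_simps div_less_of_mult mod_less_of_mult)

lemma kronecker_add_right:
  "Y \<in> carrier_mat m m' \<Longrightarrow> Y' \<in> carrier_mat m m' \<Longrightarrow> X \<otimes>\<^sub>K (Y + Y') = X \<otimes>\<^sub>K Y + X \<otimes>\<^sub>K Y'"
  by (rule eq_matI) (auto simp: kronecker_def algebra_simps div_less_of_mult mod_less_of_mult)

lemma kronecker_smult_left: "(c \<cdot>\<^sub>m X) \<otimes>\<^sub>K Y = c \<cdot>\<^sub>m (X \<otimes>\<^sub>K Y)"
  by (rule eq_matI) (auto simp: kronecker_def div_less_of_mult mod_less_of_mult)

lemma kronecker_smult_right: "X \<otimes>\<^sub>K (c \<cdot>\<^sub>m Y) = c \<cdot>\<^sub>m (X \<otimes>\<^sub>K Y)"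
  by (rule eq_matI) (auto simp: kronecker_def div_less_of_mult mod_less_of_mult)

text \<open>\<^const>\<open>at_site\<close> counts sites from 1.\<close>

lemma at_site_eq_tens:
  assumes "1 \<le> i" "i \<le> L"
  shows "at_site N L i X = tens L (\<lambda>j. if j = i then X else 1\<^sub>m N)"
  unfolding at_site_def tensor_list_eq_tens using assms
  by (auto simp: nth_append nth_Cons' intro!: tens_cong)

lemma at_site_carrier:
  "1 \<le> i \<Longrightarrow> i \<le> L \<Longrightarrow> X \<in> carrier_mat N N \<Longrightarrow> at_site N L i X \<in> carrier_mat (N ^ L) (N ^ L)"
  by (auto simp: at_site_eq_tens intro!: tens_carrier)

lemma at_site_Suc:
  assumes "1 \<le> i" "i \<le> L"
  shows "at_site N (Suc L) (Suc i) X = 1\<^sub>m N \<otimes>\<^sub>K at_site N L i X"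
  using assms by (simp add: at_site_eq_tens)

lemma at_site_1: "at_site N (Suc L) 1 X = X \<otimes>\<^sub>K 1\<^sub>m (N ^ L)"
proof -
  have "tens L (\<lambda>j. if Suc j = Suc 0 then X else 1\<^sub>m N) = tens L (\<lambda>_. 1\<^sub>m N)"
    by (rule tens_cong) auto
  then show ?thesis using tens_one[of L N] by (simp add: at_site_eq_tens)
qed

lemma at_site_induct [consumes 2, case_names first later]:
  assumes "1 \<le> i" "i \<le> L"
    and "\<And>L. Q (Suc L) 1" and "\<And>L i. 1 \<le> i \<Longrightarrow> i \<le> L \<Longrightarrow> Q L i \<Longrightarrow> Q (Suc L) (Suc i)"
  shows "Q L i"
  using assms(1,2)
proof (induct L arbitrary: i)
  case (Suc L)
  then show ?case using assms(3,4) by (cases "i = 1") (auto, metis One_nat_def Suc_le_D Suc_le_mono le_antisym not_less_eq_eq)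
qed simp

lemma at_site_add:
  assumes "1 \<le> i" "i \<le> L" "X \<in> carrier_mat N N" "Y \<in> carrier_mat N N"
  shows "at_site N L i (X + Y) = at_site N L i X + at_site N L i Y"
  using assms(1,2)
proof (induct L i rule: at_site_induct)
  case (first L)
  show ?case unfolding at_site_1 using assms by (intro kronecker_add_left)
next
  case (later L i)
  then show ?case
    using kronecker_add_right[OF at_site_carrier[OF later(1,2) assms(3)] at_site_carrier[OF later(1,2) assms(4)]]
    by (simp add: at_site_Suc)
qed

lemma at_site_smult:
  assumes "1 \<le> i" "i \<le> L"
  shows "at_site N L i (c \<cdot>\<^sub>m X) = c \<cdot>\<^sub>m at_site N L i X"
  using assms
proof (induct L i rule: at_site_induct)
  case (first L)
  show ?case unfolding at_site_1 by (rule kronecker_smult_left)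
next
  case (later L i)
  then show ?case by (simp add: at_site_Suc kronecker_smult_right)
qed

definition site :: "nat \<Rightarrow> nat \<Rightarrow> nat \<Rightarrow> complex mat \<Rightarrow> op" where
  "site N L i X = block_op (N ^ L) (at_site N L i X)"

context
  fixes N L :: nat
  assumes N: "N > 0"
begin

lemma site_mult:
  assumes "i \<in> {1..L}" "X \<in> carrier_mat N N" "Y \<in> carrier_mat N N"
  shows "site N L i (X * Y) = site N L i X * site N L i Y"
proof -
  have "at_site N L i X * at_site N L i Y = at_site N L i (X * Y)"
    using assms by (subst at_site_eq_tens, simp, simp)+ (subst tens_mult[where N = N], auto intro!: tens_cong)
  then show ?thesis
    using assms at_site_carrier[of i L] by (simp add: site_def block_op_mult[symmetric])
qed

lemma sites_swap:
  assumes "i \<in> {1..L}" "j \<in> {1..L}" "i \<noteq> j" "X \<in> carrier_mat N N" "Y \<in> carrier_mat N N"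
  shows "site N L i X * site N L j Y = site N L j Y * site N L i X"
proof -
  have "at_site N L i X * at_site N L j Y = at_site N L j Y * at_site N L i X"
    using assms by (subst at_site_eq_tens, simp, simp)+ (subst tens_mult[where N = N], auto,
        subst tens_mult[where N = N], auto intro!: tens_cong)
  then show ?thesis
    using assms at_site_carrier[of i L X N] at_site_carrier[of j L Y N] by (simp add: site_def block_op_mult[symmetric])
qed

lemma site_add:
  "i \<in> {1..L} \<Longrightarrow> X \<in> carrier_mat N N \<Longrightarrow> Y \<in> carrier_mat N N \<Longrightarrow> site N L i (X + Y) = site N L i X + site N L i Y"
  using at_site_carrier[of i L _ N] by (simp add: site_def at_site_add block_op_add)

lemma site_smult: "i \<in> {1..L} \<Longrightarrow> X \<in> carrier_mat N N \<Longrightarrow> site N L i (c \<cdot>\<^sub>m X) = c *\<^sub>c site N L i X"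
  using at_site_carrier[of i L _ N] by (simp add: site_def at_site_smult block_op_smult)

lemma site_diff:
  assumes "i \<in> {1..L}" "X \<in> carrier_mat N N" "Y \<in> carrier_mat N N"
  shows "site N L i (X - Y) = site N L i X - site N L i Y"
proof -
  have "X - Y = X + (- 1) \<cdot>\<^sub>m Y" using assms by (intro eq_matI) auto
  then show ?thesis using assms by (simp add: site_add site_smult)
qed

lemma site_one: "i \<in> {1..L} \<Longrightarrow> site N L i (1\<^sub>m N) = 1"
  using N tens_one[of L N] by (simp add: site_def at_site_eq_tens block_op_one cong: if_cong)

lemma site_power: "i \<in> {1..L} \<Longrightarrow> X \<in> carrier_mat N N \<Longrightarrow> site N L i (X ^\<^sub>m k) = site N L i X ^ k"
proof (induct k)
  case 0
  then show ?case by (simp add: site_one)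
next
  case (Suc k)
  then show ?case by (simp add: site_mult pow_carrier_mat power_commutes)
qed

text \<open>The factors are filled in from the left: multiplying by \<open>at_site\<close> at
  \<open>Suc l\<close> replaces the identity there by the next factor.\<close>

lemma block_op_tens:
  assumes F: "\<And>j. j \<in> {1..L} \<Longrightarrow> F j \<in> carrier_mat N N"
  shows "block_op (N ^ L) (tens L F) = oprod (\<lambda>i. site N L i (F i)) L"
proof -
  have "block_op (N ^ L) (tens L (\<lambda>j. if j \<le> l then F j else 1\<^sub>m N)) = oprod (\<lambda>i. site N L i (F i)) l" if "l \<le> L" for l
    using that
  proof (induct l)
    case 0
    have "tens L (\<lambda>j. if j \<le> 0 then F j else 1\<^sub>m N) = tens L (\<lambda>_. 1\<^sub>m N)" by (rule tens_cong) auto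
    then show ?case using N by (simp add: tens_one block_op_one)
  next
    case (Suc l)
    have j: "Suc l \<in> {1..L}" using Suc by auto
    have "tens L (\<lambda>j. if j \<le> Suc l then F j else 1\<^sub>m N) =
        tens L (\<lambda>j. if j \<le> l then F j else 1\<^sub>m N) * at_site N L (Suc l) (F (Suc l))"
    proof -
      have "tens L (\<lambda>j. if j \<le> l then F j else 1\<^sub>m N) * tens L (\<lambda>j. if j = Suc l then F (Suc l) else 1\<^sub>m N)
        = tens L (\<lambda>j. (if j \<le> l then F j else 1\<^sub>m N) * (if j = Suc l then F (Suc l) else 1\<^sub>m N))"
        by (rule tens_mult[where N = N]) (use F j in auto)
      also have "\<dots> = tens L (\<lambda>j. if j \<le> Suc l then F j else 1\<^sub>m N)"
      proof (rule tens_cong)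
        fix i assume "1 \<le> i" "i \<le> L"
        then have "F i \<in> carrier_mat N N" using F by simp
        then show "(if i \<le> l then F i else 1\<^sub>m N) * (if i = Suc l then F (Suc l) else 1\<^sub>m N) =
          (if i \<le> Suc l then F i else 1\<^sub>m N)" by auto
      qed
      finally show ?thesis using j by (simp add: at_site_eq_tens)
    qed
    moreover have "tens L (\<lambda>j. if j \<le> l then F j else 1\<^sub>m N) \<in> carrier_mat (N ^ L) (N ^ L)"
      by (rule tens_carrier) (use F in auto)
    ultimately show ?case
      using Suc F[OF j] j at_site_carrier[of "Suc l" L "F (Suc l)" N] by (simp add: block_op_mult site_def)
  qed
  from this[of L] have "block_op (N ^ L) (tens L (\<lambda>j. if j \<le> L then F j else 1\<^sub>m N)) = oprod (\<lambda>i. site N L i (F i)) L"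
    by simp
  moreover have "tens L (\<lambda>j. if j \<le> L then F j else 1\<^sub>m N) = tens L F" by (rule tens_cong) auto
  ultimately show ?thesis by simp
qed

lemma oprod_cong: "(\<And>i. i \<in> {1..l} \<Longrightarrow> k i = k' i) \<Longrightarrow> oprod k l = oprod k' l"
  by (induct l) auto

lemma block_op_twisted_sum:
  assumes "X \<in> carrier_mat N N" "Y \<in> carrier_mat N N" "Z \<in> carrier_mat N N"
  shows "block_op (N ^ L) (twisted_sum N L c X Y Z) =
    xsum (\<lambda>i. site N L i Z) (\<lambda>i. site N L i X) (\<lambda>i. c i *\<^sub>c site N L i Y) L"
proof -
  \<comment> \<open>\<open>G i\<close> lists the factors of the i-th summand, and
    \<open>W l i\<close> is the part of it on the first l sites; with this truncation the sum obeys
    the recursion of \<open>xsum\<close>.\<close>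
  define G where "G i = (\<lambda>j. if j < i then X else if j = i then Y else Z)" for i :: nat
  define W where "W l i = oprod (\<lambda>j. site N L j (G i j)) l" for l i
  have G: "G i j \<in> carrier_mat N N" for i j using assms by (simp add: G_def)
  have T: "tensor_list (replicate (i - 1) X @ [Y] @ replicate (L - i) Z) = tens L (G i)" if "i \<in> {1..L}" for i
    unfolding tensor_list_eq_tens using that
    by (auto simp: G_def nth_append nth_Cons' intro!: tens_cong)
  have TC: "tens L (G i) \<in> carrier_mat (N ^ L) (N ^ L)" for i
    by (rule tens_carrier) (rule G)
  have "block_op (N ^ L) (twisted_sum N L c X Y Z) = (\<Sum>i\<in>{1..L}. c i *\<^sub>c block_op (N ^ L) (tens L (G i)))"
  proof (rule Ops_eqI[of _ "N ^ L"])
    show "block_op (N ^ L) (twisted_sum N L c X Y Z) \<in> Ops (N ^ L)"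
      by (rule block_op_in_Ops) (simp add: twisted_sum_def mat_sum_def)
    show "(\<Sum>i\<in>{1..L}. c i *\<^sub>c block_op (N ^ L) (tens L (G i))) \<in> Ops (N ^ L)"
      by (intro Ops_sum Ops_closed block_op_in_Ops TC)
    fix a b assume ab: "a < N ^ L" "b < N ^ L"
    then show "ent (block_op (N ^ L) (twisted_sum N L c X Y Z)) a b =
        ent (\<Sum>i\<in>{1..L}. c i *\<^sub>c block_op (N ^ L) (tens L (G i))) a b"
      using TC by (auto simp: ent_block_op ent_sum twisted_sum_def mat_sum_def T[simplified] carrier_matD[OF TC] intro!: sum.cong)
  qed
  also have "\<dots> = (\<Sum>i\<in>{1..L}. c i *\<^sub>c W L i)"
    unfolding W_def by (intro sum.cong refl arg_cong2[of _ _ _ _ csc] block_op_tens G)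
  also have "(\<Sum>i\<in>{1..l}. c i *\<^sub>c W l i) = xsum (\<lambda>i. site N L i Z) (\<lambda>i. site N L i X) (\<lambda>i. c i *\<^sub>c site N L i Y) l" for l
  proof (induct l)
    case (Suc l)
    have "(\<Sum>i\<in>{1..Suc l}. c i *\<^sub>c W (Suc l) i) = (\<Sum>i\<in>{1..l}. c i *\<^sub>c W (Suc l) i) + c (Suc l) *\<^sub>c W (Suc l) (Suc l)"
      by simp
    also have "(\<Sum>i\<in>{1..l}. c i *\<^sub>c W (Suc l) i) = (\<Sum>i\<in>{1..l}. c i *\<^sub>c W l i) * site N L (Suc l) Z"
      unfolding sum_distrib_right by (intro sum.cong refl) (auto simp: W_def G_def)
    also have "W (Suc l) (Suc l) = oprod (\<lambda>i. site N L i X) l * site N L (Suc l) Y"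
    proof -
      have "oprod (\<lambda>j. site N L j (G (Suc l) j)) l = oprod (\<lambda>i. site N L i X) l"
        by (rule oprod_cong) (auto simp: G_def)
      then show ?thesis by (simp add: W_def G_def)
    qed
    finally show ?case using Suc by simp
  qed simp
  finally show ?thesis .
qed

lemma site_lim:
  assumes "i \<in> {1..L}" "\<And>s. M s \<in> carrier_mat N N" "M' \<in> carrier_mat N N"
    and lim: "\<And>a b. a < N \<Longrightarrow> b < N \<Longrightarrow> ((\<lambda>s. M s $$ (a, b)) \<longlongrightarrow> M' $$ (a, b)) F"
  shows "op_lim (N ^ L) F (\<lambda>s. site N L i (M s)) (site N L i M')"
proof -
  have i: "1 \<le> i" "i \<le> L" using assms by auto
  have "\<forall>a<N ^ L. \<forall>b<N ^ L. ((\<lambda>s. at_site N L i (M s) $$ (a, b)) \<longlongrightarrow> at_site N L i M' $$ (a, b)) F"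
    using i
  proof (induct L i rule: at_site_induct)
    case (first L)
    show ?case
    proof (intro allI impI)
      fix a b assume "a < N ^ Suc L" "b < N ^ Suc L"
      then have ab: "a < N * N ^ L" "b < N * N ^ L" by simp_all
      show "((\<lambda>s. at_site N (Suc L) 1 (M s) $$ (a, b)) \<longlongrightarrow> at_site N (Suc L) 1 M' $$ (a, b)) F"
        unfolding at_site_1 kronecker_index[OF assms(2) one_carrier_mat ab] kronecker_index[OF assms(3) one_carrier_mat ab]
        using div_mod_less[OF ab(1)] div_mod_less[OF ab(2)] by (intro tendsto_mult lim tendsto_const) auto
    qed
  next
    case (later L i)
    show ?case
    proof (intro allI impI)
      fix a b assume "a < N ^ Suc L" "b < N ^ Suc L"
      then have ab: "a < N * N ^ L" "b < N * N ^ L" by simp_all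
      note c = at_site_carrier[OF later(1,2)]
      show "((\<lambda>s. at_site N (Suc L) (Suc i) (M s) $$ (a, b)) \<longlongrightarrow> at_site N (Suc L) (Suc i) M' $$ (a, b)) F"
        unfolding at_site_Suc[OF later(1,2)] kronecker_index[OF one_carrier_mat c[OF assms(2)] ab] kronecker_index[OF one_carrier_mat c[OF assms(3)] ab]
        using div_mod_less[OF ab(1)] div_mod_less[OF ab(2)] later(3) by (intro tendsto_mult tendsto_const) auto
    qed
  qed
  then show ?thesis
    unfolding site_def using assms i by (intro op_lim_block_op at_site_carrier) auto
qed

end

section \<open>The intertwining relation for Lax operators\<close>

text \<open>The parameters \<open>s, \<delta>, \<sigma>, z\<close> cover the Lax operator of the model in four guises: as it stands
  (\<open>\<delta> = s, \<sigma> = 1\<close>), with \<open>k, k'\<close> exchanged, and both of these in the flipped basis of the auxiliary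
  space. They account for \<open>B\<^sub>+, B\<^sub>-, C\<^sub>-, C\<^sub>+\<close> respectively.\<close>

locale lax_chain = sites S n for S :: "nat \<Rightarrow> 'a::complex_alg set" and n +
  fixes s \<delta> \<sigma> z c :: complex and k k' f e :: "nat \<Rightarrow> 'a"
  assumes nz: "s \<noteq> 0" "\<delta> \<noteq> 0" "z \<noteq> 0" "s\<^sup>2 - inverse (s\<^sup>2) \<noteq> 0" and \<sigma>: "\<sigma> * \<sigma> = 1"
    and S: "\<And>i. i \<in> {1..n} \<Longrightarrow> k i \<in> S i" "\<And>i. i \<in> {1..n} \<Longrightarrow> k' i \<in> S i"
      "\<And>i. i \<in> {1..n} \<Longrightarrow> f i \<in> S i" "\<And>i. i \<in> {1..n} \<Longrightarrow> e i \<in> S i"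
    and S_csc: "\<And>i x t. i \<in> {1..n} \<Longrightarrow> x \<in> S i \<Longrightarrow> t *\<^sub>c x \<in> S i"
    and kk': "\<And>i. i \<in> {1..n} \<Longrightarrow> k i * k' i = 1" "\<And>i. i \<in> {1..n} \<Longrightarrow> k' i * k i = 1"
    and kf: "\<And>i. i \<in> {1..n} \<Longrightarrow> k i * f i = inverse (s\<^sup>2) *\<^sub>c (f i * k i)"
      "\<And>i. i \<in> {1..n} \<Longrightarrow> k' i * f i = s\<^sup>2 *\<^sub>c (f i * k' i)"
    and ke: "\<And>i. i \<in> {1..n} \<Longrightarrow> k i * e i = s\<^sup>2 *\<^sub>c (e i * k i)"
      "\<And>i. i \<in> {1..n} \<Longrightarrow> k' i * e i = inverse (s\<^sup>2) *\<^sub>c (e i * k' i)"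
    and ef: "\<And>i. i \<in> {1..n} \<Longrightarrow>
      (s\<^sup>2 - inverse (s\<^sup>2)) *\<^sub>c (e i * f i - f i * e i) = k i * k i - k' i * k' i"
begin

definition d where "d = s\<^sup>2 - inverse (s\<^sup>2)"

definition lx_a where "lx_a i = inverse \<delta> *\<^sub>c (z *\<^sub>c k i - inverse z *\<^sub>c k' i)"
definition lx_b where "lx_b i = (\<sigma> * d) *\<^sub>c f i"
definition lx_c where "lx_c i = (\<sigma> * d) *\<^sub>c e i"
definition lx_d where "lx_d i = \<delta> *\<^sub>c (z *\<^sub>c k' i - inverse z *\<^sub>c k i)"
definition lx where "lx i = M2 (lx_a i) (lx_b i) (lx_c i) (lx_d i)"

definition X where "X i = (c * (\<delta>\<^sup>2) ^ i) *\<^sub>c f i"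
text \<open>The (1, 1) relation forces this value. The weights \<open>(\<delta>\<^sup>2) ^ i\<close>
  in \<open>X\<close> yield \<open>y (i - 1) * \<delta> = y i * inverse \<delta>\<close>, on which
  the other relations rest.\<close>

definition y where "y i = c * (\<delta>\<^sup>2) ^ i * (\<sigma> * \<delta> * z * inverse s)"

lemma X_S: "i \<in> {1..n} \<Longrightarrow> X i \<in> S i"
  by (simp add: X_def S S_csc)

lemma kX: "i \<in> {1..n} \<Longrightarrow> k i * X i = inverse (s\<^sup>2) *\<^sub>c (X i * k i)"
  "i \<in> {1..n} \<Longrightarrow> k' i * X i = s\<^sup>2 *\<^sub>c (X i * k' i)"
  by (simp_all add: X_def kf mult.commute)

text \<open>The coefficient of f k' vanishes by the commutation rule alone; the one of f k vanishes
  by the value of \<open>y (i - 1)\<close>.\<close>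

lemma relation_00:
  assumes "i \<in> {1..n}"
  shows "inverse s *\<^sub>c (lx_a i * X i) + y (i - 1) *\<^sub>c (lx_b i * k i) = s *\<^sub>c (X i * lx_a i)"
proof -
  obtain j where j: "i = Suc j" using assms by (cases i) auto
  define t where "t = c * (\<delta>\<^sup>2) ^ i"
  have yt: "y (i - 1) = t * \<sigma> * inverse \<delta> * z * inverse s"
    using nz by (simp add: y_def t_def j power2_eq_square)
  have "inverse s *\<^sub>c (lx_a i * X i) + y (i - 1) *\<^sub>c (lx_b i * k i) - s *\<^sub>c (X i * lx_a i) =
    (inverse s * inverse \<delta> * z * t * inverse (s\<^sup>2) + y (i - 1) * \<sigma> * d - s * t * inverse \<delta> * z) *\<^sub>c (f i * k i) +
    (s * t * inverse \<delta> * inverse z - inverse s * inverse \<delta> * inverse z * t * s\<^sup>2) *\<^sub>c (f i * k' i)"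
    using assms
    by (simp add: lx_a_def lx_b_def X_def t_def[symmetric] kf algebra_simps csc_diff_left csc_diff_right csc_add_left csc_add_right)
  also have "inverse s * inverse \<delta> * z * t * inverse (s\<^sup>2) + y (i - 1) * \<sigma> * d - s * t * inverse \<delta> * z = 0"
  proof -
    have d: "inverse s * d = s - inverse s * inverse (s\<^sup>2)"
      using nz by (simp add: d_def right_diff_distrib power2_eq_square)
    have "y (i - 1) * \<sigma> * d = t * inverse \<delta> * z * (inverse s * d) * (\<sigma> * \<sigma>)"
      unfolding yt by (simp add: mult_ac)
    also have "\<dots> = t * inverse \<delta> * z * (s - inverse s * inverse (s\<^sup>2))"
      unfolding \<sigma> d by simp
    finally show ?thesis by (simp add: algebra_simps)
  qed
  also have "s * t * inverse \<delta> * inverse z - inverse s * inverse \<delta> * inverse z * t * s\<^sup>2 = 0"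
    using nz by (simp add: field_simps power2_eq_square)
  finally show ?thesis by simp
qed

lemma relation_11:
  assumes "i \<in> {1..n}"
  shows "s *\<^sub>c (lx_d i * X i) = inverse s *\<^sub>c (X i * lx_d i) + y i *\<^sub>c (k' i * lx_b i)"
proof -
  define t where "t = c * (\<delta>\<^sup>2) ^ i"
  have yt: "y i = t * \<sigma> * \<delta> * z * inverse s"
    by (simp add: y_def t_def)
  have "s *\<^sub>c (lx_d i * X i) - (inverse s *\<^sub>c (X i * lx_d i) + y i *\<^sub>c (k' i * lx_b i)) =
    (s * \<delta> * z * t * s\<^sup>2 - inverse s * \<delta> * z * t - y i * \<sigma> * d * s\<^sup>2) *\<^sub>c (f i * k' i) +
    (inverse s * \<delta> * inverse z * t - s * \<delta> * inverse z * t * inverse (s\<^sup>2)) *\<^sub>c (f i * k i)"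
    using assms
    by (simp add: lx_d_def lx_b_def X_def t_def[symmetric] kf algebra_simps csc_diff_left csc_diff_right csc_add_left csc_add_right)
  also have "s * \<delta> * z * t * s\<^sup>2 - inverse s * \<delta> * z * t - y i * \<sigma> * d * s\<^sup>2 = 0"
  proof -
    have d: "inverse s * d * s\<^sup>2 = s * s\<^sup>2 - inverse s"
    proof -
      have "d * s\<^sup>2 = s\<^sup>2 * s\<^sup>2 - 1" using nz by (simp add: d_def left_diff_distrib)
      moreover have "inverse s * (s\<^sup>2 * s\<^sup>2) = s * s\<^sup>2" using nz by (simp add: power2_eq_square)
      ultimately show ?thesis by (simp add: mult.assoc right_diff_distrib)
    qed
    have "y i * \<sigma> * d * s\<^sup>2 = t * \<delta> * z * (inverse s * d * s\<^sup>2) * (\<sigma> * \<sigma>)"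
      unfolding yt by (simp add: mult_ac)
    also have "\<dots> = t * \<delta> * z * (s * s\<^sup>2 - inverse s)"
      unfolding \<sigma> d by simp
    finally show ?thesis by (simp add: algebra_simps)
  qed
  also have "inverse s * \<delta> * inverse z * t - s * \<delta> * inverse z * t * inverse (s\<^sup>2) = 0"
    using nz by (simp add: field_simps power2_eq_square)
  finally show ?thesis by simp
qed

text \<open>The scalar terms of the two summands with y agree, and their parts k k and k' k' are
  what the commutator of e and f produces.\<close>

lemma relation_10:
  assumes "i \<in> {1..n}"
  shows "inverse s *\<^sub>c (lx_c i * X i) + y (i - 1) *\<^sub>c (lx_d i * k i) =
    inverse s *\<^sub>c (X i * lx_c i) + y i *\<^sub>c (k' i * lx_a i)"
proof -
  obtain j where j: "i = Suc j" using assms by (cases i) auto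
  define t where "t = c * (\<delta>\<^sup>2) ^ i"
  have y1: "y (i - 1) * \<delta> = t * \<sigma> * z * inverse s"
    using nz by (simp add: y_def t_def j power2_eq_square)
  have y2: "y i * inverse \<delta> = t * \<sigma> * z * inverse s"
    using nz by (simp add: y_def t_def)
  define u where "u = t * \<sigma> * inverse s"
  have uz: "t * \<sigma> * z * inverse s * inverse z = u" using nz by (simp add: u_def)
  have "y (i - 1) *\<^sub>c (lx_d i * k i) = (y (i - 1) * \<delta>) *\<^sub>c (z *\<^sub>c 1 - inverse z *\<^sub>c (k i * k i))"
    using assms by (simp add: lx_d_def left_diff_distrib kk')
  also have "\<dots> = (t * \<sigma> * z * inverse s * z) *\<^sub>c 1 - u *\<^sub>c (k i * k i)"
    unfolding y1 by (simp add: csc_diff_right uz)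
  finally have d: "y (i - 1) *\<^sub>c (lx_d i * k i) = (t * \<sigma> * z * inverse s * z) *\<^sub>c 1 - u *\<^sub>c (k i * k i)" .
  have "y i *\<^sub>c (k' i * lx_a i) = (y i * inverse \<delta>) *\<^sub>c (z *\<^sub>c 1 - inverse z *\<^sub>c (k' i * k' i))"
    using assms by (simp add: lx_a_def right_diff_distrib kk')
  also have "\<dots> = (t * \<sigma> * z * inverse s * z) *\<^sub>c 1 - u *\<^sub>c (k' i * k' i)"
    unfolding y2 by (simp add: csc_diff_right uz)
  finally have a: "y i *\<^sub>c (k' i * lx_a i) = (t * \<sigma> * z * inverse s * z) *\<^sub>c 1 - u *\<^sub>c (k' i * k' i)" .
  have "inverse s *\<^sub>c (lx_c i * X i) - inverse s *\<^sub>c (X i * lx_c i) = u *\<^sub>c d *\<^sub>c (e i * f i - f i * e i)"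
    by (simp add: lx_c_def X_def t_def[symmetric] u_def csc_diff_right mult_ac)
  also have "\<dots> = u *\<^sub>c (k i * k i) - u *\<^sub>c (k' i * k' i)"
    using ef[OF assms] by (simp add: d_def[symmetric] csc_diff_right del: csc_csc)
  finally have "inverse s *\<^sub>c (lx_c i * X i) = inverse s *\<^sub>c (X i * lx_c i) + (u *\<^sub>c (k i * k i) - u *\<^sub>c (k' i * k' i))"
    by (simp add: algebra_simps)
  then show ?thesis unfolding a d by simp
qed

text \<open>The auxiliary space carries a two-dimensional representation in which k acts as
  \<open>G s\<close> and the lowering operator is proportional to \<open>\<phi> i\<close>. So
  \<open>G s * emb (X i) + \<phi> i * emb (k' i)\<close> is a coproduct of the generator, and the
  expression with \<open>G (inverse s)\<close> and k is the opposite one.\<close>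

definition G :: "complex \<Rightarrow> 'a m2" where
  "G u = M2 (u *\<^sub>c 1) 0 0 (inverse u *\<^sub>c 1)"

definition \<phi> :: "nat \<Rightarrow> 'a m2" where
  "\<phi> i = M2 0 0 (y i *\<^sub>c 1) 0"

lemma site_relation:
  assumes "i \<in> {1..n}"
  shows "lx i * (G (inverse s) * emb (X i) + \<phi> (i - 1) * emb (k i)) = (G s * emb (X i) + \<phi> i * emb (k' i)) * lx i"
  using relation_00[OF assms] relation_11[OF assms] relation_10[OF assms] nz
  by (simp add: lx_def G_def \<phi>_def emb_def distrib_left distrib_right) (simp add: lx_b_def X_def mult_ac)

text \<open>The Lax operator conserves the weight of site plus auxiliary space. Besides s and its
  inverse, u = 2 will be used to read off weights.\<close>

lemma weight_site:
  assumes "i \<in> {1..n}" "u \<noteq> 0"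
    and K: "K * k i = k i * K" "K * k' i = k' i * K" "K * f i = inverse (u\<^sup>2) *\<^sub>c (f i * K)" "K * e i = u\<^sup>2 *\<^sub>c (e i * K)"
  shows "lx i * (G u * emb K) = G u * emb K * lx i"
proof -
  have "lx_a i * K = K * lx_a i" "lx_d i * K = K * lx_d i"
    by (simp_all add: lx_a_def lx_d_def algebra_simps K)
  moreover have "u *\<^sub>c (K * lx_b i) = inverse u *\<^sub>c (lx_b i * K)"
  proof -
    have "u *\<^sub>c (K * lx_b i) = (u * inverse (u\<^sup>2)) *\<^sub>c (lx_b i * K)"
      by (simp add: lx_b_def K mult_ac)
    also have "u * inverse (u\<^sup>2) = inverse u" using \<open>u \<noteq> 0\<close> by (simp add: power2_eq_square)
    finally show ?thesis .
  qed
  moreover have "inverse u *\<^sub>c (K * lx_c i) = u *\<^sub>c (lx_c i * K)"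
  proof -
    have "inverse u *\<^sub>c (K * lx_c i) = (inverse u * u\<^sup>2) *\<^sub>c (lx_c i * K)"
      by (simp add: lx_c_def K mult_ac)
    also have "inverse u * u\<^sup>2 = u" using \<open>u \<noteq> 0\<close> by (simp add: power2_eq_square)
    finally show ?thesis .
  qed
  ultimately show ?thesis by (simp add: lx_def G_def emb_def)
qed

lemma lx_commute:
  assumes "i \<in> {1..n}" "j \<in> {1..n}" "i \<noteq> j" "x \<in> S j"
  shows "lx i * emb x = emb x * lx i"
proof -
  have "lx_a i * x = x * lx_a i" "lx_d i * x = x * lx_d i"
    using site_commute[OF assms(1-3) S(1)[OF assms(1)] assms(4)] site_commute[OF assms(1-3) S(2)[OF assms(1)] assms(4)]
    by (simp_all add: lx_a_def lx_d_def algebra_simps)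
  moreover have "lx_b i * x = x * lx_b i" "lx_c i * x = x * lx_c i"
    using site_commute[OF assms(1-3) S(3)[OF assms(1)] assms(4)] site_commute[OF assms(1-3) S(4)[OF assms(1)] assms(4)]
    by (simp_all add: lx_b_def lx_c_def)
  ultimately show ?thesis by (simp add: lx_def emb_def)
qed

lemma G_emb: "G u * emb x = emb x * G u"
  by (simp add: G_def emb_def)

lemma \<phi>_emb: "\<phi> i * emb x = emb x * \<phi> i"
  by (simp add: \<phi>_def emb_def)

abbreviation "monod \<equiv> rprod lx n"

lemma weight_chain:
  assumes "u \<noteq> 0" and KS: "\<And>i. i \<in> {1..n} \<Longrightarrow> K i \<in> S i"
    and K: "\<And>i. i \<in> {1..n} \<Longrightarrow> K i * k i = k i * K i" "\<And>i. i \<in> {1..n} \<Longrightarrow> K i * k' i = k' i * K i"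
      "\<And>i. i \<in> {1..n} \<Longrightarrow> K i * f i = inverse (u\<^sup>2) *\<^sub>c (f i * K i)"
      "\<And>i. i \<in> {1..n} \<Longrightarrow> K i * e i = u\<^sup>2 *\<^sub>c (e i * K i)"
  shows "monod * (G u * emb (oprod K n)) = G u * emb (oprod K n) * monod"
  unfolding emb_oprod[symmetric]
proof (rule chain_weight)
  fix i assume "i \<in> {1..n}"
  then show "lx i * (G u * emb (K i)) = G u * emb (K i) * lx i"
    by (intro weight_site assms)
next
  fix i j assume ij: "i \<in> {1..n}" "j \<in> {1..n}" "i \<noteq> j"
  show "lx i * emb (K j) = emb (K j) * lx i" by (rule lx_commute[OF ij KS[OF ij(2)]])
qed (rule G_emb)

lemma weight_chain_entries:
  assumes "u \<noteq> 0" and "monod * (G u * emb K) = G u * emb K * monod"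
  shows "e00 monod * K = K * e00 monod" "e11 monod * K = K * e11 monod" "K * e01 monod = inverse (u\<^sup>2) *\<^sub>c (e01 monod * K)"
proof -
  obtain a b c' d' where m: "monod = M2 a b c' d'" by (cases monod)
  have eqs: "u *\<^sub>c (a * K) = u *\<^sub>c (K * a)" "inverse u *\<^sub>c (b * K) = u *\<^sub>c (K * b)" "inverse u *\<^sub>c (d' * K) = inverse u *\<^sub>c (K * d')"
    using assms(2) unfolding m by (simp_all add: G_def emb_def)
  show "e00 monod * K = K * e00 monod" "e11 monod * K = K * e11 monod"
    using eqs(1,3) \<open>u \<noteq> 0\<close> by (simp_all add: m csc_cancel)
  have "K * b = inverse u *\<^sub>c u *\<^sub>c (K * b)" using \<open>u \<noteq> 0\<close> by simp
  also have "\<dots> = inverse (u\<^sup>2) *\<^sub>c (b * K)" unfolding eqs(2)[symmetric] by (simp add: power2_eq_square)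
  finally show "K * e01 monod = inverse (u\<^sup>2) *\<^sub>c (e01 monod * K)" by (simp add: m)
qed

definition "KK = oprod k n"
definition "KK' = oprod k' n"
definition "XX = xsum k k' X n"

lemma commute_kk': "i \<in> {1..n} \<Longrightarrow> k i * k' i = k' i * k i"
  by (simp add: kk')

lemma kk_all:
  assumes "i \<in> {1..n}" "j \<in> {1..n}"
  shows "k i * k' j = k' j * k i" "k i * k j = k j * k i" "k' i * k' j = k' j * k' i"
proof -
  note c = site_commute[OF assms]
  show "k i * k' j = k' j * k i"
    using kk'[OF assms(1)] c S(1)[OF assms(1)] S(2)[OF assms(2)] by (cases "i = j") auto
  show "k i * k j = k j * k i"
    using c S(1)[OF assms(1)] S(1)[OF assms(2)] by (cases "i = j") auto
  show "k' i * k' j = k' j * k' i"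
    using c S(2)[OF assms(1)] S(2)[OF assms(2)] by (cases "i = j") auto
qed

lemma intertwining:
  "monod * (\<phi> 0 * emb KK + G (inverse s) * emb XX) = (G s * emb XX + \<phi> n * emb KK') * monod"
  unfolding KK_def KK'_def XX_def emb_oprod[symmetric] emb_xsum[symmetric]
proof (rule chain_intertwine)
  fix i assume i: "i \<in> {1..n}"
  show "lx i * (G (inverse s) * emb (X i) + \<phi> (i - 1) * emb (k i)) = (G s * emb (X i) + \<phi> i * emb (k' i)) * lx i"
    by (rule site_relation[OF i])
  show "lx i * (G s * emb (k i)) = G s * emb (k i) * lx i"
    using i nz commute_kk' by (intro weight_site) (simp_all add: kf ke)
  show "lx i * (G (inverse s) * emb (k' i)) = G (inverse s) * emb (k' i) * lx i"
    using i nz commute_kk' by (intro weight_site) (simp_all add: kf ke power_inverse)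
  fix j assume "j \<in> {1..n}" "i \<noteq> j"
  with i show "lx i * emb (k j) = emb (k j) * lx i" "lx i * emb (k' j) = emb (k' j) * lx i"
    "lx i * emb (X j) = emb (X j) * lx i"
    by (intro lx_commute[of i j] S X_S; simp)+
next
  fix i j assume ij: "i \<in> {1..n}" "j \<in> {1..n}"
  show "emb (k i) * emb (k' j) = emb (k' j) * emb (k i)" "emb (k i) * emb (k j) = emb (k j) * emb (k i)"
    "emb (k' i) * emb (k' j) = emb (k' j) * emb (k' i)"
    using kk_all[OF ij] by (simp_all add: emb_def)
  assume "i \<noteq> j"
  then show "emb (k i) * emb (X j) = emb (X j) * emb (k i)"
    using site_commute[OF ij _ S(1)[OF ij(1)] X_S[OF ij(2)]] by (simp add: emb_def)
qed (rule G_emb \<phi>_emb)+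

lemma weight_KK:
  "e00 monod * KK = KK * e00 monod" "e11 monod * KK = KK * e11 monod"
  "e00 monod * KK' = KK' * e00 monod" "e11 monod * KK' = KK' * e11 monod"
  "KK' * e01 monod = s\<^sup>2 *\<^sub>c (e01 monod * KK')"
proof -
  have 1: "monod * (G s * emb KK) = G s * emb KK * monod"
    unfolding KK_def using nz kk_all by (intro weight_chain S) (simp_all add: kf ke)
  have 2: "monod * (G (inverse s) * emb KK') = G (inverse s) * emb KK' * monod"
    unfolding KK'_def using nz kk_all by (intro weight_chain S) (simp_all add: kf ke power_inverse kk')
  note w1 = weight_chain_entries[OF nz(1) 1]
  have s': "inverse s \<noteq> 0" using nz by simp
  note w2 = weight_chain_entries[OF s' 2]
  show "e00 monod * KK = KK * e00 monod" "e11 monod * KK = KK * e11 monod"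
    "e00 monod * KK' = KK' * e00 monod" "e11 monod * KK' = KK' * e11 monod"
    by (rule w1 w2)+
  show "KK' * e01 monod = s\<^sup>2 *\<^sub>c (e01 monod * KK')" using w2(3) by (simp add: power_inverse)
qed

lemma KK_XX: "KK * XX = inverse (s\<^sup>2) *\<^sub>c (XX * KK)" "KK' * XX = s\<^sup>2 *\<^sub>c (XX * KK')"
  unfolding KK_def KK'_def XX_def
  by (rule oprod_xsum; use S X_S kk_all kX in auto)+

text \<open>The entries (0, 0), (0, 1), (1, 1) of \<open>intertwining\<close> are the hypotheses of
  \<open>transfer_dpow\<close>; \<open>y n\<close> and \<open>y 0\<close> come from the two ends of
  the chain.\<close>

theorem transfer_commutator:
  assumes "qi s (int (Suc m)) \<noteq> 0"
  shows "(e00 monod + e11 monod) * dpow s (Suc m) XX - dpow s (Suc m) XX * (e00 monod + e11 monod) =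
    (s ^ (2 * Suc m) - 1) *\<^sub>c (dpow s (Suc m) XX * e00 monod) +
    (inverse s ^ (2 * Suc m) - 1) *\<^sub>c (dpow s (Suc m) XX * e11 monod)
    + s *\<^sub>c (dpow s m XX * e01 monod * (y n *\<^sub>c KK' - y 0 *\<^sub>c KK))"
proof -
  obtain a b c' d' where m: "monod = M2 a b c' d'" by (cases monod)
  have eqs: "y 0 *\<^sub>c (b * KK) + inverse s *\<^sub>c (a * XX) = s *\<^sub>c (XX * a)"
    "s *\<^sub>c (b * XX) = s *\<^sub>c (XX * b)"
    "s *\<^sub>c (d' * XX) = y n *\<^sub>c (KK' * b) + inverse s *\<^sub>c (XX * d')"
    using intertwining unfolding m by (simp_all add: G_def \<phi>_def emb_def distrib_left distrib_right add.commute)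
  have K'b: "KK' * b = s\<^sup>2 *\<^sub>c (b * KK')" using weight_KK(5) by (simp add: m)
  have "inverse s *\<^sub>c (a * XX) = s *\<^sub>c (XX * a) - y 0 *\<^sub>c (b * KK)"
    using eqs(1) by (simp add: algebra_simps)
  then have "s *\<^sub>c inverse s *\<^sub>c (a * XX) = s *\<^sub>c (s *\<^sub>c (XX * a) - y 0 *\<^sub>c (b * KK))" by simp
  then have aX: "a * XX = s\<^sup>2 *\<^sub>c (XX * a) - (s * y 0) *\<^sub>c (b * KK)"
    using nz by (simp add: csc_diff_right power2_eq_square)
  have "d' * XX = inverse s *\<^sub>c s *\<^sub>c (d' * XX)" using nz by simp
  also have "\<dots> = inverse s *\<^sub>c (y n *\<^sub>c (KK' * b) + inverse s *\<^sub>c (XX * d'))"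
    unfolding eqs(3) ..
  also have "\<dots> = (inverse s * inverse s) *\<^sub>c (XX * d') + (inverse s * s\<^sup>2 * y n) *\<^sub>c (b * KK')"
    by (simp add: K'b csc_add_right mult_ac add.commute)
  also have "inverse s * s\<^sup>2 = s" using nz by (simp add: power2_eq_square)
  also have "inverse s * inverse s = inverse (s\<^sup>2)" by (simp add: power2_eq_square)
  finally have dX: "d' * XX = inverse (s\<^sup>2) *\<^sub>c (XX * d') + (s * y n) *\<^sub>c (b * KK')" .
  have bX: "b * XX = XX * b" using eqs(2) nz by (simp add: csc_cancel)
  show ?thesis
    using transfer_dpow[OF nz(1,4) assms aX dX bX KK_XX] by (simp add: m)
qed

end

section \<open>Existence of the divided power limits\<close>

lemma power_mult_commuting:
  fixes x y :: "'a::monoid_mult"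
  assumes "x * y = y * x"
  shows "(x * y) ^ m = x ^ m * y ^ m"
proof (induct m)
  case (Suc m)
  have "y * x ^ m = x ^ m * y" using power_commuting_commutes[of x y m] assms by simp
  then show ?case using Suc by (simp add: mult.assoc) (metis mult.assoc)
qed simp

lemma op_lim_oprod:
  assumes "D > 0" "\<And>i. i \<in> {1..l} \<Longrightarrow> op_lim D F (\<lambda>s. k s i) (k0 i)"
  shows "op_lim D F (\<lambda>s. oprod (k s) l) (oprod k0 l)"
  using assms(2)
proof (induct l)
  case (Suc l)
  then show ?case by (simp add: op_lim_mult)
qed (simp add: op_lim_const Ops_closed assms)

lemma op_lim_xsum:
  assumes "D > 0" "\<And>i. i \<in> {1..l} \<Longrightarrow> op_lim D F (\<lambda>s. k s i) (k0 i)"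
    "\<And>i. i \<in> {1..l} \<Longrightarrow> op_lim D F (\<lambda>s. k' s i) (k0' i)" "\<And>i. i \<in> {1..l} \<Longrightarrow> op_lim D F (\<lambda>s. X s i) (X0 i)"
  shows "op_lim D F (\<lambda>s. xsum (k s) (k' s) (X s) l) (xsum k0 k0' X0 l)"
  using assms(2-4)
proof (induct l)
  case (Suc l)
  have "op_lim D F (\<lambda>s. oprod (k' s) l) (oprod k0' l)"
    by (rule op_lim_oprod[OF assms(1)]) (use Suc.prems in auto)
  moreover have "op_lim D F (\<lambda>s. xsum (k s) (k' s) (X s) l) (xsum k0 k0' X0 l)"
    by (rule Suc.hyps) (use Suc.prems in auto)
  ultimately show ?case
    unfolding xsum.simps by (intro op_lim_add op_lim_mult) (auto intro: Suc.prems)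
qed (simp add: op_lim_const Ops_closed)

lemma op_lim_dpow:
  assumes "D > 0" "op_lim D F X x" "((\<lambda>s. q_fact (p s) a) \<longlongrightarrow> q_fact p0 a) F" "q_fact p0 a \<noteq> 0"
  shows "op_lim D F (\<lambda>s. dpow (p s) a (X s)) (dpow p0 a x)"
  unfolding dpow_def using assms by (intro op_lim_csc tendsto_divide tendsto_const op_lim_power)

text \<open>By the \<open>q\<close>-binomial formula, only the extreme terms of the \<open>N\<close>-th divided power of a sum of two
  \<open>q\<close>-commuting elements involve the vanishing factor \<open>[N]\<close>.\<close>

lemma dpow_xsum_lim:
  fixes \<kappa> \<kappa>' X :: "complex \<Rightarrow> nat \<Rightarrow> op"
  assumes "D > 0" "N > 0"
    and lim: "\<And>i. i \<in> {1..L} \<Longrightarrow> op_lim D F (\<lambda>s. \<kappa> s i) (\<kappa>0 i)"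
      "\<And>i. i \<in> {1..L} \<Longrightarrow> op_lim D F (\<lambda>s. \<kappa>' s i) (\<kappa>0' i)"
      "\<And>i. i \<in> {1..L} \<Longrightarrow> op_lim D F (\<lambda>s. X s i) (X0 i)"
    and p: "(p \<longlongrightarrow> p0) F"
    and qf: "\<And>a. a < N \<Longrightarrow> ((\<lambda>s. q_fact (p s) a) \<longlongrightarrow> q_fact p0 a) F" "\<And>a. a < N \<Longrightarrow> q_fact p0 a \<noteq> 0"
    and ev: "\<forall>\<^sub>F s in F. sites S L \<and> p s \<noteq> 0 \<and> (\<forall>m. 1 \<le> m \<longrightarrow> m \<le> N \<longrightarrow> qi (p s) (int m) \<noteq> 0) \<and>
      (\<forall>i\<in>{1..L}. \<kappa> s i \<in> S i \<and> \<kappa>' s i \<in> S i \<and> X s i \<in> S i \<and> \<kappa> s i * \<kappa>' s i = \<kappa>' s i * \<kappa> s i \<and>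
         \<kappa>' s i * X s i = (p s)\<^sup>2 *\<^sub>c (X s i * \<kappa>' s i) \<and> X s i * \<kappa> s i = (p s)\<^sup>2 *\<^sub>c (\<kappa> s i * X s i) \<and> X s i ^ N = 0)"
    and "l \<le> L"
  shows "\<exists>B. op_lim D F (\<lambda>s. dpow (p s) N (xsum (\<kappa> s) (\<kappa>' s) (X s) l)) B"
  using \<open>l \<le> L\<close>
proof (induct l)
  case 0
  have "dpow (p s) N (0::op) = 0" for s using \<open>N > 0\<close> by (simp add: dpow_def zero_power)
  then show ?case using op_lim_const[OF Ops_closed(1)] by auto
next
  case (Suc l)
  define U where "U s = xsum (\<kappa> s) (\<kappa>' s) (X s) l * \<kappa> s (Suc l)" for s
  define V where "V s = oprod (\<kappa>' s) l * X s (Suc l)" for s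
  have j: "Suc l \<in> {1..L}" using Suc by auto
  have "op_lim D F (\<lambda>s. xsum (\<kappa> s) (\<kappa>' s) (X s) l) (xsum \<kappa>0 \<kappa>0' X0 l)"
    by (rule op_lim_xsum[OF assms(1)]) (use lim Suc.prems in auto)
  from op_lim_mult[OF this lim(1)[OF j]] have U0: "\<exists>u. op_lim D F U u" unfolding U_def by blast
  have "op_lim D F (\<lambda>s. oprod (\<kappa>' s) l) (oprod \<kappa>0' l)"
    by (rule op_lim_oprod[OF assms(1)]) (use lim Suc.prems in auto)
  from op_lim_mult[OF this lim(3)[OF j]] have V0: "\<exists>v. op_lim D F V v" unfolding V_def by blast
  from U0 V0 obtain u v where u: "op_lim D F U u" and v: "op_lim D F V v" by auto
  obtain B where B: "op_lim D F (\<lambda>s. dpow (p s) N (xsum (\<kappa> s) (\<kappa>' s) (X s) l)) B" using Suc by auto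
  define R where "R a s = p s ^ (2 * a * (N - a)) *\<^sub>c (dpow (p s) a (U s) * dpow (p s) (N - a) (V s))" for a s
  have sum_eq: "\<forall>\<^sub>F s in F. dpow (p s) N (xsum (\<kappa> s) (\<kappa>' s) (X s) (Suc l)) = (\<Sum>a\<le>N. R a s)"
    using ev
  proof eventually_elim
    case (elim s)
    interpret sites S L using elim by simp
    have "V s * U s = ((p s)\<^sup>2)\<^sup>2 *\<^sub>c (U s * V s)"
      unfolding U_def V_def by (rule xsum_q_commute) (use elim Suc in auto)
    then show ?case unfolding R_def
      using dpow_q_binomial[of "p s" "V s" "U s" N] elim by (simp add: U_def V_def power_mult[symmetric])
  qed
  have "\<exists>r. op_lim D F (R a) r" if "a \<le> N" for a
  proof -
    \<comment> \<open>Only the extreme terms contain a divided power of order N. For a = 0 it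
      vanishes with the N-th power of X at the new site; for a = N it is the divided power of the
      shorter chain times a power of k, which converges by induction. In between all denominators
      have nonzero limits.\<close>
    consider "a = 0" | "a = N" | "0 < a" "a < N" using \<open>a \<le> N\<close> by linarith
    then show ?thesis
    proof cases
      case 1
      have "\<forall>\<^sub>F s in F. R a s = 0"
        using ev
      proof eventually_elim
        case (elim s)
        interpret sites S L using elim by simp
        have "X s (Suc l) * oprod (\<kappa>' s) l = oprod (\<kappa>' s) l * X s (Suc l)"
          by (rule later_commute) (use elim Suc in auto)
        then have "V s ^ N = 0"
          using power_mult_commuting[of "oprod (\<kappa>' s) l" "X s (Suc l)" N] elim j by (simp add: V_def)
        then show ?case using 1 by (simp add: R_def dpow_def)
      qed
      then show ?thesis using op_lim_cong[OF _ op_lim_const[OF Ops_closed(1)]] by blast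
    next
      case 2
      have R: "\<forall>\<^sub>F s in F. R a s = dpow (p s) N (xsum (\<kappa> s) (\<kappa>' s) (X s) l) * \<kappa> s (Suc l) ^ N"
        using ev
      proof eventually_elim
        case (elim s)
        interpret sites S L using elim by simp
        have "\<kappa> s (Suc l) * xsum (\<kappa> s) (\<kappa>' s) (X s) l = xsum (\<kappa> s) (\<kappa>' s) (X s) l * \<kappa> s (Suc l)"
          by (rule later_commute_xsum) (use elim Suc in auto)
        then have "U s ^ N = xsum (\<kappa> s) (\<kappa>' s) (X s) l ^ N * \<kappa> s (Suc l) ^ N"
          unfolding U_def by (intro power_mult_commuting) simp
        then show ?case using 2 by (simp add: R_def dpow_def)
      qed
      have "op_lim D F (\<lambda>s. dpow (p s) N (xsum (\<kappa> s) (\<kappa>' s) (X s) l) * \<kappa> s (Suc l) ^ N) (B * \<kappa>0 (Suc l) ^ N)"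
        by (intro op_lim_mult B op_lim_power assms(1) lim j)
      then show ?thesis by (intro exI op_lim_cong[OF R])
    next
      case 3
      have "op_lim D F (R a) (p0 ^ (2 * a * (N - a)) *\<^sub>c (dpow p0 a u * dpow p0 (N - a) v))"
        unfolding R_def using 3
        by (intro op_lim_csc tendsto_power p op_lim_mult op_lim_dpow assms(1) u v qf) auto
      then show ?thesis by blast
    qed
  qed
  then obtain r where "\<And>a. a \<le> N \<Longrightarrow> op_lim D F (R a) (r a)" by metis
  then have "op_lim D F (\<lambda>s. \<Sum>a\<le>N. R a s) (\<Sum>a\<le>N. r a)"
    by (intro op_lim_sum) auto
  then show ?case by (intro exI op_lim_cong[OF sum_eq])
qed

section \<open>The local representation\<close>

definition diagm :: "nat \<Rightarrow> (nat \<Rightarrow> complex) \<Rightarrow> complex mat" where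
  "diagm n g = mat n n (\<lambda>(a, b). if a = b then g b else 0)"

lemma diagm_carrier [simp]: "diagm n g \<in> carrier_mat n n"
  by (simp add: diagm_def)

lemma diagm_index: "a < n \<Longrightarrow> b < n \<Longrightarrow> diagm n g $$ (a, b) = (if a = b then g b else 0)"
  by (simp add: diagm_def)

lemma index_mult_carrier:
  "X \<in> carrier_mat m l \<Longrightarrow> Y \<in> carrier_mat l n \<Longrightarrow> a < m \<Longrightarrow> b < n \<Longrightarrow>
    (X * Y) $$ (a, b) = (\<Sum>c<l. X $$ (a, c) * Y $$ (c, b))"
  by (auto simp: scalar_prod_def atLeast0LessThan)

lemma diagm_mult_left:
  assumes "X \<in> carrier_mat n n"
  shows "diagm n g * X = mat n n (\<lambda>(a, b). g a * X $$ (a, b))"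
proof (rule eq_matI)
  fix a b assume "a < dim_row (mat n n (\<lambda>(a, b). g a * X $$ (a, b)))" "b < dim_col (mat n n (\<lambda>(a, b). g a * X $$ (a, b)))"
  then have ab: "a < n" "b < n" by auto
  have "(diagm n g * X) $$ (a, b) = (\<Sum>c<n. if c = a then g c * X $$ (c, b) else 0)"
    unfolding index_mult_carrier[OF diagm_carrier assms ab] by (intro sum.cong) (use ab in \<open>auto simp: diagm_index\<close>)
  then show "(diagm n g * X) $$ (a, b) = mat n n (\<lambda>(a, b). g a * X $$ (a, b)) $$ (a, b)" using ab by simp
qed (use assms in \<open>auto simp: diagm_def\<close>)

lemma diagm_mult_right:
  assumes "X \<in> carrier_mat n n"
  shows "X * diagm n g = mat n n (\<lambda>(a, b). X $$ (a, b) * g b)"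
proof (rule eq_matI)
  fix a b assume "a < dim_row (mat n n (\<lambda>(a, b). X $$ (a, b) * g b))" "b < dim_col (mat n n (\<lambda>(a, b). X $$ (a, b) * g b))"
  then have ab: "a < n" "b < n" by auto
  have "(X * diagm n g) $$ (a, b) = (\<Sum>c<n. if c = b then X $$ (a, c) * g c else 0)"
    unfolding index_mult_carrier[OF assms diagm_carrier ab] by (intro sum.cong) (use ab in \<open>auto simp: diagm_index\<close>)
  then show "(X * diagm n g) $$ (a, b) = mat n n (\<lambda>(a, b). X $$ (a, b) * g b) $$ (a, b)" using ab by simp
qed (use assms in \<open>auto simp: diagm_def\<close>)

lemma diagm_mult: "diagm n g * diagm n g' = diagm n (\<lambda>a. g a * g' a)"
  by (subst diagm_mult_left) (auto simp: diagm_def)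

lemma diagm_cong: "(\<And>a. a < n \<Longrightarrow> g a = g' a) \<Longrightarrow> diagm n g = diagm n g'"
  by (auto simp: diagm_def)

lemma diagm_one: "diagm n (\<lambda>_. 1) = 1\<^sub>m n"
  by (auto simp: diagm_def)

lemma k_half_diagm: "k_half N u = diagm N (\<lambda>b. u powi (int N - 1 - 2 * int b))"
  by (simp add: k_half_def diagm_def)

lemma k_half_inv_eq: "k_half_inv N u = k_half N (inverse u)"
  by (auto simp: k_half_def k_half_inv_def power_int_inverse power_int_minus simp del: minus_diff_eq intro!: eq_matI)

lemma local_carrier [simp]: "k_half N u \<in> carrier_mat N N" "f_op N s \<in> carrier_mat N N" "e_op N s \<in> carrier_mat N N"
  "h_op N \<in> carrier_mat N N"
  by (simp_all add: k_half_def f_op_def e_op_def h_op_def)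

lemma k_half_inverse: "u \<noteq> 0 \<Longrightarrow> k_half N u * k_half N (inverse u) = 1\<^sub>m N"
proof -
  assume "u \<noteq> 0"
  then have "u powi m * inverse u powi m = 1" for m by (simp add: power_int_inverse)
  then show ?thesis unfolding k_half_diagm diagm_mult diagm_one[symmetric] by (simp only:)
qed

lemma k_half_commute: "k_half N u * k_half N v = k_half N v * k_half N u"
  unfolding k_half_diagm diagm_mult by (simp add: mult.commute)

text \<open>The parameters of k and f are independent, since u will be s, its inverse or 2.\<close>

lemma k_half_f:
  assumes "u \<noteq> 0"
  shows "k_half N u * f_op N s = inverse (u\<^sup>2) \<cdot>\<^sub>m (f_op N s * k_half N u)"
proof -
  have "u powi (m - 2) = inverse (u\<^sup>2) * u powi m" for m
    using assms by (simp add: power_int_diff divide_inverse mult.commute)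
  from this[of "int N - 1 - 2 * int b" for b]
  have pw: "u powi (int N - 1 - 2 * int (Suc b)) = inverse (u\<^sup>2) * u powi (int N - 1 - 2 * int b)" for b
    by (simp add: algebra_simps)
  show ?thesis
    unfolding k_half_diagm diagm_mult_left[OF local_carrier(2)] diagm_mult_right[OF local_carrier(2)]
  proof (rule eq_matI)
    fix i j assume "i < dim_row (inverse (u\<^sup>2) \<cdot>\<^sub>m mat N N (\<lambda>(a, b). f_op N s $$ (a, b) * u powi (int N - 1 - 2 * int b)))"
      "j < dim_col (inverse (u\<^sup>2) \<cdot>\<^sub>m mat N N (\<lambda>(a, b). f_op N s $$ (a, b) * u powi (int N - 1 - 2 * int b)))"
    then show "mat N N (\<lambda>(a, b). u powi (int N - 1 - 2 * int a) * f_op N s $$ (a, b)) $$ (i, j) =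
        (inverse (u\<^sup>2) \<cdot>\<^sub>m mat N N (\<lambda>(a, b). f_op N s $$ (a, b) * u powi (int N - 1 - 2 * int b))) $$ (i, j)"
      using pw[of j] by (cases "i = Suc j") (simp_all add: f_op_def)
  qed simp_all
qed

lemma k_half_e:
  assumes "u \<noteq> 0"
  shows "k_half N u * e_op N s = u\<^sup>2 \<cdot>\<^sub>m (e_op N s * k_half N u)"
proof -
  have "u powi (m + 2) = u\<^sup>2 * u powi m" for m
    using assms by (simp add: power_int_add mult.commute)
  from this[of "int N - 1 - 2 * int (Suc a)" for a]
  have pw: "u powi (int N - 1 - 2 * int a) = u\<^sup>2 * u powi (int N - 1 - 2 * int (Suc a))" for a
    by (simp add: algebra_simps)
  show ?thesis
    unfolding k_half_diagm diagm_mult_left[OF local_carrier(3)] diagm_mult_right[OF local_carrier(3)]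
  proof (rule eq_matI)
    fix i j assume "i < dim_row (u\<^sup>2 \<cdot>\<^sub>m mat N N (\<lambda>(a, b). e_op N s $$ (a, b) * u powi (int N - 1 - 2 * int b)))"
      "j < dim_col (u\<^sup>2 \<cdot>\<^sub>m mat N N (\<lambda>(a, b). e_op N s $$ (a, b) * u powi (int N - 1 - 2 * int b)))"
    then show "mat N N (\<lambda>(a, b). u powi (int N - 1 - 2 * int a) * e_op N s $$ (a, b)) $$ (i, j) =
        (u\<^sup>2 \<cdot>\<^sub>m mat N N (\<lambda>(a, b). e_op N s $$ (a, b) * u powi (int N - 1 - 2 * int b))) $$ (i, j)"
      using pw[of i] by (cases "j = Suc i") (simp_all add: e_op_def)
  qed simp_all
qed

lemma e_f_diag: "e_op N s * f_op N s = diagm N (\<lambda>b. qi s (int N - 1 - int b) * qi s (int b + 1))"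
proof (rule eq_matI)
  fix a b assume "a < dim_row (diagm N (\<lambda>b. qi s (int N - 1 - int b) * qi s (int b + 1)))"
    "b < dim_col (diagm N (\<lambda>b. qi s (int N - 1 - int b) * qi s (int b + 1)))"
  then have ab: "a < N" "b < N" by (auto simp: diagm_def)
  have "(e_op N s * f_op N s) $$ (a, b) =
      (\<Sum>c<N. if c = Suc b then (if a = b then q_int s (N - Suc b) * q_int s (b + 1) else 0) else 0)"
    unfolding index_mult_carrier[OF local_carrier(3,2) ab]
    by (intro sum.cong) (use ab in \<open>auto simp: e_op_def f_op_def\<close>)
  also have "\<dots> = (if a = b then qi s (int N - 1 - int b) * qi s (int b + 1) else 0)"
  proof (cases "Suc b < N")
    case False
    then have "int N - 1 - int b = 0" using ab by simp
    with False show ?thesis by simp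
  next
    case True
    then have "int (N - Suc b) = int N - 1 - int b" by simp
    with True show ?thesis by (simp add: q_int_eq_qi add.commute diff_diff_eq)
  qed
  finally show "(e_op N s * f_op N s) $$ (a, b) = diagm N (\<lambda>b. qi s (int N - 1 - int b) * qi s (int b + 1)) $$ (a, b)"
    using ab by (simp add: diagm_index)
qed (simp_all add: e_op_def f_op_def diagm_def)

lemma f_e_diag: "f_op N s * e_op N s = diagm N (\<lambda>b. qi s (int b) * qi s (int N - int b))"
proof (rule eq_matI)
  fix a b assume "a < dim_row (diagm N (\<lambda>b. qi s (int b) * qi s (int N - int b)))"
    "b < dim_col (diagm N (\<lambda>b. qi s (int b) * qi s (int N - int b)))"
  then have ab: "a < N" "b < N" by (auto simp: diagm_def)
  have "(f_op N s * e_op N s) $$ (a, b) =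
      (\<Sum>c<N. if Suc c = b then (if a = b then q_int s b * q_int s (N - b) else 0) else 0)"
    unfolding index_mult_carrier[OF local_carrier(2,3) ab]
    by (intro sum.cong) (use ab in \<open>auto simp: e_op_def f_op_def\<close>)
  also have "\<dots> = (if a = b then qi s (int b) * qi s (int N - int b) else 0)"
  proof (cases b)
    case (Suc c)
    then have "c < N" using ab by simp
    then have "(\<Sum>c<N. if Suc c = b then (if a = b then q_int s b * q_int s (N - b) else 0) else 0) =
      (if a = b then q_int s b * q_int s (N - b) else 0)"
      using Suc by simp
    then show ?thesis using ab by (simp add: q_int_eq_qi of_nat_diff)
  qed simp
  finally show "(f_op N s * e_op N s) $$ (a, b) = diagm N (\<lambda>b. qi s (int b) * qi s (int N - int b)) $$ (a, b)"
    using ab by (simp add: diagm_index)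
qed (simp_all add: e_op_def f_op_def diagm_def)

lemma e_f_commutator:
  assumes "s \<noteq> 0" "s\<^sup>2 - inverse (s\<^sup>2) \<noteq> 0"
  shows "(s\<^sup>2 - inverse (s\<^sup>2)) \<cdot>\<^sub>m (e_op N s * f_op N s - f_op N s * e_op N s) =
    k_half N s * k_half N s - k_half N (inverse s) * k_half N (inverse s)"
proof (rule eq_matI)
  fix a b assume "a < dim_row (k_half N s * k_half N s - k_half N (inverse s) * k_half N (inverse s))"
    "b < dim_col (k_half N s * k_half N s - k_half N (inverse s) * k_half N (inverse s))"
  then have ab: "a < N" "b < N" by (auto simp: k_half_def)
  define w where "w = int N - 1 - 2 * int b"
  \<comment> \<open>An instance of \<open>qi_exchange\<close> with t = 1, where the second argument
    is -b.\<close>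
  have "qi s (int N - 1 - int b) * qi s (int b + 1) = qi s (int N - int b) * qi s (int b) + qi s w"
  proof -
    have "qi s (- int b - 1) = - qi s (int b + 1)"
      using qi_minus[of s "int b + 1"] by (simp add: algebra_simps minus_diff_commute)
    then show ?thesis
      using qi_exchange[OF assms(1), of "int N - int b" 1 "- int b"] qi_1[OF assms(2)] qi_minus[of s "int b"]
      by (simp add: w_def algebra_simps)
  qed
  then have "(s\<^sup>2 - inverse (s\<^sup>2)) * (qi s (int N - 1 - int b) * qi s (int b + 1) - qi s (int b) * qi s (int N - int b)) =
    (s\<^sup>2 - inverse (s\<^sup>2)) * qi s w" by (simp add: mult.commute)
  also have "\<dots> = s powi (2 * w) - s powi (- (2 * w))"
    using assms by (simp add: qi_def)
  also have "s powi (2 * w) = s powi w * s powi w"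
    using assms by (simp add: power_int_add[symmetric])
  also have "s powi (- (2 * w)) = inverse s powi w * inverse s powi w"
    using assms by (simp add: power_int_inverse power_int_minus power_int_add[symmetric] inverse_mult_distrib[symmetric] del: inverse_mult_distrib)
  finally have eq: "(s\<^sup>2 - inverse (s\<^sup>2)) * (qi s (int N - 1 - int b) * qi s (int b + 1) - qi s (int b) * qi s (int N - int b)) =
    s powi w * s powi w - inverse s powi w * inverse s powi w" .
  show "((s\<^sup>2 - inverse (s\<^sup>2)) \<cdot>\<^sub>m (e_op N s * f_op N s - f_op N s * e_op N s)) $$ (a, b) =
    (k_half N s * k_half N s - k_half N (inverse s) * k_half N (inverse s)) $$ (a, b)"
    unfolding k_half_diagm diagm_mult e_f_diag f_e_diag
    using ab eq by (simp add: diagm_index carrier_matD[OF diagm_carrier] w_def)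
qed (auto simp: k_half_def e_op_def f_op_def)

lemma f_power_index:
  "a < N \<Longrightarrow> b < N \<Longrightarrow> (f_op N s ^\<^sub>m m) $$ (a, b) \<noteq> 0 \<Longrightarrow> a = b + m"
proof (induct m arbitrary: b)
  case (Suc m)
  have c: "f_op N s ^\<^sub>m m \<in> carrier_mat N N" by (rule pow_carrier_mat) simp
  then have "(f_op N s ^\<^sub>m Suc m) $$ (a, b) = (\<Sum>c<N. (f_op N s ^\<^sub>m m) $$ (a, c) * f_op N s $$ (c, b))"
    using index_mult_carrier[OF c local_carrier(2) Suc(2,3)] by simp
  with Suc(4) obtain c where "c < N" "(f_op N s ^\<^sub>m m) $$ (a, c) \<noteq> 0" "f_op N s $$ (c, b) \<noteq> 0"
    by (metis (no_types, lifting) lessThan_iff mult_eq_0_iff sum.neutral)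
  then have "a = c + m" "c = b + 1" using Suc by (auto simp: f_op_def split: if_splits)
  then show ?case by simp
qed (auto simp: f_op_def split: if_splits)

lemma e_power_index:
  "a < N \<Longrightarrow> b < N \<Longrightarrow> (e_op N s ^\<^sub>m m) $$ (a, b) \<noteq> 0 \<Longrightarrow> b = a + m"
proof (induct m arbitrary: b)
  case (Suc m)
  have c: "e_op N s ^\<^sub>m m \<in> carrier_mat N N" by (rule pow_carrier_mat) simp
  then have "(e_op N s ^\<^sub>m Suc m) $$ (a, b) = (\<Sum>c<N. (e_op N s ^\<^sub>m m) $$ (a, c) * e_op N s $$ (c, b))"
    using index_mult_carrier[OF c local_carrier(3) Suc(2,3)] by simp
  with Suc(4) obtain c where "c < N" "(e_op N s ^\<^sub>m m) $$ (a, c) \<noteq> 0" "e_op N s $$ (c, b) \<noteq> 0"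
    by (metis (no_types, lifting) lessThan_iff mult_eq_0_iff sum.neutral)
  then have "c = a + m" "b = c + 1" using Suc by (auto simp: e_op_def split: if_splits)
  then show ?case by simp
qed (auto simp: e_op_def split: if_splits)

lemma f_nilpotent: "f_op N s ^\<^sub>m N = 0\<^sub>m N N"
proof (rule eq_matI)
  fix a b assume "a < dim_row (0\<^sub>m N N)" "b < dim_col (0\<^sub>m N N)"
  then show "(f_op N s ^\<^sub>m N) $$ (a, b) = 0\<^sub>m N N $$ (a, b)"
    using f_power_index[of a N b s N] by fastforce
qed (simp_all add: carrier_matD[OF pow_carrier_mat[OF local_carrier(2)]] f_op_def)

lemma e_nilpotent: "e_op N s ^\<^sub>m N = 0\<^sub>m N N"
proof (rule eq_matI)
  fix a b assume "a < dim_row (0\<^sub>m N N)" "b < dim_col (0\<^sub>m N N)"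
  then show "(e_op N s ^\<^sub>m N) $$ (a, b) = 0\<^sub>m N N $$ (a, b)"
    using e_power_index[of a N b s N] by fastforce
qed (simp_all add: carrier_matD[OF pow_carrier_mat[OF local_carrier(3)]] e_op_def)

section \<open>Weights\<close>

text \<open>The eigenvalue of the sum of all h on the basis vector a, whose local states are the
  base-N digits of a, the most significant first.\<close>

fun wt :: "nat \<Rightarrow> nat \<Rightarrow> nat \<Rightarrow> int" where
  "wt N 0 a = 0"
| "wt N (Suc L) a = int N - 1 - 2 * int (a div N ^ L) + wt N L (a mod N ^ L)"

lemma A_op_diagm: "u \<noteq> 0 \<Longrightarrow> A_op N L u = diagm (N ^ L) (\<lambda>a. u powi wt N L a)"
proof (induct L)
  case 0
  show ?case by (auto simp: A_op_def tensor_list_def diagm_def intro!: eq_matI)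
next
  case (Suc L)
  have "A_op N (Suc L) u = k_half N u \<otimes>\<^sub>K A_op N L u" by (simp add: A_op_def tensor_list_def)
  also have "\<dots> = diagm (N ^ Suc L) (\<lambda>a. u powi wt N (Suc L) a)"
  proof (rule eq_matI)
    fix a b assume "a < dim_row (diagm (N ^ Suc L) (\<lambda>a. u powi wt N (Suc L) a))"
      "b < dim_col (diagm (N ^ Suc L) (\<lambda>a. u powi wt N (Suc L) a))"
    then have ab: "a < N * N ^ L" "b < N * N ^ L" by (auto simp: diagm_def)
    have "a div N ^ L = b div N ^ L \<and> a mod N ^ L = b mod N ^ L \<longleftrightarrow> a = b" by (metis div_mult_mod_eq)
    then show "(k_half N u \<otimes>\<^sub>K A_op N L u) $$ (a, b) = diagm (N ^ Suc L) (\<lambda>a. u powi wt N (Suc L) a) $$ (a, b)"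
      unfolding Suc(1)[OF Suc(2)] k_half_diagm kronecker_index[OF diagm_carrier diagm_carrier ab]
      using ab div_mod_less[OF ab(1)] div_mod_less[OF ab(2)] Suc(2) by (auto simp: diagm_index power_int_add)
  qed (auto simp: k_half_def Suc diagm_def)
  finally show ?case .
qed

lemma h_sum:
  assumes "a < N ^ L" "b < N ^ L"
  shows "(\<Sum>i\<in>{1..L}. at_site N L i (h_op N) $$ (a, b)) = (if a = b then of_int (wt N L a) else 0)"
  using assms
proof (induct L arbitrary: a b)
  case (Suc L)
  have ab: "a < N * N ^ L" "b < N * N ^ L" using Suc by auto
  note dm = div_mod_less[OF ab(1)] div_mod_less[OF ab(2)]
  have iff: "a div N ^ L = b div N ^ L \<and> a mod N ^ L = b mod N ^ L \<longleftrightarrow> a = b" by (metis div_mult_mod_eq)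
  have "(\<Sum>i\<in>{1..Suc L}. at_site N (Suc L) i (h_op N) $$ (a, b)) =
    at_site N (Suc L) 1 (h_op N) $$ (a, b) + (\<Sum>i\<in>{1..L}. at_site N (Suc L) (Suc i) (h_op N) $$ (a, b))"
    by (subst sum.atLeast_Suc_atMost) (simp_all only: sum.shift_bounds_cl_Suc_ivl One_nat_def le_add1 plus_1_eq_Suc Suc_le_mono le0)
  also have "at_site N (Suc L) 1 (h_op N) $$ (a, b) = (if a = b then of_int (int N - 1 - 2 * int (a div N ^ L)) else 0)"
    unfolding at_site_1 kronecker_index[OF local_carrier(4) one_carrier_mat ab]
    using dm iff by (auto simp: h_op_def)
  also have "(\<Sum>i\<in>{1..L}. at_site N (Suc L) (Suc i) (h_op N) $$ (a, b)) =
     (\<Sum>i\<in>{1..L}. (if a div N ^ L = b div N ^ L then 1 else 0) * at_site N L i (h_op N) $$ (a mod N ^ L, b mod N ^ L))"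
  proof (intro sum.cong refl)
    fix i assume "i \<in> {1..L}"
    then have i: "1 \<le> i" "i \<le> L" by auto
    show "at_site N (Suc L) (Suc i) (h_op N) $$ (a, b) =
      (if a div N ^ L = b div N ^ L then 1 else 0) * at_site N L i (h_op N) $$ (a mod N ^ L, b mod N ^ L)"
      unfolding at_site_Suc[OF i] kronecker_index[OF one_carrier_mat at_site_carrier[OF i local_carrier(4)] ab]
      using dm by simp
  qed
  also have "\<dots> = (if a = b then of_int (wt N L (a mod N ^ L)) else 0)"
    unfolding sum_distrib_left[symmetric] using Suc(1)[of "a mod N ^ L" "b mod N ^ L"] dm iff by auto
  finally show ?case by simp
qed simp

lemma H_N_diagm: "H_N N L = diagm (N ^ L) (\<lambda>a. of_int (wt N L a) / of_nat N)"
  by (rule eq_matI) (auto simp: H_N_def mat_sum_def h_sum[unfolded One_nat_def] diagm_def)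

lemma block_op_diagm: "n > 0 \<Longrightarrow> block_op n (diagm n g) = diag (\<lambda>a. g (a mod n))"
proof (rule op_eqI, rule ext)
  fix v a assume n: "n > 0"
  have "app (block_op n (diagm n g)) v a = (\<Sum>b<n. if b = a mod n then g b * v (n * (a div n) + b) else 0)"
    unfolding app_block_op using n by (intro sum.cong) (auto simp: diagm_index)
  then show "app (block_op n (diagm n g)) v a = app (diag (\<lambda>a. g (a mod n))) v a" using n by simp
qed

lemma ent_diag_mult:
  assumes "X \<in> Ops n" "a < n" "b < n"
  shows "ent (block_op n (diagm n g) * X) a b = g a * ent X a b"
    and "ent (X * block_op n (diagm n g)) a b = ent X a b * g b"
proof -
  obtain M where M: "X = block_op n M" "M \<in> carrier_mat n n" using assms by (auto simp: Ops_def)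
  show "ent (block_op n (diagm n g) * X) a b = g a * ent X a b"
    unfolding M(1) block_op_mult[OF diagm_carrier M(2), symmetric] using assms
    by (simp add: ent_block_op diagm_mult_left[OF M(2)])
  show "ent (X * block_op n (diagm n g)) a b = ent X a b * g b"
    unfolding M(1) block_op_mult[OF M(2) diagm_carrier, symmetric] using assms
    by (simp add: ent_block_op diagm_mult_right[OF M(2)])
qed

text \<open>Conjugation by \<open>diag (2\<^bsup>wt\<^esup>)\<close> detects weights, since the powers of 2 are distinct.\<close>

lemma ent_weight:
  assumes "X \<in> Ops n" "a < n" "b < n" "ent X a b \<noteq> 0"
    and "block_op n (diagm n (\<lambda>a. 2 powi w a)) * X = (2 powi t) *\<^sub>c (X * block_op n (diagm n (\<lambda>a. 2 powi w a)))"
  shows "w a = w b + t"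
proof -
  have "2 powi w a * ent X a b = 2 powi t * (ent X a b * 2 powi w b)"
    using arg_cong[OF assms(5), of "\<lambda>x. ent x a b"] ent_diag_mult[OF assms(1-3)] by simp
  then have "(2::complex) powi w a = 2 powi (w b + t)"
    using assms(4) by (simp add: power_int_add)
  then have "norm ((2::complex) powi w a) = norm ((2::complex) powi (w b + t))" by simp
  then have "(2::real) powi w a = 2 powi (w b + t)" by (simp add: norm_power_int)
  then show ?thesis
    by (metis linorder_neqE_linordered_idom numeral_One numeral_less_iff order_less_irrefl power_int_strict_increasing semiring_norm(76))
qed

section \<open>The root of unity\<close>

text \<open>The square of \<open>s_root N\<close> is q, a primitive N-th root of unity; hence the
  exponent 2 m.\<close>

lemma s_root_power_eq_1:
  assumes "N > 0"
  shows "s_root N ^ (2 * m) = 1 \<longleftrightarrow> N dvd m"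
proof -
  have pow: "s_root N ^ (2 * m) = cis (2 * pi * real m / real N)"
    by (simp add: s_root_def DeMoivre mult_ac)
  show ?thesis
  proof
    assume "s_root N ^ (2 * m) = 1"
    then have "cos (2 * pi * real m / real N) = 1"
      unfolding pow by (metis Re_complex_of_real cis.simps(1) of_real_1 one_complex.simps(1))
    then obtain k :: int where "2 * pi * real m / real N = k * 2 * pi"
      by (auto simp: cos_one_2pi_int)
    then have "real m = of_int k * real N" using assms by (simp add: field_simps)
    then have "int m = k * int N" by (metis of_int_eq_iff of_int_mult of_int_of_nat_eq)
    then show "N dvd m" by (metis dvd_triv_right int_dvd_int_iff)
  next
    assume "N dvd m"
    then obtain k where "m = N * k" by auto
    then have "2 * pi * real m / real N = 2 * pi * real k" using assms by simp
    then show "s_root N ^ (2 * m) = 1" unfolding pow by (simp add: cis_multiple_2pi)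
  qed
qed

lemma s_root_nonzero [simp]: "s_root N \<noteq> 0"
  by (simp add: s_root_def)

lemma s_root_powi_eq_1:
  assumes "N > 0"
  shows "s_root N powi (2 * w) = 1 \<longleftrightarrow> int N dvd w"
proof (cases "w \<ge> 0")
  case True
  then obtain m where "w = int m" using nonneg_int_cases by blast
  then show ?thesis using s_root_power_eq_1[OF assms, of m] by (simp add: power_int_def nat_mult_distrib)
next
  case False
  then obtain m where m: "w = - int m" using nonpos_int_cases[of w] by auto
  then have "s_root N powi (2 * w) = inverse (s_root N ^ (2 * m))"
    by (simp add: power_int_minus power_int_def nat_mult_distrib power_inverse)
  then show ?thesis using s_root_power_eq_1[OF assms, of m] m by (simp add: inverse_eq_1_iff)
qed

lemma qi_eq_0_iff:
  assumes "s \<noteq> 0" "s\<^sup>2 - inverse (s\<^sup>2) \<noteq> 0"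
  shows "qi s m = 0 \<longleftrightarrow> s powi (4 * m) = 1"
proof -
  have "s powi (4 * m) = s powi (2 * m) * s powi (2 * m)"
    using assms by (simp add: power_int_add[symmetric])
  moreover have "qi s m = 0 \<longleftrightarrow> s powi (2 * m) = inverse (s powi (2 * m))"
    using assms by (simp add: qi_def power_int_minus)
  moreover have "x = inverse x \<longleftrightarrow> x * x = 1" if "x \<noteq> 0" for x :: complex
    using that by (simp add: field_simps)
  ultimately show ?thesis using assms(1) by simp
qed

lemma tendsto_qi:
  assumes "s0 \<noteq> 0" "s0\<^sup>2 - inverse (s0\<^sup>2) \<noteq> 0"
  shows "((\<lambda>s. qi s m) \<longlongrightarrow> qi s0 m) (at s0)"
  unfolding qi_def using assms by (intro tendsto_intros) auto

lemma tendsto_q_fact: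
  assumes "s0 \<noteq> 0" "s0\<^sup>2 - inverse (s0\<^sup>2) \<noteq> 0"
  shows "((\<lambda>s. q_fact s m) \<longlongrightarrow> q_fact s0 m) (at s0)"
  unfolding q_fact_def q_int_eq_qi using assms by (intro tendsto_prod tendsto_qi)

lemma q_fact_inverse: "q_fact (inverse s) m = q_fact s m"
  by (simp add: q_fact_def q_int_eq_qi qi_inverse)

lemma dpow_inverse: "dpow (inverse s) m X = dpow s m X"
  by (simp add: dpow_def q_fact_inverse)

text \<open>The two numerators vanish at s0 with derivatives 4w / s0 and 4N / s0, and their common
  denominator cancels.\<close>

lemma qi_ratio_limit:
  assumes "s0 \<noteq> 0" "N > 0" "s0 powi (2 * w) = s0 powi (- (2 * w))" "s0 powi (2 * int N) = s0 powi (- (2 * int N))"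
    "s0 powi (2 * w) = 1" "s0 powi (2 * int N) = 1" "s0\<^sup>2 - inverse (s0\<^sup>2) \<noteq> 0"
  shows "((\<lambda>s. qi s w / qi s (int N)) \<longlongrightarrow> of_int w / of_nat N) (at s0)"
proof -
  define g where "g w s = s powi (2 * w) - s powi (- (2 * w))" for w and s :: complex
  have deriv: "((\<lambda>s. (g w s - g w s0) / (s - s0)) \<longlongrightarrow> of_int (4 * w) / s0) (at s0)"
    if "s0 powi (2 * w) = 1" for w
  proof -
    have i: "inverse (s0 powi (2 * w)) = 1" using that by simp
    have "(g w has_field_derivative
        (of_int (2 * w) * s0 powi (2 * w - 1) * 1 - of_int (- (2 * w)) * s0 powi (- (2 * w) - 1) * 1)) (at s0)"
      unfolding g_def using assms(1) by (intro derivative_eq_intros refl) auto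
    moreover have "of_int (2 * w) * s0 powi (2 * w - 1) * 1 - of_int (- (2 * w)) * s0 powi (- (2 * w) - 1) * 1 =
        of_int (4 * w) / s0"
      using assms(1) that i by (simp add: power_int_diff power_int_minus)
    ultimately show ?thesis by (simp add: has_field_derivative_iff)
  qed
  have g0: "g w s0 = 0" "g (int N) s0 = 0" using assms by (simp_all add: g_def)
  have "((\<lambda>s. ((g w s - g w s0) / (s - s0)) / ((g (int N) s - g (int N) s0) / (s - s0))) \<longlongrightarrow>
     (of_int (4 * w) / s0) / (of_int (4 * int N) / s0)) (at s0)"
    using assms by (intro tendsto_divide deriv) auto
  also have "(of_int (4 * w) / s0) / (of_int (4 * int N) / s0) = of_int w / (of_nat N :: complex)"
    using assms by simp
  finally show ?thesis
  proof (rule Lim_transform_eventually)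
    have "\<forall>\<^sub>F s in at s0. s\<^sup>2 - inverse (s\<^sup>2) \<noteq> 0"
      by (rule tendsto_imp_eventually_ne[of _ "s0\<^sup>2 - inverse (s0\<^sup>2)"]) (use assms in \<open>auto intro!: tendsto_intros\<close>)
    moreover have "\<forall>\<^sub>F s in at s0. s \<noteq> s0" by (rule eventually_neq_at_within)
    ultimately show "\<forall>\<^sub>F s in at s0. (g w s - g w s0) / (s - s0) / ((g (int N) s - g (int N) s0) / (s - s0)) =
        qi s w / qi s (int N)"
    proof eventually_elim
      case (elim s)
      have q: "(x / t) / (y / t) = x / y" if "t \<noteq> 0" for x y t :: complex using that by simp
      have "qi s w / qi s (int N) = g w s / g (int N) s"
        unfolding qi_def g_def by (rule q[OF elim(1)])
      moreover have "(g w s / (s - s0)) / (g (int N) s / (s - s0)) = g w s / g (int N) s"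
        by (rule q) (use elim in simp)
      ultimately show ?case unfolding g0 diff_zero by (simp only:)
    qed
  qed
qed

section \<open>The generators\<close>

definition wp :: "bool \<Rightarrow> complex \<Rightarrow> complex" where
  "wp p s = (if p then s else inverse s)"

lemma xsum_csc: "xsum k k' (\<lambda>i. c *\<^sub>c X i) l = c *\<^sub>c xsum k k' X l" for k k' X :: "nat \<Rightarrow> 'a::complex_alg"
  by (induct l) (simp_all add: csc_add_right)

text \<open>The four generators are \<open>gen True False = B\<^sub>+\<close>, \<open>gen False False = B\<^sub>-\<close>, \<open>gen True True = C\<^sub>-\<close>
  and \<open>gen False True = C\<^sub>+\<close>: the first flag is the sign of \<open>k\<close> to the right of the
  raising or lowering operator, the second one tells whether this is \<open>e\<close>.\<close>

locale nbs =
  fixes N L :: nat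
  assumes N: "3 \<le> N" "odd N" and L: "0 < L" "N dvd L"
begin

abbreviation "s0 \<equiv> s_root N"
abbreviation "D \<equiv> N ^ L"

lemma N_pos: "N > 0" and D_pos: "D > 0"
  using N by simp_all

definition good :: "complex \<Rightarrow> bool" where
  "good s \<longleftrightarrow> s \<noteq> 0 \<and> s\<^sup>2 - inverse (s\<^sup>2) \<noteq> 0"

definition "kk p s i = site N L i (k_half N (wp p s))"
definition "ff q s i = site N L i (if q then e_op N s else f_op N s)"
definition "loc i = site N L i ` carrier_mat N N"

text \<open>The prefactors q^(-(L+1)/2) of the B's and q^((L+1)/2) of the C's.\<close>

definition "gen_scale q s = inverse (wp (\<not> q) s) ^ (L + 1)"

definition gen :: "bool \<Rightarrow> bool \<Rightarrow> complex \<Rightarrow> op" where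
  "gen p q s = xsum (kk p s) (kk (\<not> p) s) (\<lambda>i. (gen_scale q s * ((wp (\<not> q) s)\<^sup>2) ^ i) *\<^sub>c ff q s i) L"

definition gen_mat :: "bool \<Rightarrow> bool \<Rightarrow> complex \<Rightarrow> complex mat" where
  "gen_mat p q = (if q then if p then C_minus N L else C_plus N L else if p then B_plus N L else B_minus N L)"

lemma gen_mat_carrier: "gen_mat p q s \<in> carrier_mat D D"
  by (simp add: gen_mat_def B_plus_def B_minus_def C_plus_def C_minus_def twisted_sum_def mat_sum_def)

lemma block_op_gen_mat: "block_op D (gen_mat p q s) = gen p q s"
proof -
  have tw: "block_op D (c \<cdot>\<^sub>m twisted_sum N L g X Y Z) =
      xsum (\<lambda>i. site N L i Z) (\<lambda>i. site N L i X) (\<lambda>i. (c * g i) *\<^sub>c site N L i Y) L"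
    if "X \<in> carrier_mat N N" "Y \<in> carrier_mat N N" "Z \<in> carrier_mat N N" for c g X Y Z
  proof -
    have "twisted_sum N L g X Y Z \<in> carrier_mat D D" by (simp add: twisted_sum_def mat_sum_def)
    then show ?thesis
      using that by (simp add: block_op_smult block_op_twisted_sum[OF N_pos] xsum_csc[symmetric])
  qed
  have p: "s powi (- (int L + 1)) = inverse s ^ (L + 1)" "s powi (int L + 1) = s ^ (L + 1)"
    by (simp_all add: power_int_minus power_int_def power_inverse nat_add_distrib)
  have p': "s powi (- int L - 1) = inverse s ^ (L + 1)" using p(1) by simp
  show ?thesis
    by (cases p; cases q)
      (simp_all add: gen_mat_def gen_def B_plus_def B_minus_def C_plus_def C_minus_def tw k_half_inv_eq p p'
        kk_def[abs_def] ff_def wp_def gen_scale_def power_inverse)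
qed

lemma loc_sites: "sites loc L"
  by standard (auto simp: loc_def intro: sites_swap[OF N_pos])

lemma kk_loc: "kk p s i \<in> loc i" and ff_loc: "ff q s i \<in> loc i"
  by (auto simp: kk_def ff_def loc_def)

lemma loc_csc: "i \<in> {1..L} \<Longrightarrow> x \<in> loc i \<Longrightarrow> c *\<^sub>c x \<in> loc i"
  by (auto simp: loc_def site_smult[OF N_pos, symmetric])

lemma kk_kk:
  assumes "i \<in> {1..L}" "s \<noteq> 0"
  shows "kk p s i * kk (\<not> p) s i = 1"
  using assms k_half_inverse[of "wp p s" N]
  by (auto simp: kk_def wp_def site_mult[OF N_pos, symmetric] site_one[OF N_pos])

lemma site_k_f:
  assumes "i \<in> {1..L}" "u \<noteq> 0"
  shows "site N L i (k_half N u) * ff q s i = (if q then u\<^sup>2 else inverse (u\<^sup>2)) *\<^sub>c (ff q s i * site N L i (k_half N u))"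
proof -
  note i = assms(1)
  have "site N L i (k_half N u * f_op N s) = inverse (u\<^sup>2) *\<^sub>c site N L i (f_op N s * k_half N u)"
    unfolding k_half_f[OF assms(2)] by (rule site_smult[OF N_pos i mult_carrier_mat[OF local_carrier(2,1)]])
  moreover have "site N L i (k_half N u * e_op N s) = u\<^sup>2 *\<^sub>c site N L i (e_op N s * k_half N u)"
    unfolding k_half_e[OF assms(2)] by (rule site_smult[OF N_pos i mult_carrier_mat[OF local_carrier(3,1)]])
  ultimately show ?thesis
    by (auto simp: ff_def site_mult[OF N_pos i])
qed

lemma site_k_k: "i \<in> {1..L} \<Longrightarrow> site N L i (k_half N u) * kk p s i = kk p s i * site N L i (k_half N u)"
  using k_half_commute[of N u] by (simp add: kk_def site_mult[OF N_pos, symmetric])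

lemma site_e_f:
  assumes "i \<in> {1..L}" "good s"
  shows "(s\<^sup>2 - inverse (s\<^sup>2)) *\<^sub>c (ff True s i * ff False s i - ff False s i * ff True s i) =
    kk True s i * kk True s i - kk False s i * kk False s i"
proof -
  have c: "e_op N s * f_op N s \<in> carrier_mat N N" "f_op N s * e_op N s \<in> carrier_mat N N"
    "k_half N s * k_half N s \<in> carrier_mat N N" "k_half N (inverse s) * k_half N (inverse s) \<in> carrier_mat N N"
    by (intro mult_carrier_mat[of _ N N] local_carrier)+
  have "site N L i ((s\<^sup>2 - inverse (s\<^sup>2)) \<cdot>\<^sub>m (e_op N s * f_op N s - f_op N s * e_op N s)) =
    site N L i (k_half N s * k_half N s - k_half N (inverse s) * k_half N (inverse s))"
    using e_f_commutator[of s N] assms by (simp add: good_def)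
  then show ?thesis
    using assms(1) c
    by (simp add: site_smult[OF N_pos] site_diff[OF N_pos] site_mult[OF N_pos] minus_carrier_mat kk_def ff_def wp_def)
qed

text \<open>For p = q the local relations hold with s inverted. Taking \<sigma> = -1 and -1/z for z
  compensates for this in the entries, so that in all four cases the Lax operator is the original
  one up to the flip of the auxiliary basis.\<close>

lemma lax_chain:
  assumes "good s" "z \<noteq> 0"
  shows "lax_chain loc L (wp (p \<noteq> q) s) (wp (\<not> q) s) (if p \<noteq> q then 1 else - 1) (if p \<noteq> q then z else - inverse z)
    (kk p s) (kk (\<not> p) s) (ff q s) (ff (\<not> q) s)"
proof -
  interpret sites loc L by (rule loc_sites)
  have s: "s \<noteq> 0" "s\<^sup>2 - inverse (s\<^sup>2) \<noteq> 0" using assms by (auto simp: good_def)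
  have w: "wp r s \<noteq> 0" for r using s by (simp add: wp_def)
  have dneq: "(wp r s)\<^sup>2 - inverse ((wp r s)\<^sup>2) = (if r then s\<^sup>2 - inverse (s\<^sup>2) else - (s\<^sup>2 - inverse (s\<^sup>2)))" for r
    by (simp add: wp_def power_inverse)
  have wsq: "(wp (\<not> r) s)\<^sup>2 = inverse ((wp r s)\<^sup>2)" "inverse ((wp (\<not> r) s)\<^sup>2) = (wp r s)\<^sup>2" for r
    by (simp_all add: wp_def power_inverse)
  show ?thesis
  proof
    show "wp (p \<noteq> q) s \<noteq> 0" "wp (\<not> q) s \<noteq> 0" by (rule w)+
    show "(if p \<noteq> q then z else - inverse z) \<noteq> 0" using assms by simp
    show "(wp (p \<noteq> q) s)\<^sup>2 - inverse ((wp (p \<noteq> q) s)\<^sup>2) \<noteq> 0" unfolding dneq using s by auto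
    show "(if p \<noteq> q then 1 else - 1) * (if p \<noteq> q then 1 else - 1) = (1::complex)" by simp
    fix i assume i: "i \<in> {1..L}"
    show "kk p s i \<in> loc i" "kk (\<not> p) s i \<in> loc i" "ff q s i \<in> loc i" "ff (\<not> q) s i \<in> loc i"
      by (rule kk_loc ff_loc)+
    show "t *\<^sub>c x \<in> loc i" if "x \<in> loc i" for t x using loc_csc[OF i that] .
    show "kk p s i * kk (\<not> p) s i = 1" "kk (\<not> p) s i * kk p s i = 1"
      using kk_kk[OF i s(1), of p] kk_kk[OF i s(1), of "\<not> p"] by simp_all
    note kf = site_k_f[OF i w, folded kk_def]
    show "kk p s i * ff q s i = inverse ((wp (p \<noteq> q) s)\<^sup>2) *\<^sub>c (ff q s i * kk p s i)"
      "kk (\<not> p) s i * ff q s i = (wp (p \<noteq> q) s)\<^sup>2 *\<^sub>c (ff q s i * kk (\<not> p) s i)"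
      "kk p s i * ff (\<not> q) s i = (wp (p \<noteq> q) s)\<^sup>2 *\<^sub>c (ff (\<not> q) s i * kk p s i)"
      "kk (\<not> p) s i * ff (\<not> q) s i = inverse ((wp (p \<noteq> q) s)\<^sup>2) *\<^sub>c (ff (\<not> q) s i * kk (\<not> p) s i)"
      by (cases p; cases q; simp add: kf wp_def power_inverse)+
    show "((wp (p \<noteq> q) s)\<^sup>2 - inverse ((wp (p \<noteq> q) s)\<^sup>2)) *\<^sub>c (ff (\<not> q) s i * ff q s i - ff q s i * ff (\<not> q) s i) =
        kk p s i * kk p s i - kk (\<not> p) s i * kk (\<not> p) s i"
    proof -
      have neg: "(s\<^sup>2 - inverse (s\<^sup>2)) *\<^sub>c (ff False s i * ff True s i - ff True s i * ff False s i) =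
          kk False s i * kk False s i - kk True s i * kk True s i"
        using arg_cong[OF site_e_f[OF i assms(1)], of uminus] by (simp add: csc_minus_right[symmetric] del: csc_minus_right)
      have m: "(- c) *\<^sub>c (x - y) = c *\<^sub>c (y - x)" for c and x y :: op
        by (simp add: csc_diff_right)
      show ?thesis
        unfolding dneq using site_e_f[OF i assms(1)] neg by (cases p; cases q) (simp_all only: if_True if_False m simp_thms not_True_eq_False not_False_eq_True)
    qed
  qed
qed

section \<open>The limits\<close>

text \<open>[m] vanishes at \<open>s0\<close> iff N divides 2m, and as N is odd, this means that N
  divides m.\<close>

lemma s0_good: "good s0" and qi_s0: "0 < m \<Longrightarrow> m < N \<Longrightarrow> qi s0 (int m) \<noteq> 0"
proof -
  have 4: "s0 powi (4 * int m) \<noteq> 1" if "0 < m" "m < N" for m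
  proof
    assume "s0 powi (4 * int m) = 1"
    then have "N dvd 2 * m"
      using s_root_powi_eq_1[OF N_pos, of "2 * int m"] int_dvd_int_iff[of N "2 * m"] by simp
    then have "N dvd m" using N(2) by (metis coprime_commute coprime_dvd_mult_right_iff coprime_left_2_iff_odd)
    then show False using that by (auto dest: dvd_imp_le)
  qed
  show g: "good s0"
    unfolding good_def
  proof
    show "s0\<^sup>2 - inverse (s0\<^sup>2) \<noteq> 0"
    proof
      assume "s0\<^sup>2 - inverse (s0\<^sup>2) = 0"
      then have "s0\<^sup>2 = inverse (s0\<^sup>2)" by simp
      then have "s0\<^sup>2 * s0\<^sup>2 = 1" by (metis power_eq_0_iff right_inverse s_root_nonzero)
      then show False using 4[of 1] N by (simp add: power_int_def power_add[symmetric])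
    qed
  qed simp
  show "qi s0 (int m) \<noteq> 0" if "0 < m" "m < N"
    using 4[OF that] qi_eq_0_iff[of s0 "int m"] g by (simp add: good_def)
qed

lemma q_fact_s0: "m < N \<Longrightarrow> q_fact s0 m \<noteq> 0"
  by (auto simp: q_fact_def q_int_eq_qi qi_s0)

text \<open>The exceptional parameters are 0 and roots of unity of bounded order, a finite set. It
  contains \<open>s0\<close>, a zero of [N], so it matters that \<open>at s0\<close> is
  punctured.\<close>

lemma eventually_generic: "\<forall>\<^sub>F s in at s0. good s \<and> (\<forall>m. 1 \<le> m \<longrightarrow> m \<le> N \<longrightarrow> qi s (int m) \<noteq> 0)"
proof -
  define bad where "bad = insert (0::complex) (\<Union>m\<in>{1..N}. {s. s ^ (4 * m) = 1})"
  have "finite bad" unfolding bad_def by (auto intro!: finite_nth_roots)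
  then have "\<forall>\<^sub>F s in at s0. \<forall>x\<in>bad. s \<noteq> x"
    by (intro eventually_ball_finite ballI eventually_neq_at_within)
  then show ?thesis
  proof eventually_elim
    case (elim s)
    then have nb: "s \<notin> bad" by auto
    then have s: "s \<noteq> 0" "s ^ (4 * m) \<noteq> 1" if "1 \<le> m" "m \<le> N" for m
      using that by (auto simp: bad_def)
    have s_nz: "s \<noteq> 0" using s(1)[of 1] N by simp
    have "s\<^sup>2 - inverse (s\<^sup>2) \<noteq> 0"
    proof
      assume "s\<^sup>2 - inverse (s\<^sup>2) = 0"
      then have "s\<^sup>2 * s\<^sup>2 = 1" using s_nz by (metis power_eq_0_iff right_inverse right_minus_eq)
      then show False using s(2)[of 1] N by (simp add: power_add[symmetric])
    qed
    then have g: "good s" using s_nz by (simp add: good_def)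
    moreover have "qi s (int m) \<noteq> 0" if "1 \<le> m" "m \<le> N" for m
      using qi_eq_0_iff[of s "int m"] g s(2)[OF that] by (simp add: good_def power_int_def nat_mult_distrib)
    ultimately show ?case by blast
  qed
qed

lemma tendsto_wp: "(wp p \<longlongrightarrow> wp p s0) (at s0)"
  unfolding wp_def[abs_def] by (cases p) (auto intro!: tendsto_intros)

lemma wp_s0: "wp p s0 \<noteq> 0"
  by (simp add: wp_def)

lemma kk_lim: "i \<in> {1..L} \<Longrightarrow> op_lim D (at s0) (\<lambda>s. kk p s i) (kk p s0 i)"
  unfolding kk_def
proof (rule site_lim[OF N_pos])
  fix a b assume ab: "a < N" "b < N"
  have "((\<lambda>s. wp p s powi m) \<longlongrightarrow> wp p s0 powi m) (at s0)" for m
    by (intro tendsto_power_int tendsto_wp wp_s0)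
  then show "((\<lambda>s. k_half N (wp p s) $$ (a, b)) \<longlongrightarrow> k_half N (wp p s0) $$ (a, b)) (at s0)"
    using ab by (auto simp: k_half_def)
qed auto

lemma ff_lim: "i \<in> {1..L} \<Longrightarrow> op_lim D (at s0) (\<lambda>s. ff q s i) (ff q s0 i)"
  unfolding ff_def
proof (rule site_lim[OF N_pos])
  fix a b assume ab: "a < N" "b < N"
  have "((\<lambda>s. q_int s m) \<longlongrightarrow> q_int s0 m) (at s0)" for m
    unfolding q_int_eq_qi using s0_good by (intro tendsto_qi) (auto simp: good_def)
  then show "((\<lambda>s. (if q then e_op N s else f_op N s) $$ (a, b)) \<longlongrightarrow> (if q then e_op N s0 else f_op N s0) $$ (a, b)) (at s0)"
    using ab by (auto simp: e_op_def f_op_def)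
qed auto

lemma tendsto_gen_scale: "((\<lambda>s. gen_scale q s * ((wp (\<not> q) s)\<^sup>2) ^ i) \<longlongrightarrow> gen_scale q s0 * ((wp (\<not> q) s0)\<^sup>2) ^ i) (at s0)"
  unfolding gen_scale_def by (intro tendsto_intros tendsto_wp wp_s0)

lemma gen_lim: "op_lim D (at s0) (gen p q) (gen p q s0)"
  unfolding gen_def[abs_def]
  by (rule op_lim_xsum[OF D_pos]) (auto intro!: kk_lim ff_lim op_lim_csc tendsto_gen_scale)

lemma ff_nilpotent: "i \<in> {1..L} \<Longrightarrow> ff q s i ^ N = 0"
proof -
  assume i: "i \<in> {1..L}"
  have "site N L i (0\<^sub>m N N) = site N L i (0\<^sub>m N N) + site N L i (0\<^sub>m N N)"
    using site_add[OF N_pos i, of "0\<^sub>m N N" "0\<^sub>m N N"] by simp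
  then have "site N L i (0\<^sub>m N N) = 0" by simp
  then show ?thesis
    using site_power[OF N_pos i, of "f_op N s" N] site_power[OF N_pos i, of "e_op N s" N]
    by (simp add: ff_def f_nilpotent e_nilpotent)
qed

definition G :: "bool \<Rightarrow> bool \<Rightarrow> op" where
  "G p q = block_op D (divided_power_limit N L (gen_mat p q))"

lemma dpow_wp: "dpow (wp p s) m X = dpow s m X"
  by (simp add: wp_def dpow_inverse)

lemma q_fact_wp: "q_fact (wp p s) m = q_fact s m"
  by (simp add: wp_def q_fact_inverse)

lemma G_lim: "op_lim D (at s0) (\<lambda>s. dpow s N (gen p q s)) (G p q)"
proof -
  define X where "X s i = (gen_scale q s * ((wp (\<not> q) s)\<^sup>2) ^ i) *\<^sub>c ff q s i" for s i
  have q: "((\<lambda>s. q_fact (wp (p \<noteq> q) s) a) \<longlongrightarrow> q_fact (wp (p \<noteq> q) s0) a) (at s0)" for a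
    unfolding q_fact_wp using s0_good by (intro tendsto_q_fact) (auto simp: good_def)
  \<comment> \<open>The site relations hold for s or its inverse according to p and q; by
    \<open>dpow_wp\<close> the divided power is the same for both.\<close>
  have "\<exists>B. op_lim D (at s0) (\<lambda>s. dpow (wp (p \<noteq> q) s) N (xsum (kk p s) (kk (\<not> p) s) (X s) L)) B"
  proof (rule dpow_xsum_lim[where S = loc and L = L])
    show "\<forall>\<^sub>F s in at s0. sites loc L \<and> wp (p \<noteq> q) s \<noteq> 0 \<and> (\<forall>m. 1 \<le> m \<longrightarrow> m \<le> N \<longrightarrow> qi (wp (p \<noteq> q) s) (int m) \<noteq> 0) \<and>
      (\<forall>i\<in>{1..L}. kk p s i \<in> loc i \<and> kk (\<not> p) s i \<in> loc i \<and> X s i \<in> loc i \<and> kk p s i * kk (\<not> p) s i = kk (\<not> p) s i * kk p s i \<and>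
         kk (\<not> p) s i * X s i = (wp (p \<noteq> q) s)\<^sup>2 *\<^sub>c (X s i * kk (\<not> p) s i) \<and>
         X s i * kk p s i = (wp (p \<noteq> q) s)\<^sup>2 *\<^sub>c (kk p s i * X s i) \<and> X s i ^ N = 0)"
      using eventually_generic
    proof eventually_elim
      case (elim s)
      \<comment> \<open>Only local relations are taken from this locale, so the spectral parameter
        is set to 1.\<close>
      interpret lc: lax_chain loc L "wp (p \<noteq> q) s" "wp (\<not> q) s" "if p \<noteq> q then 1 else - 1" "if p \<noteq> q then 1 else - inverse 1"
        "gen_scale q s" "kk p s" "kk (\<not> p) s" "ff q s" "ff (\<not> q) s"
        by (rule lax_chain) (use elim in auto)
      have w: "wp (p \<noteq> q) s \<noteq> 0" by (rule lc.nz)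
      have ww: "(wp (p = (\<not> q)) s)\<^sup>2 * (inverse ((wp (p = (\<not> q)) s)\<^sup>2) * x) = x" for x
        using w by simp
      have qiw: "qi (wp r s) m = qi s m" for r m by (simp add: wp_def qi_inverse)
      have "X s i \<in> loc i" "kk p s i * kk (\<not> p) s i = kk (\<not> p) s i * kk p s i"
         "kk (\<not> p) s i * X s i = (wp (p \<noteq> q) s)\<^sup>2 *\<^sub>c (X s i * kk (\<not> p) s i)"
         "X s i * kk p s i = (wp (p \<noteq> q) s)\<^sup>2 *\<^sub>c (kk p s i * X s i)" "X s i ^ N = 0" if i: "i \<in> {1..L}" for i
        using w N_pos lc.kf[OF i] lc.kk'[OF i]
        by (simp_all add: ww X_def loc_csc[OF i ff_loc] csc_power ff_nilpotent[OF i] mult.commute)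
      then show ?case using w elim by (simp add: loc_sites kk_loc qiw)
    qed
    show "op_lim D (at s0) (\<lambda>s. X s i) (X s0 i)" if "i \<in> {1..L}" for i
      unfolding X_def by (intro op_lim_csc tendsto_gen_scale ff_lim that)
    show "q_fact (wp (p \<noteq> q) s0) a \<noteq> 0" if "a < N" for a using q_fact_s0[OF that] by (simp add: q_fact_wp)
  qed (use D_pos N_pos kk_lim tendsto_wp q in auto)
  then obtain B where B: "op_lim D (at s0) (\<lambda>s. dpow s N (gen p q s)) B"
    unfolding dpow_wp X_def gen_def by blast
  have blk: "block_op D ((1 / q_fact s N) \<cdot>\<^sub>m (gen_mat p q s ^\<^sub>m N)) = dpow s N (gen p q s)" for s
    using gen_mat_carrier[of p q s] D_pos
    by (simp add: block_op_smult pow_carrier_mat block_op_power block_op_gen_mat dpow_def)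
  have "G p q = B"
    unfolding G_def divided_power_limit_def
  proof (rule block_op_mat_lim)
    show "(1 / q_fact s N) \<cdot>\<^sub>m (gen_mat p q s ^\<^sub>m N) \<in> carrier_mat D D" for s
      using gen_mat_carrier by (simp add: pow_carrier_mat)
  qed (use B blk in simp_all)
  then show ?thesis using B by simp
qed

end

section \<open>Diagonal operators and weights\<close>

context nbs
begin

definition dg :: "(nat \<Rightarrow> complex) \<Rightarrow> op" where
  "dg g = block_op D (diagm D g)"

lemma dg_Ops: "dg g \<in> Ops D"
  unfolding dg_def by (rule block_op_in_Ops) simp

lemma dg_mult: "dg g * dg g' = dg (\<lambda>a. g a * g' a)"
  unfolding dg_def by (subst block_op_mult[symmetric]) (simp_all add: diagm_mult)

lemma dg_csc: "c *\<^sub>c dg g = dg (\<lambda>a. c * g a)"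
proof -
  have "c \<cdot>\<^sub>m diagm D g = diagm D (\<lambda>a. c * g a)" by (rule eq_matI) (auto simp: diagm_def)
  then show ?thesis unfolding dg_def by (simp only: block_op_smult[OF diagm_carrier, symmetric])
qed

lemma dg_cong: "(\<And>a. a < D \<Longrightarrow> g a = g' a) \<Longrightarrow> dg g = dg g'"
  unfolding dg_def by (rule arg_cong[of _ _ "block_op D"], rule diagm_cong)

lemma ent_dg: "a < D \<Longrightarrow> b < D \<Longrightarrow> ent (dg g) a b = (if a = b then g b else 0)"
  unfolding dg_def by (simp add: ent_block_op diagm_index)

lemma ent_dg_mult:
  assumes "X \<in> Ops D" "a < D" "b < D"
  shows "ent (dg g * X) a b = g a * ent X a b" "ent (X * dg g) a b = ent X a b * g b"
  unfolding dg_def using ent_diag_mult[OF assms] by auto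

definition A_at :: "complex \<Rightarrow> op" where
  "A_at u = block_op D (A_op N L u)"

lemma A_at_dg: "u \<noteq> 0 \<Longrightarrow> A_at u = dg (\<lambda>a. u powi wt N L a)"
  by (simp add: A_at_def dg_def A_op_diagm)

lemma A_at_oprod: "A_at u = oprod (\<lambda>i. site N L i (k_half N u)) L"
proof -
  have "A_op N L u = tens L (\<lambda>_. k_half N u)"
    unfolding A_op_def tensor_list_eq_tens length_replicate by (rule tens_cong) simp
  then show ?thesis unfolding A_at_def by (simp add: block_op_tens[OF N_pos])
qed

lemma A_at_kk: "oprod (kk p s) L = A_at (wp p s)"
  by (simp add: A_at_oprod kk_def[abs_def])

lemma site_loc: "X \<in> carrier_mat N N \<Longrightarrow> site N L i X \<in> loc i"
  by (simp add: loc_def)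

lemma A_at_gen:
  assumes "u \<noteq> 0"
  shows "A_at u * gen p q s = (if q then u\<^sup>2 else inverse (u\<^sup>2)) *\<^sub>c (gen p q s * A_at u)"
proof -
  interpret sites loc L by (rule loc_sites)
  show ?thesis
    unfolding A_at_oprod gen_def
    by (rule oprod_xsum)
      (auto simp: kk_loc ff_loc loc_csc site_k_k site_k_f[OF _ assms] site_loc mult.commute)
qed

lemma gen_Ops: "gen p q s \<in> Ops D"
  unfolding block_op_gen_mat[symmetric] by (rule block_op_in_Ops) (rule gen_mat_carrier)

lemma G_Ops: "G p q \<in> Ops D"
  using G_lim by (simp add: op_lim_def)

definition shift :: "bool \<Rightarrow> int" where
  "shift q = (if q then 2 else - 2)"

lemma G_weight:
  assumes "a < D" "b < D" "ent (G p q) a b \<noteq> 0"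
  shows "wt N L a = wt N L b + shift q * int N"
proof -
  have "((\<lambda>s. ent (dpow s N (gen p q s)) a b) \<longlongrightarrow> ent (G p q) a b) (at s0)"
    using G_lim assms by (simp add: op_lim_def)
  \<comment> \<open>A nonzero entry of the limit is nonzero for some s near \<open>s0\<close>, where
    commutation with \<open>A_at 2\<close> determines the weight shift.\<close>
  then have "\<forall>\<^sub>F s in at s0. ent (dpow s N (gen p q s)) a b \<noteq> 0"
    using assms(3) by (rule tendsto_imp_eventually_ne)
  then obtain s where s: "ent (dpow s N (gen p q s)) a b \<noteq> 0"
    using eventually_happens[of _ "at s0"] by auto
  have "A_at 2 * gen p q s = (2 powi shift q) *\<^sub>c (gen p q s * A_at 2)"
    using A_at_gen[of 2 p q s] by (simp add: shift_def power_int_minus)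
  from dpow_intertwine[OF this, of s N]
  have "dg (\<lambda>a. 2 powi wt N L a) * dpow s N (gen p q s) =
    (2 powi (shift q * int N)) *\<^sub>c (dpow s N (gen p q s) * dg (\<lambda>a. 2 powi wt N L a))"
    by (simp add: A_at_dg power_int_mult)
  then show ?thesis
    unfolding dg_def by (rule ent_weight[OF Ops_dpow[OF D_pos gen_Ops] assms(1,2) s])
qed

lemma gen_commute:
  assumes "good s"
  shows "gen True q s * gen False q s = gen False q s * gen True q s"
proof -
  interpret sites loc L by (rule loc_sites)
  have s: "s \<noteq> 0" "inverse s \<noteq> 0" using assms by (simp_all add: good_def)
  define u where "u p = (if q then (wp p s)\<^sup>2 else inverse ((wp p s)\<^sup>2))" for p
  have w: "wp p s \<noteq> 0" for p using s by (simp add: wp_def)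
  have kf: "kk p s i * (c *\<^sub>c ff q s i) = u p *\<^sub>c ((c *\<^sub>c ff q s i) * kk p s i)" if "i \<in> {1..L}" for p i c
    using site_k_f[OF that w, of p q s] by (simp add: kk_def u_def mult.commute)
  show ?thesis
    unfolding gen_def not_True_eq_False not_False_eq_True
    by (rule xsum_xsum_commute[where u = "u True" and v = "u False"])
      (use kf kk_kk[OF _ s(1), of _ True] kk_kk[OF _ s(1), of _ False] in \<open>auto simp: kk_loc ff_loc loc_csc mult.commute\<close>)
qed

lemma dpow_commute:
  assumes "x * y = y * x"
  shows "dpow s m x * dpow s m y = dpow s m y * dpow s m (x :: 'a::complex_alg)"
proof -
  have "x ^ m * y = y * x ^ m" by (rule power_commuting_commutes[OF assms])
  then have "y ^ m * x ^ m = x ^ m * y ^ m" by (intro power_commuting_commutes) simp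
  then show ?thesis by (simp add: dpow_def)
qed

lemma at_s0_not_bot: "at s0 \<noteq> bot"
  by simp

lemma G_commute: "G True q * G False q = G False q * G True q"
proof (rule op_lim_unique[OF at_s0_not_bot])
  show "op_lim D (at s0) (\<lambda>s. dpow s N (gen True q s) * dpow s N (gen False q s)) (G True q * G False q)"
    by (intro op_lim_mult G_lim)
  show "op_lim D (at s0) (\<lambda>s. dpow s N (gen True q s) * dpow s N (gen False q s)) (G False q * G True q)"
  proof (rule op_lim_cong)
    show "op_lim D (at s0) (\<lambda>s. dpow s N (gen False q s) * dpow s N (gen True q s)) (G False q * G True q)"
      by (intro op_lim_mult G_lim)
    show "\<forall>\<^sub>F s in at s0. dpow s N (gen True q s) * dpow s N (gen False q s) = dpow s N (gen False q s) * dpow s N (gen True q s)"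
      using eventually_generic by eventually_elim (simp add: dpow_commute gen_commute)
  qed
qed

section \<open>The Cartan relation on the sector\<close>

text \<open>Equivalent to q^wt = 1, the condition A^2 = 1 on a basis vector; so \<open>P\<close>
  projects onto the sector.\<close>

definition W :: "nat \<Rightarrow> bool" where
  "W a \<longleftrightarrow> int N dvd wt N L a"

definition P :: op where
  "P = dg (\<lambda>a. if W a then 1 else 0)"

definition H :: op where
  "H = dg (\<lambda>a. of_int (wt N L a) / of_nat N)"

text \<open>The scalar coefficients of B and C at the same site are inverse to each other, so the
  local commutators enter \<open>xsum_commutator\<close> unscaled.\<close>

lemma gen_commutator:
  assumes "good s"
  shows "(s\<^sup>2 - inverse (s\<^sup>2)) *\<^sub>c (gen p True s * gen p False s - gen p False s * gen p True s) =
    A_at s * A_at s - A_at (inverse s) * A_at (inverse s)"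
proof -
  have s: "s \<noteq> 0" using assms by (simp add: good_def)
  have w: "wp p s \<noteq> 0" for p using s by (simp add: wp_def)
  interpret lc: lax_chain loc L "wp (p \<noteq> False) s" "wp (\<not> False) s" "if p \<noteq> False then 1 else - 1"
    "if p \<noteq> False then 1 else - inverse 1" "gen_scale False s" "kk p s" "kk (\<not> p) s" "ff False s" "ff (\<not> False) s"
    by (rule lax_chain) (use assms in auto)
  define c where "c q i = gen_scale q s * ((wp (\<not> q) s)\<^sup>2) ^ i" for q i
  have gen_scale: "c True i * c False i = 1" for i
    using s by (simp add: c_def gen_scale_def wp_def power_inverse power_mult_distrib[symmetric] del: power_Suc)
      (simp add: field_simps)
  have gen: "gen p q s = xsum (kk p s) (kk (\<not> p) s) (\<lambda>i. c q i *\<^sub>c ff q s i) L" for q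
    by (simp add: gen_def c_def)
  have "((wp p s)\<^sup>2 - inverse ((wp p s)\<^sup>2)) *\<^sub>c (gen p True s * gen p False s - gen p False s * gen p True s) =
    oprod (kk p s) L * oprod (kk p s) L - oprod (kk (\<not> p) s) L * oprod (kk (\<not> p) s) L"
    unfolding gen
  proof (rule lc.xsum_commutator[where u = "(wp p s)\<^sup>2" and v = "inverse ((wp p s)\<^sup>2)"])
    fix i assume i: "i \<in> {1..L}"
    note r = lc.kf[OF i] lc.ke[OF i]
    have ww: "(wp p s)\<^sup>2 * (inverse ((wp p s)\<^sup>2) * x) = x" "inverse ((wp p s)\<^sup>2) * ((wp p s)\<^sup>2 * x) = x"
      "(wp p s)\<^sup>2 * inverse ((wp p s)\<^sup>2) = 1" for x
      using w[of p] by simp_all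
    show "kk p s i * kk (\<not> p) s i = kk (\<not> p) s i * kk p s i" using lc.kk'[OF i] by simp
    show "kk (\<not> p) s i * c False i *\<^sub>c ff False s i = (wp p s)\<^sup>2 *\<^sub>c (c False i *\<^sub>c ff False s i * kk (\<not> p) s i)"
      "c False i *\<^sub>c ff False s i * kk p s i = (wp p s)\<^sup>2 *\<^sub>c (kk p s i * c False i *\<^sub>c ff False s i)"
      "kk (\<not> p) s i * c True i *\<^sub>c ff True s i = inverse ((wp p s)\<^sup>2) *\<^sub>c (c True i *\<^sub>c ff True s i * kk (\<not> p) s i)"
      "c True i *\<^sub>c ff True s i * kk p s i = inverse ((wp p s)\<^sup>2) *\<^sub>c (kk p s i * c True i *\<^sub>c ff True s i)"
      using r by (simp_all add: ww mult.commute mult.left_commute)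
    show "((wp p s)\<^sup>2 - inverse ((wp p s)\<^sup>2)) *\<^sub>c
        (c True i *\<^sub>c ff True s i * c False i *\<^sub>c ff False s i - c False i *\<^sub>c ff False s i * c True i *\<^sub>c ff True s i) =
      kk p s i * kk p s i - kk (\<not> p) s i * kk (\<not> p) s i"
      using lc.ef[OF i] gen_scale[of i] by (simp add: mult.commute[of "c False i"])
  qed (use w in \<open>auto simp: kk_loc ff_loc loc_csc\<close>)
  then have "((wp p s)\<^sup>2 - inverse ((wp p s)\<^sup>2)) *\<^sub>c (gen p True s * gen p False s - gen p False s * gen p True s) =
    A_at (wp p s) * A_at (wp p s) - A_at (wp (\<not> p) s) * A_at (wp (\<not> p) s)"
    by (simp only: A_at_kk)
  \<comment> \<open>For p = False the relation above is the one for the inverse parameter, and both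
    of its sides change sign.\<close>
  moreover have "((inverse s)\<^sup>2 - inverse ((inverse s)\<^sup>2)) *\<^sub>c x = - ((s\<^sup>2 - inverse (s\<^sup>2)) *\<^sub>c x)" for x :: op
    by (simp add: power_inverse csc_diff_left)
  ultimately show ?thesis by (cases p) (simp_all add: wp_def, metis minus_diff_eq neg_equal_iff_equal)
qed

lemma quantum_sl2:
  assumes "good s"
  shows "quantum_sl2 s (gen p True s) (gen p False s) (A_at s * A_at s) (A_at (inverse s) * A_at (inverse s))"
proof
  have s: "s \<noteq> 0" "inverse s \<noteq> 0" using assms by (simp_all add: good_def)
  show "s \<noteq> 0" "s\<^sup>2 - inverse (s\<^sup>2) \<noteq> 0" using assms by (simp_all add: good_def)
  show "(s\<^sup>2 - inverse (s\<^sup>2)) *\<^sub>c (gen p True s * gen p False s - gen p False s * gen p True s) =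
    A_at s * A_at s - A_at (inverse s) * A_at (inverse s)" by (rule gen_commutator[OF assms])
  have sq: "A_at u * A_at u * x = (v * v) *\<^sub>c (x * (A_at u * A_at u))" if "A_at u * x = v *\<^sub>c (x * A_at u)" for u v x
    using that by (simp add: mult.assoc assoc_rule_csc[OF that])
  have p4: "s\<^sup>2 * s\<^sup>2 = s ^ 4" "inverse (s\<^sup>2) * inverse (s\<^sup>2) = inverse (s ^ 4)"
    by (simp_all add: power_add[symmetric] inverse_mult_distrib[symmetric] del: inverse_mult_distrib)
  note g = A_at_gen[OF s(1), THEN sq] A_at_gen[OF s(2), THEN sq]
  show "A_at s * A_at s * gen p True s = s ^ 4 *\<^sub>c (gen p True s * (A_at s * A_at s))"
    "A_at (inverse s) * A_at (inverse s) * gen p True s = inverse (s ^ 4) *\<^sub>c (gen p True s * (A_at (inverse s) * A_at (inverse s)))"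
    "A_at s * A_at s * gen p False s = inverse (s ^ 4) *\<^sub>c (gen p False s * (A_at s * A_at s))"
    "A_at (inverse s) * A_at (inverse s) * gen p False s = s ^ 4 *\<^sub>c (gen p False s * (A_at (inverse s) * A_at (inverse s)))"
    using g[of p True s] g[of p False s] by (simp_all add: p4 power_inverse)
qed

lemma qbin_lim_0:
  assumes "int N dvd w" "1 \<le> t" "t < N"
  shows "((\<lambda>s. qbin s w t) \<longlongrightarrow> 0) (at s0)"
proof -
  have g: "s0 \<noteq> 0" "s0\<^sup>2 - inverse (s0\<^sup>2) \<noteq> 0" using s0_good by (simp_all add: good_def)
  have "((\<lambda>s. qbin s w t) \<longlongrightarrow> (\<Prod>j<t. qi s0 (w - int j)) / q_fact s0 t) (at s0)"
    unfolding qbin_def using q_fact_s0[OF assms(3)] g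
    by (intro tendsto_divide tendsto_prod tendsto_qi tendsto_q_fact)
  moreover have "qi s0 w = 0"
    using s_root_powi_eq_1[OF N_pos, of w] s_root_powi_eq_1[OF N_pos, of "- w"] assms(1) by (simp add: qi_def)
  then have "(\<Prod>j<t. qi s0 (w - int j)) = 0"
    using assms(2) by (intro prod_zero) (auto intro!: bexI[of _ 0])
  ultimately show ?thesis by simp
qed

text \<open>The factor j = 0 divided by [N] tends to w / N. In the others [w - j] tends to -[j]
  because q^w = 1; their product (-1)^(N-1) [N-1]! cancels the remaining denominator, since N - 1 is
  even.\<close>

lemma qbin_lim_N:
  assumes "int N dvd w"
  shows "((\<lambda>s. qbin s w N) \<longlongrightarrow> of_int w / of_nat N) (at s0)"
proof -
  have g: "s0 \<noteq> 0" "s0\<^sup>2 - inverse (s0\<^sup>2) \<noteq> 0" using s0_good by (simp_all add: good_def)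
  obtain n where n: "N = Suc n" using N_pos by (cases N) auto
  have one: "s0 powi (2 * w) = 1" "s0 powi (- (2 * w)) = 1" "s0 powi (2 * int N) = 1" "s0 powi (- (2 * int N)) = 1"
    using s_root_powi_eq_1[OF N_pos, of w] s_root_powi_eq_1[OF N_pos, of "- w"]
      s_root_powi_eq_1[OF N_pos, of "int N"] s_root_powi_eq_1[OF N_pos, of "- int N"] assms by simp_all
  have "qi s0 (w - int j) = - qi s0 (int j)" for j
  proof -
    have "s0 powi (2 * (w - int j)) = s0 powi (- (2 * int j))" "s0 powi (- (2 * (w - int j))) = s0 powi (2 * int j)"
      using g one by (simp_all add: right_diff_distrib power_int_diff power_int_minus divide_inverse)
    then show ?thesis by (simp add: qi_def diff_divide_distrib)
  qed
  then have "(\<Prod>j<n. qi s0 (w - int (Suc j))) = (- 1) ^ n * (\<Prod>j<n. qi s0 (int (Suc j)))"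
    by (simp add: prod_uminus del: of_nat_Suc)
  also have "(\<Prod>j<n. qi s0 (int (Suc j))) = q_fact s0 n"
    by (simp add: q_fact_def q_int_eq_qi prod.atLeast1_atMost_eq del: of_nat_Suc)
  also have "(- 1) ^ n = (1::complex)" using N(2) n by simp
  finally have fact: "(\<Prod>j<n. qi s0 (w - int (Suc j))) / q_fact s0 n = 1"
    using q_fact_s0[of n] n by simp
  have "((\<lambda>s. qi s w / qi s (int N) * ((\<Prod>j<n. qi s (w - int (Suc j))) / q_fact s n)) \<longlongrightarrow>
      of_int w / of_nat N * ((\<Prod>j<n. qi s0 (w - int (Suc j))) / q_fact s0 n)) (at s0)"
    using q_fact_s0[of n] n g one N_pos
    by (intro tendsto_mult qi_ratio_limit tendsto_divide tendsto_prod tendsto_qi tendsto_q_fact) auto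
  moreover have "qi s w / qi s (int N) * ((\<Prod>j<n. qi s (w - int (Suc j))) / q_fact s n) = qbin s w N" for s
    unfolding qbin_def n prod.lessThan_Suc_shift q_fact_Suc by (simp add: mult.commute)
  ultimately show ?thesis unfolding fact by simp
qed

text \<open>\<open>Q\<close> projects onto a single basis vector and so has a definite weight. In
  Kac's formula with m = n = N the upper entry of the binomials is this weight itself.\<close>

lemma G_kac:
  assumes "b < D" "W b"
  defines "Q \<equiv> dg (\<lambda>a. if a = b then 1 else 0)"
  shows "G p True * (G p False * Q) = G p False * (G p True * Q) + (of_int (wt N L b) / of_nat N) *\<^sub>c Q"
proof (rule op_lim_unique[OF at_s0_not_bot])
  define w where "w = wt N L b"
  define R where "R t s = qbin s w t *\<^sub>c (dpow s (N - t) (gen p False s) * (dpow s (N - t) (gen p True s) * Q))" for t s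
  \<comment> \<open>The limits of the summands: the reordered product for t = 0, the Cartan term for
    t = N, and zero otherwise. A sum of two conditionals makes the total immediate.\<close>
  define r where "r t = (if t = 0 then G p False * (G p True * Q) else 0) +
    (if t = N then (of_int w / of_nat N) *\<^sub>c Q else 0)" for t
  have Q: "op_lim D (at s0) (\<lambda>_. Q) Q" unfolding Q_def by (intro op_lim_const dg_Ops)
  have g: "s0 \<noteq> 0" "s0\<^sup>2 - inverse (s0\<^sup>2) \<noteq> 0" using s0_good by (simp_all add: good_def)
  show "op_lim D (at s0) (\<lambda>s. dpow s N (gen p True s) * (dpow s N (gen p False s) * Q)) (G p True * (G p False * Q))"
    by (intro op_lim_mult G_lim Q)
  have "op_lim D (at s0) (R t) (r t)" if "t \<le> N" for t
  proof -
    consider "t = 0" | "t = N" | "1 \<le> t" "t < N" using \<open>t \<le> N\<close> by linarith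
    then show ?thesis
    proof cases
      case 1
      have "op_lim D (at s0) (\<lambda>s. dpow s N (gen p False s) * (dpow s N (gen p True s) * Q)) (G p False * (G p True * Q))"
        by (intro op_lim_mult G_lim Q)
      then show ?thesis using 1 N_pos by (simp add: R_def[abs_def] r_def)
    next
      case 2
      have "op_lim D (at s0) (\<lambda>s. qbin s w N *\<^sub>c Q) ((of_int w / of_nat N) *\<^sub>c Q)"
        using assms(2) by (intro op_lim_csc Q qbin_lim_N) (simp add: W_def w_def)
      then show ?thesis using 2 N_pos by (simp add: R_def[abs_def] r_def)
    next
      case 3
      have "op_lim D (at s0) (R t) (0 *\<^sub>c (dpow s0 (N - t) (gen p False s0) * (dpow s0 (N - t) (gen p True s0) * Q)))"
        unfolding R_def using assms(2) 3 g q_fact_s0[of "N - t"]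
        by (intro op_lim_csc qbin_lim_0 op_lim_mult op_lim_dpow D_pos gen_lim Q tendsto_q_fact) (simp_all add: W_def w_def)
      then show ?thesis using 3 by (simp add: r_def)
    qed
  qed
  then have "op_lim D (at s0) (\<lambda>s. \<Sum>t\<le>N. R t s) (\<Sum>t\<le>N. r t)" by (intro op_lim_sum) simp
  also have "(\<Sum>t\<le>N. r t) = G p False * (G p True * Q) + (of_int (wt N L b) / of_nat N) *\<^sub>c Q"
    by (simp add: r_def sum.distrib w_def)
  finally have lim: "op_lim D (at s0) (\<lambda>s. \<Sum>t\<le>N. R t s) (G p False * (G p True * Q) + (of_int (wt N L b) / of_nat N) *\<^sub>c Q)" .
  have ev: "\<forall>\<^sub>F s in at s0. dpow s N (gen p True s) * (dpow s N (gen p False s) * Q) = (\<Sum>t\<le>N. R t s)"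
    using eventually_generic
  proof eventually_elim
    case (elim s)
    interpret quantum_sl2 s "gen p True s" "gen p False s" "A_at s * A_at s" "A_at (inverse s) * A_at (inverse s)"
      by (rule quantum_sl2) (use elim in simp)
    have "weight w Q"
    proof -
      have "s powi (2 * w) = s powi w * s powi w" "s powi (- (2 * w)) = inverse s powi w * inverse s powi w"
        using s(1) by (simp_all add: power_int_add[symmetric] power_int_inverse power_int_minus inverse_mult_distrib[symmetric] del: inverse_mult_distrib)
      then show ?thesis
        using s(1) unfolding weight_def unfolding Q_def A_at_dg[OF s(1)] A_at_dg[OF nonzero_imp_inverse_nonzero[OF s(1)]] dg_mult dg_csc
        by (auto intro!: dg_cong simp: w_def)
    qed
    from kac_formula[OF this, of N N] elim show ?case by (simp add: R_def)
  qed
  show "op_lim D (at s0) (\<lambda>s. dpow s N (gen p True s) * (dpow s N (gen p False s) * Q))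
     (G p False * (G p True * Q) + (of_int (wt N L b) / of_nat N) *\<^sub>c Q)"
    by (rule op_lim_cong[OF ev lim])
qed

lemma G_commutator: "(G p True * G p False - G p False * G p True) * P = H * P"
proof (rule Ops_eqI[of _ D])
  let ?X = "G p True * G p False - G p False * G p True"
  have X: "?X \<in> Ops D" by (intro Ops_closed G_Ops)
  show "?X * P \<in> Ops D" "H * P \<in> Ops D" unfolding P_def H_def by (intro Ops_closed G_Ops dg_Ops)+
  fix a b assume ab: "a < D" "b < D"
  show "ent (?X * P) a b = ent (H * P) a b"
  proof (cases "W b")
    case True
    define Q where "Q = dg (\<lambda>a. if a = b then 1 else 0)"
    have eq: "?X * Q = (of_int (wt N L b) / of_nat N) *\<^sub>c Q"
      using G_kac[OF ab(2) True, of p] by (simp add: Q_def left_diff_distrib mult.assoc)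
    have e1: "ent (?X * Q) a b = ent ?X a b"
      unfolding Q_def ent_dg_mult(2)[OF X ab] by simp
    have e2: "ent ((of_int (wt N L b) / of_nat N) *\<^sub>c Q) a b = (of_int (wt N L b) / of_nat N) * (if a = b then 1 else 0)"
      by (simp add: Q_def ent_dg[OF ab])
    have "ent ?X a b = (of_int (wt N L b) / of_nat N) * (if a = b then 1 else 0)"
      unfolding e1[symmetric] eq e2 ..
    then show ?thesis
      unfolding P_def ent_dg_mult(2)[OF X ab] H_def dg_mult ent_dg[OF ab] using True by simp
  qed (simp only: P_def ent_dg_mult(2)[OF X ab] H_def dg_mult ent_dg[OF ab], simp)
qed

lemma P_idem: "P * P = P"
  unfolding P_def dg_mult by (rule dg_cong) simp

lemma P_H: "P * H = H * P"
  unfolding P_def H_def dg_mult by (simp add: mult.commute)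

lemma P_Ops: "P \<in> Ops D" and H_Ops: "H \<in> Ops D"
  by (simp_all add: P_def H_def dg_Ops)

text \<open>Weights are shifted by plus or minus 2N, which preserves divisibility by N.\<close>

lemma P_G: "P * G p q = G p q * P"
proof (rule Ops_eqI[of _ D])
  fix a b assume ab: "a < D" "b < D"
  have "W a = W b" if "ent (G p q) a b \<noteq> 0"
    using G_weight[OF ab that] by (simp add: W_def dvd_add_left_iff)
  then show "ent (P * G p q) a b = ent (G p q * P) a b"
    unfolding P_def ent_dg_mult[OF G_Ops ab] by auto
qed (intro Ops_closed P_Ops G_Ops)+

lemma H_G: "H * G p q - G p q * H = of_int (shift q) *\<^sub>c G p q"
proof (rule Ops_eqI[of _ D])
  fix a b assume ab: "a < D" "b < D"
  show "ent (H * G p q - G p q * H) a b = ent (of_int (shift q) *\<^sub>c G p q) a b"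
  proof (cases "ent (G p q) a b = 0")
    case False
    have "(of_int (wt N L a) :: complex) / of_nat N - of_int (wt N L b) / of_nat N = of_int (shift q)"
      using G_weight[OF ab False] N_pos by (simp add: field_simps)
    moreover have "ent (H * G p q - G p q * H) a b =
        (of_int (wt N L a) / of_nat N - of_int (wt N L b) / of_nat N) * ent (G p q) a b"
      by (simp add: H_def ent_dg_mult[OF G_Ops ab] algebra_simps)
    ultimately show ?thesis by simp
  qed (simp add: H_def ent_dg_mult[OF G_Ops ab])
qed (intro Ops_closed H_Ops G_Ops)+

end

section \<open>The transfer matrix\<close>

text \<open>Conjugation by the exchange of the two auxiliary basis vectors, hence
  multiplicative.\<close>

definition swap_m2 :: "'a m2 \<Rightarrow> 'a m2" where
  "swap_m2 x = M2 (e11 x) (e10 x) (e01 x) (e00 x)"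

lemma swap_m2_mult: "swap_m2 (x * y) = swap_m2 x * swap_m2 (y :: 'a::ring_1 m2)"
  by (cases x; cases y) (simp add: swap_m2_def add.commute)

lemma rprod_swap_m2: "rprod (\<lambda>i. swap_m2 (M i)) l = swap_m2 (rprod M l :: 'a::ring_1 m2)"
  by (induct l) (simp_all add: swap_m2_mult, simp add: swap_m2_def one_m2_def)

lemma m2_sel_mult:
  "e00 (x * y) = e00 x * e00 y + e01 x * e10 y" "e01 (x * y) = e00 x * e01 y + e01 x * e11 y"
  "e10 (x * y) = e10 x * e00 y + e11 x * e10 y" "e11 (x * y) = e10 x * e01 y + e11 x * e11 (y :: 'a::ring_1 m2)"
  by (simp_all add: times_m2_def)

context nbs
begin

definition lax_op :: "complex \<Rightarrow> complex \<Rightarrow> nat \<Rightarrow> op m2" where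
  "lax_op s z i = M2
    (inverse s *\<^sub>c (z *\<^sub>c kk True s i - inverse z *\<^sub>c kk False s i)) ((s\<^sup>2 - inverse (s\<^sup>2)) *\<^sub>c ff False s i)
    ((s\<^sup>2 - inverse (s\<^sup>2)) *\<^sub>c ff True s i) (s *\<^sub>c (z *\<^sub>c kk False s i - inverse z *\<^sub>c kk True s i))"

definition "monodromy_op s z = rprod (lax_op s z) L"

lemma monodromy_blocks:
  assumes "l \<le> L"
  shows "\<exists>A B C E. monodromy N L s z l = (A, B, C, E) \<and> {A, B, C, E} \<subseteq> carrier_mat D D \<and>
    M2 (block_op D A) (block_op D B) (block_op D C) (block_op D E) = rprod (lax_op s z) l"
  using assms
proof (induct l)
  case 0
  have "M2 (block_op D (1\<^sub>m D)) (block_op D (0\<^sub>m D D)) (block_op D (0\<^sub>m D D)) (block_op D (1\<^sub>m D)) = 1"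
    by (simp add: block_op_one[OF D_pos] block_op_zero one_m2_def)
  then show ?case by simp
next
  case (Suc l)
  then obtain A B C E where m: "monodromy N L s z l = (A, B, C, E)"
    "A \<in> carrier_mat D D" "B \<in> carrier_mat D D" "C \<in> carrier_mat D D" "E \<in> carrier_mat D D"
    "M2 (block_op D A) (block_op D B) (block_op D C) (block_op D E) = rprod (lax_op s z) l" by auto
  obtain A' B' C' E' where lx: "lax N L s z (Suc l) = (A', B', C', E')" by (metis prod_cases4)
  have i: "1 \<le> Suc l" "Suc l \<le> L" using Suc by simp_all
  note c = at_site_carrier[OF i local_carrier(1)] at_site_carrier[OF i local_carrier(2)] at_site_carrier[OF i local_carrier(3)]
  have cd: "z \<cdot>\<^sub>m at_site N L (Suc l) (k_half N u) - inverse z \<cdot>\<^sub>m at_site N L (Suc l) (k_half N v) \<in> carrier_mat D D" for u v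
    by (intro minus_carrier_mat smult_carrier_mat c(1))
  have lc: "A' \<in> carrier_mat D D" "B' \<in> carrier_mat D D" "C' \<in> carrier_mat D D" "E' \<in> carrier_mat D D"
    using lx c cd unfolding lax_def k_half_inv_eq by auto
  have bl: "M2 (block_op D A') (block_op D B') (block_op D C') (block_op D E') = lax_op s z (Suc l)"
    using lx c cd unfolding lax_def k_half_inv_eq
    by (auto simp: lax_op_def block_op_smult block_op_diff kk_def ff_def site_def wp_def)
  have "M2 (block_op D (A' * A + B' * C)) (block_op D (A' * B + B' * E)) (block_op D (C' * A + E' * C)) (block_op D (C' * B + E' * E))
      = rprod (lax_op s z) (Suc l)"
    unfolding rprod.simps bl[symmetric] m(6)[symmetric] m2_simps
    using m(2-5) lc by (simp add: block_op_add[of _ D] block_op_mult[of _ D] mult_carrier_mat[of _ D D])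
  moreover have "monodromy N L s z (Suc l) = (A' * A + B' * C, A' * B + B' * E, C' * A + E' * C, C' * B + E' * E)"
    by (simp add: lx m(1))
  moreover have "{A' * A + B' * C, A' * B + B' * E, C' * A + E' * C, C' * B + E' * E} \<subseteq> carrier_mat D D"
    using m(2-5) lc by (auto intro!: add_carrier_mat mult_carrier_mat[of _ D D])
  ultimately show ?case by blast
qed

lemma tau: "tau_NBS N L z \<in> carrier_mat D D" "block_op D (tau_NBS N L z) = e00 (monodromy_op s0 z) + e11 (monodromy_op s0 z)"
proof -
  obtain A B C E where m: "monodromy N L s0 z L = (A, B, C, E)" "{A, B, C, E} \<subseteq> carrier_mat D D"
    "M2 (block_op D A) (block_op D B) (block_op D C) (block_op D E) = monodromy_op s0 z"
    unfolding monodromy_op_def using monodromy_blocks[of L s0 z] by blast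
  then have t: "tau_NBS N L z = A + E" by (simp add: tau_NBS_def transfer_matrix_def)
  show "tau_NBS N L z \<in> carrier_mat D D" using m t by simp
  show "block_op D (tau_NBS N L z) = e00 (monodromy_op s0 z) + e11 (monodromy_op s0 z)"
    unfolding t m(3)[symmetric] using m(2) by (simp add: block_op_add)
qed

lemma rprod_lim:
  assumes "\<And>i. i \<in> {1..l} \<Longrightarrow> op_lim D F (\<lambda>s. e00 (M s i)) (e00 (M0 i)) \<and> op_lim D F (\<lambda>s. e01 (M s i)) (e01 (M0 i)) \<and>
    op_lim D F (\<lambda>s. e10 (M s i)) (e10 (M0 i)) \<and> op_lim D F (\<lambda>s. e11 (M s i)) (e11 (M0 i))"
  shows "op_lim D F (\<lambda>s. e00 (rprod (M s) l)) (e00 (rprod M0 l)) \<and> op_lim D F (\<lambda>s. e01 (rprod (M s) l)) (e01 (rprod M0 l)) \<and>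
    op_lim D F (\<lambda>s. e10 (rprod (M s) l)) (e10 (rprod M0 l)) \<and> op_lim D F (\<lambda>s. e11 (rprod (M s) l)) (e11 (rprod M0 l))"
  using assms
proof (induct l)
  case 0
  show ?case using D_pos by (simp add: one_m2_def op_lim_const Ops_closed)
next
  case (Suc l)
  note ih = Suc(1)[OF Suc(2)] and j = Suc(2)[of "Suc l"]
  show ?case unfolding rprod.simps m2_sel_mult
    using ih j by (auto intro!: op_lim_add op_lim_mult)
qed

lemma monodromy_op_lim:
  "op_lim D (at s0) (\<lambda>s. e00 (monodromy_op s z)) (e00 (monodromy_op s0 z))" "op_lim D (at s0) (\<lambda>s. e01 (monodromy_op s z)) (e01 (monodromy_op s0 z))"
  "op_lim D (at s0) (\<lambda>s. e10 (monodromy_op s z)) (e10 (monodromy_op s0 z))" "op_lim D (at s0) (\<lambda>s. e11 (monodromy_op s z)) (e11 (monodromy_op s0 z))"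
proof -
  have i: "((\<lambda>s. inverse s) \<longlongrightarrow> inverse s0) (at s0)" "((\<lambda>s. s\<^sup>2 - inverse (s\<^sup>2)) \<longlongrightarrow> s0\<^sup>2 - inverse (s0\<^sup>2)) (at s0)"
    "((\<lambda>s. s) \<longlongrightarrow> s0) (at s0)"
    by (intro tendsto_intros; simp)+
  have lax_op: "op_lim D (at s0) (\<lambda>s. e00 (lax_op s z i)) (e00 (lax_op s0 z i)) \<and> op_lim D (at s0) (\<lambda>s. e01 (lax_op s z i)) (e01 (lax_op s0 z i)) \<and>
    op_lim D (at s0) (\<lambda>s. e10 (lax_op s z i)) (e10 (lax_op s0 z i)) \<and> op_lim D (at s0) (\<lambda>s. e11 (lax_op s z i)) (e11 (lax_op s0 z i))"
    if "i \<in> {1..L}" for i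
    unfolding lax_op_def m2.sel
    by (intro conjI op_lim_csc op_lim_diff kk_lim ff_lim that i tendsto_const)
  show "op_lim D (at s0) (\<lambda>s. e00 (monodromy_op s z)) (e00 (monodromy_op s0 z))" "op_lim D (at s0) (\<lambda>s. e01 (monodromy_op s z)) (e01 (monodromy_op s0 z))"
    "op_lim D (at s0) (\<lambda>s. e10 (monodromy_op s z)) (e10 (monodromy_op s0 z))" "op_lim D (at s0) (\<lambda>s. e11 (monodromy_op s z)) (e11 (monodromy_op s0 z))"
    unfolding monodromy_op_def using rprod_lim[of L "at s0" "\<lambda>s. lax_op s z" "lax_op s0 z", OF lax_op] by blast+
qed

lemma lx_eq_lax_op:
  assumes "good s" "z \<noteq> 0"
  shows "lax_chain.lx (wp (p \<noteq> q) s) (wp (\<not> q) s) (if p \<noteq> q then 1 else - 1) (if p \<noteq> q then z else - inverse z)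
    (kk p s) (kk (\<not> p) s) (ff q s) (ff (\<not> q) s) i = (if q then swap_m2 (lax_op s z i) else lax_op s z i)"
proof -
  interpret lc: lax_chain loc L "wp (p \<noteq> q) s" "wp (\<not> q) s" "if p \<noteq> q then 1 else - 1" "if p \<noteq> q then z else - inverse z"
    c "kk p s" "kk (\<not> p) s" "ff q s" "ff (\<not> q) s" for c
    by (rule lax_chain[OF assms])
  have neg: "- (a *\<^sub>c x) + b *\<^sub>c y = b *\<^sub>c y - a *\<^sub>c x" for a b and x y :: op by simp
  have sq: "(inverse s)\<^sup>2 = inverse (s\<^sup>2)" by (simp add: power_inverse)
  have m: "(- 1 * (inverse (s\<^sup>2) - s\<^sup>2)) = s\<^sup>2 - inverse (s\<^sup>2)" by simp
  show ?thesis
    unfolding lc.lx_def lc.lx_a_def lc.lx_b_def lc.lx_c_def lc.lx_d_def lc.d_def lax_op_def swap_m2_def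
    by (cases p; cases q) (simp_all add: wp_def sq)
qed

lemma G_transfer:
  assumes "z \<noteq> 0"
  defines "\<tau> \<equiv> e00 (monodromy_op s0 z) + e11 (monodromy_op s0 z)"
  shows "(\<tau> * G p q - G p q * \<tau>) * P = 0"
proof -
  define w where "w s = wp (p \<noteq> q) s" for s
  define y where "y s i = gen_scale q s * ((wp (\<not> q) s)\<^sup>2) ^ i *
      ((if p \<noteq> q then 1 else - 1) * wp (\<not> q) s * (if p \<noteq> q then z else - inverse z) * inverse (w s))" for s i
  \<comment> \<open>For the C's the auxiliary basis is flipped: a and d change places, and the lower
    left entry takes the role of b.\<close>
  define a where "a s = (if q then e11 (monodromy_op s z) else e00 (monodromy_op s z))" for s
  define d where "d s = (if q then e00 (monodromy_op s z) else e11 (monodromy_op s z))" for s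
  define b where "b s = (if q then e10 (monodromy_op s z) else e01 (monodromy_op s z))" for s
  define l where "l s = (a s + d s) * dpow s N (gen p q s) - dpow s N (gen p q s) * (a s + d s)" for s
  define r where "r s = (w s ^ (2 * N) - 1) *\<^sub>c (dpow s N (gen p q s) * a s) +
      (inverse (w s) ^ (2 * N) - 1) *\<^sub>c (dpow s N (gen p q s) * d s) +
      w s *\<^sub>c (dpow s (N - 1) (gen p q s) * b s * (y s L *\<^sub>c A_at (wp (\<not> p) s) - y s 0 *\<^sub>c A_at (wp p s)))" for s
  \<comment> \<open>The divided power of order N - 1 is evaluated at \<open>s0\<close> directly, as
    [N-1]! is nonzero there; order N appears only through the limit \<open>G p q\<close>.\<close>
  define r0 where "r0 = (w s0 ^ (2 * N) - 1) *\<^sub>c (G p q * a s0) + (inverse (w s0) ^ (2 * N) - 1) *\<^sub>c (G p q * d s0) +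
      w s0 *\<^sub>c (dpow s0 (N - 1) (gen p q s0) * b s0 * (y s0 L *\<^sub>c A_at (wp (\<not> p) s0) - y s0 0 *\<^sub>c A_at (wp p s0)))"
  have ad: "a s0 + d s0 = \<tau>" by (simp add: a_def d_def \<tau>_def add.commute)
  have g: "s0 \<noteq> 0" "s0\<^sup>2 - inverse (s0\<^sup>2) \<noteq> 0" using s0_good by (simp_all add: good_def)
  have lims: "op_lim D (at s0) a (a s0)" "op_lim D (at s0) d (d s0)" "op_lim D (at s0) b (b s0)"
    unfolding a_def[abs_def] d_def[abs_def] b_def[abs_def] using monodromy_op_lim by auto
  have wl: "(w \<longlongrightarrow> w s0) (at s0)" unfolding w_def by (rule tendsto_wp)
  have w0: "w s0 \<noteq> 0" unfolding w_def by (rule wp_s0)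
  have yl: "((\<lambda>s. y s i) \<longlongrightarrow> y s0 i) (at s0)" for i
    unfolding y_def using w0 by (intro tendsto_mult tendsto_gen_scale tendsto_const tendsto_wp tendsto_inverse wl)
  have AAl: "op_lim D (at s0) (\<lambda>s. A_at (wp r s)) (A_at (wp r s0))" for r
    unfolding A_at_kk[symmetric] by (intro op_lim_oprod D_pos kk_lim)
  have l_lim: "op_lim D (at s0) l (\<tau> * G p q - G p q * \<tau>)"
    unfolding l_def[abs_def] ad[symmetric] by (intro op_lim_diff op_lim_mult op_lim_add lims G_lim)
  have r_lim: "op_lim D (at s0) r r0"
    unfolding r_def[abs_def] r0_def using q_fact_s0[of "N - 1"] N_pos w0
    by (intro op_lim_add op_lim_diff op_lim_csc op_lim_mult lims G_lim AAl yl wl tendsto_diff tendsto_power tendsto_const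
        tendsto_inverse op_lim_dpow D_pos gen_lim tendsto_q_fact g) auto
  have "\<forall>\<^sub>F s in at s0. l s = r s"
    using eventually_generic
  proof eventually_elim
    case (elim s)
    interpret lc: lax_chain loc L "wp (p \<noteq> q) s" "wp (\<not> q) s" "if p \<noteq> q then 1 else - 1" "if p \<noteq> q then z else - inverse z"
      "gen_scale q s" "kk p s" "kk (\<not> p) s" "ff q s" "ff (\<not> q) s"
      by (rule lax_chain) (use elim assms in auto)
    have mono: "rprod lc.lx L = (if q then swap_m2 (monodromy_op s z) else monodromy_op s z)"
    proof -
      have "rprod lc.lx L = rprod (\<lambda>i. if q then swap_m2 (lax_op s z i) else lax_op s z i) L"
        using lx_eq_lax_op[of s z p q] elim assms by (intro arg_cong[of _ _ "\<lambda>f. rprod f L"] ext) simp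
      then show ?thesis by (cases q) (simp_all add: monodromy_op_def rprod_swap_m2)
    qed
    have e: "e00 (rprod lc.lx L) = a s" "e11 (rprod lc.lx L) = d s" "e01 (rprod lc.lx L) = b s"
      unfolding mono by (simp_all add: a_def d_def b_def swap_m2_def)
    have XX: "lc.XX = gen p q s" unfolding lc.XX_def by (simp add: gen_def lc.X_def[abs_def])
    have KK: "lc.KK = A_at (wp p s)" "lc.KK' = A_at (wp (\<not> p) s)" by (simp_all add: lc.KK_def lc.KK'_def A_at_kk)
    have yy: "lc.y i = y s i" for i unfolding lc.y_def y_def w_def ..
    have n: "Suc (N - 1) = N" using N_pos by simp
    have "qi (wp (p \<noteq> q) s) (int (Suc (N - 1))) \<noteq> 0"
      unfolding n using elim N_pos by (auto simp: wp_def qi_inverse)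
    from lc.transfer_commutator[OF this] show ?case
      unfolding e XX KK yy dpow_wp n l_def r_def w_def .
  qed
  from op_lim_cong[OF this r_lim] have eq: "\<tau> * G p q - G p q * \<tau> = r0"
    by (rule op_lim_unique[OF at_s0_not_bot l_lim])
  have s2N: "s0 ^ (2 * N) = 1" using s_root_power_eq_1[OF N_pos, of N] by simp
  then have w2N: "w s0 ^ (2 * N) = 1" "inverse (w s0) ^ (2 * N) = 1"
    by (simp_all add: w_def wp_def power_inverse)
  have "y s0 L = y s0 0"
  proof -
    have "s0 ^ (2 * L) = 1" using s_root_power_eq_1[OF N_pos, of L] L by simp
    then have "((wp (\<not> q) s0)\<^sup>2) ^ L = 1" by (simp add: wp_def power_inverse power_mult[symmetric])
    then show ?thesis by (simp add: y_def)
  qed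
  then have r0: "r0 = (w s0 * y s0 0) *\<^sub>c (dpow s0 (N - 1) (gen p q s0) * b s0 * (A_at (wp (\<not> p) s0) - A_at (wp p s0)))"
    unfolding r0_def w2N by (simp add: csc_diff_right right_diff_distrib)
  have "A_at (wp r s0) * P = A_at s0 * P" for r
  proof -
    have "inverse s0 powi m = s0 powi m" if "int N dvd m" for m
    proof -
      have "s0 powi m * s0 powi m = 1"
        using s_root_powi_eq_1[OF N_pos, of m] that by (simp add: power_int_add[symmetric])
      then have "inverse (s0 powi m) = s0 powi m" by (rule inverse_unique)
      then show ?thesis by (simp add: power_int_inverse)
    qed
    then show ?thesis
      unfolding P_def A_at_dg[OF wp_s0] A_at_dg[OF s_root_nonzero] dg_mult
      by (intro dg_cong) (simp add: wp_def W_def)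
  qed
  from this[of p] this[of "\<not> p"] show ?thesis
    unfolding eq r0 by (simp add: mult.assoc left_diff_distrib)
qed

text \<open>The transfer matrix conserves the total weight, so it commutes with every function of
  it; this covers both \<open>P\<close> and \<open>H\<close>.\<close>

lemma tau_weight:
  assumes "z \<noteq> 0"
  defines "\<tau> \<equiv> e00 (monodromy_op s0 z) + e11 (monodromy_op s0 z)"
  shows "\<tau> * dg (\<lambda>a. g (wt N L a)) = dg (\<lambda>a. g (wt N L a)) * \<tau>"
proof -
  interpret lc: lax_chain loc L "wp (True \<noteq> False) s0" "wp (\<not> False) s0" "if True \<noteq> False then 1 else - 1"
    "if True \<noteq> False then z else - inverse z" 1 "kk True s0" "kk (\<not> True) s0" "ff False s0" "ff (\<not> False) s0"
    by (rule lax_chain[OF s0_good assms(1)])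
  have lx: "rprod lc.lx L = monodromy_op s0 z"
    unfolding monodromy_op_def using lx_eq_lax_op[OF s0_good assms(1), of True False] by (intro arg_cong[of _ _ "\<lambda>f. rprod f L"] ext) simp
  have "rprod lc.lx L * (lc.G 2 * emb (oprod (\<lambda>i. site N L i (k_half N 2)) L)) =
     lc.G 2 * emb (oprod (\<lambda>i. site N L i (k_half N 2)) L) * rprod lc.lx L"
    by (rule lc.weight_chain) (auto simp: site_loc site_k_k site_k_f)
  then have conserved: "rprod lc.lx L * (lc.G 2 * emb (A_at 2)) = lc.G 2 * emb (A_at 2) * rprod lc.lx L"
    unfolding A_at_oprod .
  have two: "(2::complex) \<noteq> 0" by simp
  note lc.weight_chain_entries(1,2)[OF two conserved]
  then have "e00 (monodromy_op s0 z) * A_at 2 = A_at 2 * e00 (monodromy_op s0 z)" "e11 (monodromy_op s0 z) * A_at 2 = A_at 2 * e11 (monodromy_op s0 z)"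
    unfolding lx .
  then have "A_at 2 * \<tau> = \<tau> * A_at 2" by (simp add: \<tau>_def distrib_left distrib_right)
  then have comm: "block_op D (diagm D (\<lambda>a. 2 powi wt N L a)) * \<tau> = (2 powi 0) *\<^sub>c (\<tau> * block_op D (diagm D (\<lambda>a. 2 powi wt N L a)))"
    by (simp add: A_at_dg dg_def)
  have O: "\<tau> \<in> Ops D" unfolding \<tau>_def tau(2)[symmetric] by (rule block_op_in_Ops) (rule tau)
  show ?thesis
  proof (rule Ops_eqI[of _ D])
    fix a b assume ab: "a < D" "b < D"
    have "wt N L a = wt N L b" if "ent \<tau> a b \<noteq> 0"
      using ent_weight[OF O ab that comm] by simp
    then show "ent (\<tau> * dg (\<lambda>a. g (wt N L a))) a b = ent (dg (\<lambda>a. g (wt N L a)) * \<tau>) a b"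
      unfolding ent_dg_mult[OF O ab] by (cases "ent \<tau> a b = 0") simp_all
  qed (intro Ops_closed O dg_Ops)+
qed

end

section \<open>The representation on the sector\<close>

text \<open>Eigenvalues of the bracket with a diagonal operator are differences of its values, here
  finitely many.\<close>

lemma diag_eventually_bounded:
  assumes "finite (range d)"
  obtains M where "\<And>y n. n \<ge> M \<Longrightarrow> br (diag d) y = of_nat n *\<^sub>c y \<Longrightarrow> y = 0"
proof -
  define S where "S = (\<lambda>(x, y). x - y) ` (range d \<times> range d)"
  have "finite S" using assms by (simp add: S_def)
  then have "finite (of_nat -` S :: nat set)" by (rule finite_vimageI) (simp add: inj_def)
  then obtain M where M: "\<And>n. of_nat n \<in> S \<Longrightarrow> n < M"
    unfolding finite_nat_set_iff_bounded by auto
  show ?thesis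
  proof (rule that)
    fix y n assume "n \<ge> M" "br (diag d) y = of_nat n *\<^sub>c y"
    moreover have "d a - d b \<noteq> of_nat n" for a b
    proof
      assume "d a - d b = of_nat n"
      then have "of_nat n \<in> S" unfolding S_def by (intro image_eqI[of _ _ "(d a, d b)"]) simp_all
      then show False using M[of n] \<open>n \<ge> M\<close> by simp
    qed
    ultimately show "y = 0" using diag_bounded[OF assms] by blast
  qed
qed

lemma diagm_mult_vec:
  assumes "v \<in> carrier_vec n" "a < n"
  shows "(diagm n g *\<^sub>v v) $ a = g a * v $ a"
proof -
  have "(diagm n g *\<^sub>v v) $ a = (\<Sum>b<n. diagm n g $$ (a, b) * v $ b)"
    using assms carrier_matD[OF diagm_carrier[of n g]] by (auto simp: scalar_prod_def atLeast0LessThan)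
  also have "\<dots> = (\<Sum>b<n. if b = a then g b * v $ b else 0)"
    by (intro sum.cong) (use assms in \<open>auto simp: diagm_index\<close>)
  finally show ?thesis using assms(2) by simp
qed

lemma op_vec_mult:
  assumes "x \<in> Ops n" "y \<in> Ops n" "v \<in> carrier_vec n"
  shows "op_vec n (x * y) v = op_vec n x (op_vec n y v)"
proof -
  obtain M M' where M: "x = block_op n M" "M \<in> carrier_mat n n" "y = block_op n M'" "M' \<in> carrier_mat n n"
    using assms by (auto simp: Ops_def)
  then show ?thesis
    using assms(3) by (simp add: block_op_mult[symmetric] op_vec_block_op[of _ n] mult_carrier_mat[of _ n n]
        mult_mat_vec_carrier[of _ n n] assoc_mult_mat_vec[of _ n n])
qed

context nbs
begin

text \<open>The Cartan relation holds only after multiplication by \<open>P\<close>. As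
  \<open>P\<close> is idempotent and commutes with the generators, the truncated ones satisfy it
  identically.\<close>

definition gen_W :: "bool \<Rightarrow> bool \<Rightarrow> op" where
  "gen_W p q = P * G p q"

lemma gen_W_mult: "gen_W p q * gen_W p' q' = (G p q * G p' q') * P"
proof -
  have "gen_W p q * gen_W p' q' = P * (G p q * P) * G p' q'" by (simp add: gen_W_def mult.assoc)
  also have "\<dots> = (P * P) * G p q * G p' q'" by (simp add: P_G[symmetric] mult.assoc)
  also have "\<dots> = (G p q * G p' q') * P" by (simp add: P_idem P_G mult.assoc)
  finally show ?thesis .
qed

lemma br_gen_W: "br (gen_W p True) (gen_W p False) = P * H"
  unfolding br_def gen_W_mult left_diff_distrib[symmetric] G_commutator P_H ..

lemma br_gen_W_commute: "br (gen_W True q) (gen_W False q) = 0"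
  by (simp add: br_def gen_W_mult G_commute)

lemma br_H_gen_W: "br (P * H) (gen_W p q) = of_int (shift q) *\<^sub>c gen_W p q"
proof -
  have "(P * H) * gen_W p q = P * (H * P) * G p q" by (simp add: gen_W_def mult.assoc)
  also have "\<dots> = (P * P) * (H * G p q)" by (simp add: P_H[symmetric] mult.assoc)
  finally have 1: "(P * H) * gen_W p q = P * (H * G p q)" by (simp add: P_idem)
  have "gen_W p q * (P * H) = P * (G p q * P) * H" by (simp add: gen_W_def mult.assoc)
  also have "\<dots> = (P * P) * (G p q * H)" by (simp add: P_G[symmetric] mult.assoc)
  finally have 2: "gen_W p q * (P * H) = P * (G p q * H)" by (simp add: P_idem)
  show ?thesis unfolding br_def 1 2 right_diff_distrib[symmetric] H_G by (simp add: gen_W_def)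
qed

text \<open>The generators are the truncated limits of C+, B-, C-, B+, that is E_1, F_1, F_0, E_0,
  in the roles of e, f, e times t^-1 and f times t. Weights are bounded because the diagonal depends
  only on the index modulo \<open>D\<close>.\<close>

lemma chevalley: "chevalley (gen_W False True) (gen_W False False) (gen_W True True) (gen_W True False) (P * H)"
proof -
  define h where "h = P * H"
  have h0: "br (gen_W False True) (gen_W False False) = h" "br (gen_W True True) (gen_W True False) = h"
    by (simp_all add: br_gen_W h_def)
  have he: "br h (gen_W p True) = 2 *\<^sub>c gen_W p True" and hf: "br h (gen_W p False) = - (2 *\<^sub>c gen_W p False)" for p
    using br_H_gen_W[of p True] br_H_gen_W[of p False] by (simp_all add: h_def shift_def)
  define d where "d a = (if W (a mod D) then 1 else 0) * (of_int (wt N L (a mod D)) / of_nat N :: complex)" for a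
  have hd: "h = diag d"
    unfolding h_def P_def H_def dg_mult unfolding dg_def block_op_diagm[OF D_pos] d_def ..
  have "range d \<subseteq> (\<lambda>a. (if W a then 1 else 0) * (of_int (wt N L a) / of_nat N)) ` {..<D}"
    unfolding d_def[abs_def] using D_pos by auto
  then have fin: "finite (range d)" by (rule finite_subset) simp
  have "range (\<lambda>a. - d a) = uminus ` range d" by auto
  then have fin': "finite (range (\<lambda>a. - d a))" using fin by simp
  have hd': "- h = diag (\<lambda>a. - d a)" unfolding hd by (rule op_eqI) simp
  obtain M where M: "\<And>y n. n \<ge> M \<Longrightarrow> br h y = of_nat n *\<^sub>c y \<Longrightarrow> y = 0"
    unfolding hd using diag_eventually_bounded[OF fin] by blast
  obtain M' where M': "\<And>y n. n \<ge> M' \<Longrightarrow> br (- h) y = of_nat n *\<^sub>c y \<Longrightarrow> y = 0"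
    unfolding hd' using diag_eventually_bounded[OF fin'] by blast
  have c: "br (gen_W p q) (gen_W p' q) = 0" for p p' q
    using br_gen_W_commute[of q] br_swap[of "gen_W False q" "gen_W True q"] by (cases p; cases p') simp_all
  \<comment> \<open>(f, e, -h) is again a triple of the required kind, which gives the Serre
    relations for the lowering operators.\<close>
  have swap: "br (gen_W False False) (gen_W False True) = - h" "br (gen_W True False) (gen_W True True) = - h"
    using h0 br_swap[of "gen_W False False"] br_swap[of "gen_W True False"] by simp_all
  have "chevalley (gen_W False True) (gen_W False False) (gen_W True True) (gen_W True False) h"
  proof
    show "br (gen_W False True) (br (gen_W False True) (br (gen_W False True) (gen_W True False))) = 0"
      by (rule serre_of_bounded[OF he h0(1) c hf M])
    show "br (gen_W True True) (br (gen_W True True) (br (gen_W True True) (gen_W False False))) = 0"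
      by (rule serre_of_bounded[OF he h0(2) c hf M])
    show "br (gen_W False False) (br (gen_W False False) (br (gen_W False False) (gen_W True True))) = 0"
      by (rule serre_of_bounded[OF _ swap(1) c _ M']) (simp_all add: he hf)
    show "br (gen_W True False) (br (gen_W True False) (br (gen_W True False) (gen_W False True))) = 0"
      by (rule serre_of_bounded[OF _ swap(2) c _ M']) (simp_all add: he hf)
  qed (rule h0 he hf c)+
  then show ?thesis by (simp add: h_def)
qed

lemma P_mat: "op_vec D P v = vec D (\<lambda>b. if W b then v $ b else 0)" if "v \<in> carrier_vec D"
proof -
  have "op_vec D P v = diagm D (\<lambda>b. if W b then 1 else 0) *\<^sub>v v"
    unfolding P_def dg_def using that by (intro op_vec_block_op) simp_all
  also have "\<dots> = vec D (\<lambda>b. if W b then v $ b else 0)"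
  proof (rule eq_vecI)
    fix a assume "a < dim_vec (vec D (\<lambda>b. if W b then v $ b else 0))"
    then have a: "a < D" by simp
    show "(diagm D (\<lambda>b. if W b then 1 else 0) *\<^sub>v v) $ a = vec D (\<lambda>b. if W b then v $ b else 0) $ a"
      unfolding diagm_mult_vec[OF that a] using a by simp
  qed (simp add: diagm_def)
  finally show ?thesis .
qed

lemma sector_iff: "v \<in> sector N L \<longleftrightarrow> v \<in> carrier_vec D \<and> op_vec D P v = v"
proof (cases "v \<in> carrier_vec D")
  case True
  have A: "A_op N L s0 = diagm D (\<lambda>a. s0 powi wt N L a)" by (simp add: A_op_diagm)
  have "A_op N L s0 ^\<^sub>m 2 = A_op N L s0 * A_op N L s0"
    unfolding numeral_2_eq_2 by (simp add: A diagm_def)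
  also have "\<dots> = diagm D (\<lambda>a. s0 powi (2 * wt N L a))"
    unfolding A diagm_mult by (rule diagm_cong) (simp add: power_int_add[symmetric])
  finally have A2: "A_op N L s0 ^\<^sub>m 2 = diagm D (\<lambda>a. s0 powi (2 * wt N L a))" .
  note entry = diagm_mult_vec[OF True]
  have "v \<in> sector N L \<longleftrightarrow> (\<forall>a<D. s0 powi (2 * wt N L a) * v $ a = v $ a)"
    unfolding sector_def A2 using True entry
    by (auto simp: diagm_def vec_eq_iff)
  also have "\<dots> \<longleftrightarrow> (\<forall>a<D. (if W a then v $ a else 0) = v $ a)"
    using s_root_powi_eq_1[OF N_pos] by (auto simp: W_def)
  also have "\<dots> \<longleftrightarrow> op_vec D P v = v"
    unfolding P_mat[OF True] using True by (auto simp: vec_eq_iff)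
  finally show ?thesis using True by simp
qed (simp add: sector_def)

lemma op_vec_PX:
  assumes "x \<in> Ops D" "P * x = x * P" "v \<in> sector N L"
  shows "op_vec D (P * x) v = op_vec D x v"
  using assms op_vec_mult[OF assms(1) P_Ops, of v] by (simp add: sector_iff)

lemma generator_carrier: "E_hat N L i \<in> carrier_mat D D" "F_hat N L i \<in> carrier_mat D D" "H_hat N L i \<in> carrier_mat D D"
  by (auto simp: E_hat_def F_hat_def H_hat_def divided_power_limit_def mat_lim_def H_N_diagm)

lemma block_op_E: "block_op D (E_hat N L i) = (if i = 0 then G True False else G False True)"
  and block_op_F: "block_op D (F_hat N L i) = (if i = 0 then G True True else G False False)"
  and block_op_H: "block_op D (H_hat N L i) = (if i = 0 then - H else H)"
  by (auto simp: E_hat_def F_hat_def H_hat_def G_def gen_mat_def H_def dg_def H_N_diagm block_op_uminus)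

lemma loop_representation:
  "\<exists>\<rho>. loop_sl2_representation (sector N L) \<rho> \<and>
     (\<forall>i\<in>{0, 1}. \<forall>v\<in>sector N L.
        \<rho> (loop_H i) v = H_hat N L i *\<^sub>v v \<and> \<rho> (loop_E i) v = E_hat N L i *\<^sub>v v \<and> \<rho> (loop_F i) v = F_hat N L i *\<^sub>v v)"
proof -
  interpret ch: chevalley "gen_W False True" "gen_W False False" "gen_W True True" "gen_W True False" "P * H"
    by (rule chevalley)
  define \<rho> where "\<rho> X v = op_vec D (ch.loop_rep X) v" for X v
  have gen_W: "gen_W p q \<in> Ops D \<and> P * gen_W p q = gen_W p q" for p q
    by (simp add: gen_W_def mult.assoc[symmetric] P_idem Ops_closed P_Ops G_Ops)
  \<comment> \<open>Sums, multiples and brackets inherit \<open>P * x = x\<close> from the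
    generators; hence the sector is invariant.\<close>
  have R: "ch.loop_rep X \<in> Ops D \<and> P * ch.loop_rep X = ch.loop_rep X" for X
    by (rule ch.loop_rep_closure)
      (use gen_W in \<open>auto simp: br_def Ops_closed distrib_left right_diff_distrib mult.assoc[symmetric]\<close>)
  have S: "v \<in> carrier_vec D" "op_vec D P v = v" if "v \<in> sector N L" for v
    using that by (simp_all add: sector_iff)
  have inv: "\<rho> X v \<in> sector N L" if "v \<in> sector N L" for X v
    unfolding sector_iff \<rho>_def
    using op_vec_mult[OF P_Ops conjunct1[OF R[of X]] S(1)[OF that]] R[of X] by simp
  have "loop_sl2_representation (sector N L) \<rho>"
    unfolding loop_sl2_representation_def
  proof (intro conjI ballI allI)
    fix X v w c assume X: "X \<in> loop_sl2" and v: "v \<in> sector N L"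
    show "\<rho> X v \<in> sector N L" by (rule inv[OF v])
    show "\<rho> X (c \<cdot>\<^sub>v v) = c \<cdot>\<^sub>v \<rho> X v" unfolding \<rho>_def by (rule op_vec_smult_right[OF S(1)[OF v]])
    show "\<rho> (laurent_const c \<cdot>\<^sub>m X) v = c \<cdot>\<^sub>v \<rho> X v"
      unfolding \<rho>_def ch.loop_rep_smult[OF X] by (rule op_vec_csc_left)
    show "\<rho> X (v + w) = \<rho> X v + \<rho> X w" if "w \<in> sector N L"
      unfolding \<rho>_def by (rule op_vec_add_right[OF S(1)[OF v] S(1)[OF that]])
  next
    fix X Y v assume XY: "X \<in> loop_sl2" "Y \<in> loop_sl2" and v: "v \<in> sector N L"
    show "\<rho> (X + Y) v = \<rho> X v + \<rho> Y v"
      unfolding \<rho>_def ch.loop_rep_add[OF XY] by (rule op_vec_add_left)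
    show "\<rho> (commutator X Y) v = \<rho> X (\<rho> Y v) - \<rho> Y (\<rho> X v)"
      unfolding \<rho>_def ch.loop_rep_commutator[OF XY] br_def op_vec_diff_left
      by (simp add: op_vec_mult R S(1)[OF v])
  qed
  moreover have "\<rho> (loop_H i) v = H_hat N L i *\<^sub>v v \<and> \<rho> (loop_E i) v = E_hat N L i *\<^sub>v v \<and> \<rho> (loop_F i) v = F_hat N L i *\<^sub>v v"
    if "i \<in> {0, 1}" and v: "v \<in> sector N L" for i v
  proof -
    note mv = op_vec_block_op[OF generator_carrier(1) S(1)[OF v], symmetric] op_vec_block_op[OF generator_carrier(2) S(1)[OF v], symmetric]
      op_vec_block_op[OF generator_carrier(3) S(1)[OF v], symmetric]
    \<comment> \<open>The representation contains \<open>P * H\<close> where \<open>H_hat\<close>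
      gives \<open>H\<close>; on the sector \<open>P\<close> acts as the identity.\<close>
    have H: "op_vec D (- (P * H)) v = op_vec D (- H) v"
      using op_vec_PX[OF Ops_closed(6)[OF H_Ops, of "- 1"] _ v] P_H by simp
    show ?thesis
      unfolding mv block_op_E block_op_F block_op_H \<rho>_def using that(1) ch.loop_rep_values H
        op_vec_PX[OF G_Ops P_G v] op_vec_PX[OF H_Ops P_H v]
      by (auto simp: gen_W_def)
  qed
  ultimately show ?thesis by blast
qed

lemma transfer_symmetry:
  assumes z: "z \<noteq> 0" and v: "v \<in> sector N L"
  shows "tau_NBS N L z *\<^sub>v v \<in> sector N L"
    and "commutator (tau_NBS N L z) (H_hat N L i) *\<^sub>v v = 0\<^sub>v D"
    and "commutator (tau_NBS N L z) (E_hat N L i) *\<^sub>v v = 0\<^sub>v D"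
    and "commutator (tau_NBS N L z) (F_hat N L i) *\<^sub>v v = 0\<^sub>v D"
proof -
  define \<tau> where "\<tau> = e00 (monodromy_op s0 z) + e11 (monodromy_op s0 z)"
  have t: "block_op D (tau_NBS N L z) = \<tau>" by (simp add: \<tau>_def tau)
  have O: "\<tau> \<in> Ops D" unfolding t[symmetric] by (rule block_op_in_Ops) (rule tau)
  have w: "\<tau> * dg (\<lambda>a. g (wt N L a)) = dg (\<lambda>a. g (wt N L a)) * \<tau>" for g
    unfolding \<tau>_def by (rule tau_weight[OF z])
  have S: "v \<in> carrier_vec D" "op_vec D P v = v" using v by (simp_all add: sector_iff)
  have tP: "\<tau> * P = P * \<tau>" unfolding P_def W_def using w[of "\<lambda>x. if int N dvd x then 1 else 0"] .
  have tH: "\<tau> * H = H * \<tau>" unfolding H_def using w[of "\<lambda>x. of_int x / of_nat N"] .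
  have tv: "tau_NBS N L z *\<^sub>v v = op_vec D \<tau> v"
    unfolding t[symmetric] by (rule op_vec_block_op[symmetric, OF tau(1) S(1)])
  have "op_vec D P (op_vec D \<tau> v) = op_vec D \<tau> (op_vec D P v)"
    unfolding op_vec_mult[OF P_Ops O S(1), symmetric] tP[symmetric] by (rule op_vec_mult[OF O P_Ops S(1)])
  then show "tau_NBS N L z *\<^sub>v v \<in> sector N L"
    unfolding tv sector_iff by (simp add: S)
  have key: "commutator (tau_NBS N L z) M *\<^sub>v v = 0\<^sub>v D"
    if M: "M \<in> carrier_mat D D" and 0: "(\<tau> * block_op D M - block_op D M * \<tau>) * P = 0" for M
  proof -
    have c: "tau_NBS N L z * M \<in> carrier_mat D D" "M * tau_NBS N L z \<in> carrier_mat D D"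
      using tau(1) M by (auto intro: mult_carrier_mat)
    then have gen_scale: "commutator (tau_NBS N L z) M \<in> carrier_mat D D"
      unfolding commutator_def by (intro minus_carrier_mat)
    have b: "block_op D (commutator (tau_NBS N L z) M) = \<tau> * block_op D M - block_op D M * \<tau>"
      unfolding commutator_def block_op_diff[OF c] block_op_mult[OF tau(1) M] block_op_mult[OF M tau(1)] t ..
    have O': "\<tau> * block_op D M - block_op D M * \<tau> \<in> Ops D"
      by (intro Ops_closed O block_op_in_Ops M)
    have "commutator (tau_NBS N L z) M *\<^sub>v v = op_vec D (\<tau> * block_op D M - block_op D M * \<tau>) (op_vec D P v)"
      unfolding b[symmetric] S(2) by (rule op_vec_block_op[symmetric, OF gen_scale S(1)])
    also have "\<dots> = op_vec D 0 v"
      unfolding op_vec_mult[OF O' P_Ops S(1), symmetric] 0 ..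
    also have "\<dots> = 0\<^sub>v D" by (auto simp: op_vec_def)
    finally show ?thesis .
  qed
  note GT = G_transfer[OF z, folded \<tau>_def]
  show "commutator (tau_NBS N L z) (H_hat N L i) *\<^sub>v v = 0\<^sub>v D"
    by (rule key[OF generator_carrier(3)]) (simp add: block_op_H tH)
  show "commutator (tau_NBS N L z) (E_hat N L i) *\<^sub>v v = 0\<^sub>v D"
    by (rule key[OF generator_carrier(1)]) (simp add: block_op_E GT)
  show "commutator (tau_NBS N L z) (F_hat N L i) *\<^sub>v v = 0\<^sub>v D"
    by (rule key[OF generator_carrier(2)]) (simp add: block_op_F GT)
qed

end

theorem proposition3p1:
  fixes N L :: nat
  assumes "3 \<le> N" and "odd N" and "0 < L" and "N dvd L"
  shows "(\<exists>\<rho>. loop_sl2_representation (sector N L) \<rho> \<and>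
            (\<forall>i\<in>{0, 1}. \<forall>v\<in>sector N L.
               \<rho> (loop_H i) v = H_hat N L i *\<^sub>v v \<and>
               \<rho> (loop_E i) v = E_hat N L i *\<^sub>v v \<and>
               \<rho> (loop_F i) v = F_hat N L i *\<^sub>v v)) \<and>
         (\<forall>z. z \<noteq> 0 \<longrightarrow> (\<forall>v\<in>sector N L.
            tau_NBS N L z *\<^sub>v v \<in> sector N L \<and>
            (\<forall>i\<in>{0, 1}.
               commutator (tau_NBS N L z) (H_hat N L i) *\<^sub>v v = 0\<^sub>v (N ^ L) \<and>
               commutator (tau_NBS N L z) (E_hat N L i) *\<^sub>v v = 0\<^sub>v (N ^ L) \<and>
               commutator (tau_NBS N L z) (F_hat N L i) *\<^sub>v v = 0\<^sub>v (N ^ L))))"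
proof -
  interpret nbs N L using assms by unfold_locales
  show ?thesis using loop_representation transfer_symmetry by blast
qed

end
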